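(* Let $k\ge1$ be an integer and $m\ge1$ an odd integer. Then \begin{align*} r_7(1^6,2;2^{2k}m^2)&=12\left(\frac{2^{5k+5}-63}{2^5-1}\right)s_5(m),\\ r_7(1^5,2^2;2^{2k}m^2)&=r_7(1^6,4;2^{2k}m^2)=\left(\frac{250\times2^{5k}-126}{2^5-1}\right)s_6(m),\\ r_7(1^4,2^3;2^{2k}m^2)&=\left(\frac{198\times2^{5k}-756}{2^5-1}\right)s_5(m),\\ r_7(1^3,2^4;2^{2k}m^2)&=r_7(1^4,2^2,4;2^{2k}m^2)=126\left(\frac{2^{5k}-1}{2^5-1}\right)s_6(m),\\ r_7(1^2,2^5;2^{2k}m^2)&=\left(\frac{105\times2^{5k}-756}{2^5-1}\right)s_5(m),\\ r_7(1^5,4^2;2^{2k}m^2)&=\left(\frac{95\times2^{5k}-126}{2^5-1}\right)s_6(m),\\ r_7(1^3,4^4;2^{2k}m^2)&=r_7(1^2,4^5;2^{2k}m^2)=r_7(1,4^6;2^{2k}m^2)=r_7(1,2^2,4^4;2^{2k}m^2)=\left(\frac{35\times2^{5k-1}-126}{2^5-1}\right)s_6(m),\\ r_7(1^3,2^2,4^2;2^{2k}m^2)&=r_7(1^2,2^4,4;2^{2k}m^2)=r_7(1,2^6;2^{2k}m^2)=\left(\frac{2^{5k+6}-126}{2^5-1}\right)s_6(m),\\ r_7(1^2,2^2,4^3;2^{2k}m^2)&=r_7(1,2^4,4^2;2^{2k}m^2)=r_7(1^4,4^3;2^{2k}m^2)=\left(\frac{33\times2^{5k}-126}{2^5-1}\right)s_6(m).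 \end{align*}
   Context: For ${\bf a}=(a_1,\ldots,a_7)$ of positive integers, $r_7({\bf a};N)=\#\{x\in\mathbb{Z}^7:\sum a_ix_i^2=N\}$; exponents denote multiplicities, e.g. $(1^5,2^2)=(1,1,1,1,1,2,2)$. For odd $m=\prod_{p\ge3}p^{\lambda_p}$ (over odd primes $p$), with Legendre symbols, $$s_5(m)=\prod_{p\ge3}\left(\frac{p^{5\lambda_p+5}-1}{p^5-1}-p^2\left(\frac{-2}{p}\right)\frac{p^{5\lambda_p}-1}{p^5-1}\right),\qquad s_6(m)=\prod_{p\ge3}\left(\frac{p^{5\lambda_p+5}-1}{p^5-1}-p^2\left(\frac{-4}{p}\right)\frac{p^{5\lambda_p}-1}{p^5-1}\right).$$ *)

theory Defs
  imports Complex_Main "HOL-Number_Theory.Number_Theory"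
begin

text \<open>
  The coefficient vector is a list of seven positive integers, and the vectors of
  $\mathbb{Z}^7$ are the integer lists of length 7. Positivity of the coefficients makes the
  counted set finite; \<open>card\<close> gives no information for other coefficient lists.
\<close>

definition r7 :: "nat list \<Rightarrow> nat \<Rightarrow> nat" where
  "r7 a N = card {x :: int list. length x = 7 \<and> (\<Sum>i<7. int (a ! i) * (x ! i)\<^sup>2) = int N}"

text \<open>
  For odd \<open>m\<close> all prime factors are odd. The product may be restricted to them because the
  factor of a prime with exponent 0 is 1.
\<close>

definition s_prod :: "int \<Rightarrow> nat \<Rightarrow> real" where
  "s_prod d m =
    (\<Prod>p\<in>prime_factors m.
       (real p ^ (5 * multiplicity p m + 5) - 1) / (real p ^ 5 - 1)
       - real p ^ 2 * of_int (Legendre d (int p))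
         * ((real p ^ (5 * multiplicity p m) - 1) / (real p ^ 5 - 1)))"

definition s5 :: "nat \<Rightarrow> real" where
  "s5 m = s_prod (-2) m"

definition s6 :: "nat \<Rightarrow> real" where
  "s6 m = s_prod (-4) m"

text \<open>\<open>mults i j l\<close> is the coefficient vector $(1^i, 2^j, 4^l)$, exponents denoting multiplicities.\<close>

definition mults :: "nat \<Rightarrow> nat \<Rightarrow> nat \<Rightarrow> nat list" where
  "mults i j l = replicate i 1 @ replicate j 2 @ replicate l 4"

end

theory Submission
  imports Defs "HOL-Computational_Algebra.Formal_Laurent_Series"
begin

text \<open>
  The number of representations of $N^2$ by $x_1^2 + Q(x_2,\ldots,x_7)$ is
  $\sum_j r_Q(N^2 - j^2)$. If a series $\sum b(n) q^n$ of weight 3 satisfies the Hecke relation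
  $b(m) b(n) = \sum_{t \mid (m, n)} \chi(t) t^2 b(m n / t^2)$, then the factorisation
  $N^2 - j^2 = (N - j)(N + j)$ shows, following Selberg, that the coefficient of
  $(\sum b(n) q^n)^2$ at $2N$ equals $\sum_{t \mid N} \chi(t) t^2 \sum_j b((N/t)^2 - j^2)$. The senary theta
  series needed here are combinations of Eisenstein series of weight 3 (and, in one case, a series that
  contributes nothing at even $N$), and the squares of the latter are Eisenstein series
  of weight 6 on even exponents (on multiples of 4 for the character of conductor 8), since
  the cusp forms of level 4 and 8 vanish there. Dirichlet inversion then turns sums of fifth powers of divisors
  into the products $s_5$ and $s_6$.

  The identities between theta series and divisor sums are elementary: convolutions of divisor
  sums at odd exponents come from Liouville's identity, and the coefficients at even
  exponents are handled by the substitution $q \mapsto q^2$, so that both sides of each identity are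
  determined by the same recursion.
\<close>

section \<open>Liouville's identity\<close>

text \<open>Modular forms enter only through polynomials. Let X = \<open>tX\<close> and Y =
  \<open>tY\<close> be the even and odd parts of theta(q)^2. Up to constants, the Eisenstein series
  of weight 3 and 6 are polynomials in X and Y, times \<open>theta * dil theta\<close> when the
  conductor is 8, and q -> q^2 acts by X + Y -> X and 4 X Y -> Y^2, a step of the
  arithmetic-geometric mean. Dimension arguments thus become polynomial identities: a series is
  fixed by its constant term and a relation to its own dilation. What separates the squares of
  weight 3 series from dilated Eisenstein series is Y times an even series, visible at odd exponents
  only; for conductor 8 this takes two successive halvings of the exponent. The condition k >= 1
  makes the represented number 4 t with t a square. Split theta = c + b into even and odd j; then
  b^q c^(7-q) has exponents congruent to q modulo 4, so only q = 0 and q = 4 contribute. Hence the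
  forms with \<open>s6\<close> are told apart only by the coefficient of b^4 in their theta product,
  which is 15, 7, 5, 3, 1 or 0.\<close>

definition quads :: "nat \<Rightarrow> (nat \<times> nat \<times> nat \<times> nat) set" where
  "quads n = {(a, b, x, y). 0 < a \<and> 0 < b \<and> 0 < x \<and> 0 < y \<and> a * x + b * y = n}"

lemma finite_quads [simp, intro]: "finite (quads n)"
proof (rule finite_subset)
  show "quads n \<subseteq> {..n} \<times> {..n} \<times> {..n} \<times> {..n}"
  proof (clarsimp simp: quads_def)
    fix a b x y :: nat
    assume "0 < a" "0 < b" "0 < x" "0 < y"
    then have "a * 1 \<le> a * x" "1 * x \<le> a * x" "b * 1 \<le> b * y" "1 * y \<le> b * y"
      by (intro mult_le_mono; simp)+
    then show "a \<le> a * x + b * y \<and> b \<le> a * x + b * y \<and> x \<le> a * x + b * y \<and> y \<le> a * x + b * y"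
      by linarith
  qed
qed auto

lemma sum_quads_exchange:
  "(\<Sum>(a, b, x, y)\<in>quads n. h x y a b) = (\<Sum>(a, b, x, y)\<in>quads n. h a b x y)"
  by (rule sum.reindex_bij_witness[where i = "\<lambda>(a, b, x, y). (x, y, a, b)" and j = "\<lambda>(a, b, x, y). (x, y, a, b)"])
    (auto simp: quads_def mult.commute)

lemma sum_quads_split:
  fixes h :: "nat \<Rightarrow> nat \<Rightarrow> nat \<Rightarrow> nat \<Rightarrow> real"
  shows "(\<Sum>(a, b, x, y)\<in>quads n. h a b x y) =
    (\<Sum>(a, b, x, y)\<in>{(a, b, x, y)\<in>quads n. b < a}. h a b x y + h b a y x) +
    (\<Sum>(a, b, x, y)\<in>{(a, b, x, y)\<in>quads n. a = b}. h a b x y)"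
proof -
  let ?h = "\<lambda>(a, b, x, y). h a b x y"
  let ?R = "{(a, b, x, y)\<in>quads n. b < a}" and ?L = "{(a, b, x, y)\<in>quads n. a < b}"
    and ?D = "{(a, b, x, y)\<in>quads n. a = b}"
  have fin: "finite ?R" "finite ?L" "finite ?D"
    by (rule finite_subset[OF _ finite_quads[of n]]; blast)+
  have "sum ?h (quads n) = sum ?h (?R \<union> ?L \<union> ?D)"
    by (rule arg_cong[where f = "sum ?h"]) auto
  also have "\<dots> = sum ?h (?R \<union> ?L) + sum ?h ?D"
    using fin by (intro sum.union_disjoint) auto
  also have "sum ?h (?R \<union> ?L) = sum ?h ?R + sum ?h ?L"
    using fin by (intro sum.union_disjoint) auto
  also have "sum ?h ?L = (\<Sum>(a, b, x, y)\<in>?R. h b a y x)"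
    by (rule sum.reindex_bij_witness[where i = "\<lambda>(a, b, x, y). (b, a, y, x)" and j = "\<lambda>(a, b, x, y). (b, a, y, x)"])
      (auto simp: quads_def)
  also have "sum ?h ?R + (\<Sum>(a, b, x, y)\<in>?R. h b a y x) = (\<Sum>(a, b, x, y)\<in>?R. h a b x y + h b a y x)"
    unfolding sum.distrib[symmetric] by (rule sum.cong) auto
  finally show ?thesis .
qed

text \<open>The map \<open>(a, b, x, y) \<mapsto> (x + y, x, b, a - b)\<close> is an involution of the solutions of
  \<open>a x + b y = n\<close> with \<open>b < a\<close>: one Euclidean step on \<open>(a, b)\<close>, followed by exchanging the roles of
  \<open>(a, b)\<close> and \<open>(x, y)\<close>.\<close>

lemma sum_quads_involution:
  fixes k :: "nat \<Rightarrow> nat \<Rightarrow> nat \<Rightarrow> nat \<Rightarrow> real"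
  assumes "\<And>a b x y. b < a \<Longrightarrow> k (x + y) x b (a - b) = - k a b x y"
  shows "(\<Sum>(a, b, x, y)\<in>{(a, b, x, y)\<in>quads n. b < a}. k a b x y) = 0"
proof -
  let ?R = "{(a, b, x, y)\<in>quads n. b < a}"
  let ?d = "\<lambda>(a, b, x, y). (x + y, x, b, a - b) :: nat \<times> nat \<times> nat \<times> nat"
  have d: "?d p \<in> ?R" "?d (?d p) = p" if "p \<in> ?R" for p
  proof -
    obtain a b x y where p: "p = (a, b, x, y)" by (cases p)
    with that obtain c where a: "a = b + c" "c > 0" using less_imp_add_positive by auto
    show "?d p \<in> ?R" "?d (?d p) = p"
      using that unfolding p a quads_def by (simp_all add: algebra_simps)
  qed
  have "(\<Sum>(a, b, x, y)\<in>?R. k a b x y) = (\<Sum>(a, b, x, y)\<in>?R. k (x + y) x b (a - b))"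
    by (rule sum.reindex_bij_witness[where i = ?d and j = ?d]) (use d in \<open>auto simp only: split: prod.splits\<close>, simp)
  also have "\<dots> = (\<Sum>(a, b, x, y)\<in>?R. - k a b x y)"
    by (rule sum.cong) (use assms in auto)
  also have "\<dots> = - (\<Sum>(a, b, x, y)\<in>?R. k a b x y)"
    unfolding sum_negf[symmetric] by (rule sum.cong) auto
  finally show ?thesis by simp
qed

theorem liouville_identity:
  fixes F :: "int \<Rightarrow> int \<Rightarrow> real"
  assumes ev1: "\<And>u v. F (- u) v = F u v" and ev2: "\<And>u v. F u (- v) = F u v"
  shows "(\<Sum>(a, b, x, y)\<in>quads n. F (int a - int b) (int x + int y) - F (int a + int b) (int x - int y)) =
    (\<Sum>(a, b, x, y)\<in>{(a, b, x, y)\<in>quads n. a = b}.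
      F 0 (int x + int y) - F (int x + int y) 0 - 2 * F (int y) (int a) + 2 * F (int a) (int x))"
proof -
  \<comment> \<open>\<open>e1\<close> trades F(a + b, x - y) for F(x + y, a - b), and
    \<open>e2\<close> says that the two terms with factor 2 have equal sums over all solutions. They
    are put in because, after a < b is folded onto b < a, they make the summand change sign under
    the involution; only a = b survives.\<close>
  define h where "h = (\<lambda>a b x y :: nat. F (int a - int b) (int x + int y) - F (int x + int y) (int a - int b)
      - 2 * F (int y) (int a) + 2 * F (int b) (int x))"
  have ev1': "F (int a - int b) v = F (int b - int a) v" for a b v
    using ev1[of "int b - int a" v] by simp
  have ev2': "F u (int a - int b) = F u (int b - int a)" for a b u
    using ev2[of u "int b - int a"] by simp
  have e1: "(\<Sum>(a, b, x, y)\<in>quads n. F (int a + int b) (int x - int y)) =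
      (\<Sum>(a, b, x, y)\<in>quads n. F (int x + int y) (int a - int b))"
    using sum_quads_exchange[of "\<lambda>a b x y. F (int a + int b) (int x - int y)" n] by simp
  have e2: "(\<Sum>(a, b, x, y)\<in>quads n. 2 * F (int y) (int a)) = (\<Sum>(a, b, x, y)\<in>quads n. 2 * F (int b) (int x))"
    using sum_quads_exchange[of "\<lambda>a b x y. 2 * F (int b) (int x)" n] by simp
  have "(\<Sum>(a, b, x, y)\<in>quads n. F (int a - int b) (int x + int y) - F (int a + int b) (int x - int y)) =
      (\<Sum>(a, b, x, y)\<in>quads n. h a b x y)"
    using e1 e2 unfolding h_def
    by (simp add: case_prod_unfold sum.distrib sum_subtractf)
  also have "\<dots> = (\<Sum>(a, b, x, y)\<in>{(a, b, x, y)\<in>quads n. b < a}. h a b x y + h b a y x) +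
    (\<Sum>(a, b, x, y)\<in>{(a, b, x, y)\<in>quads n. a = b}. h a b x y)"
    by (rule sum_quads_split)
  also have "(\<Sum>(a, b, x, y)\<in>{(a, b, x, y)\<in>quads n. b < a}. h a b x y + h b a y x) = 0"
  proof (rule sum_quads_involution)
    fix a b x y :: nat
    assume "b < a"
    then have 1: "int (a - b) = int a - int b" "int b + int (a - b) = int a" "int (a - b) + int b = int a"
      "int (x + y) - int x = int y" "int x - int (x + y) = - int y" by simp_all
    have 2: "h b a y x = F (int a - int b) (int x + int y) - F (int x + int y) (int a - int b)
        - 2 * F (int x) (int b) + 2 * F (int a) (int y)"
      unfolding h_def using ev1'[of b a "int x + int y"] ev2'[of "int x + int y" b a] by (simp add: add.commute)
    show "h (x + y) x b (a - b) + h x (x + y) (a - b) b = - (h a b x y + h b a y x)"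
      unfolding 2 unfolding h_def 1 by (simp add: ev1 ev2)
  qed
  also have "(\<Sum>(a, b, x, y)\<in>{(a, b, x, y)\<in>quads n. a = b}. h a b x y) =
     (\<Sum>(a, b, x, y)\<in>{(a, b, x, y)\<in>quads n. a = b}.
      F 0 (int x + int y) - F (int x + int y) 0 - 2 * F (int y) (int a) + 2 * F (int a) (int x))"
    by (rule sum.cong) (auto simp: h_def)
  finally show ?thesis by simp
qed

section \<open>Power series of divisor sums\<close>

definition pairs :: "nat \<Rightarrow> (nat \<times> nat) set" where
  "pairs n = {(d, e). 0 < d \<and> 0 < e \<and> d * e = n}"

lemma finite_pairs [simp, intro]: "finite (pairs n)"
proof (rule finite_subset)
  show "pairs n \<subseteq> {..n} \<times> {..n}"
    by (auto simp: pairs_def)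
qed auto

lemma pairs_0 [simp]: "pairs 0 = {}"
  by (auto simp: pairs_def)

lemma sum_pairs_swap: "(\<Sum>(d, e)\<in>pairs n. h e d) = (\<Sum>(d, e)\<in>pairs n. h d e)"
  by (rule sum.reindex_bij_witness[where i = "\<lambda>(d, e). (e, d)" and j = "\<lambda>(d, e). (e, d)"])
    (auto simp: pairs_def mult.commute)

text \<open>The Lambert series with terms w d e q^(d e). Both divisors stay in the weight, so that a
  product of two such series is a sum over \<open>quads\<close>, where Liouville's identity
  applies.\<close>

definition ser :: "(nat \<Rightarrow> nat \<Rightarrow> real) \<Rightarrow> real fps" where
  "ser w = Abs_fps (\<lambda>n. \<Sum>(d, e)\<in>pairs n. w d e)"

lemma ser_nth: "ser w $ n = (\<Sum>(d, e)\<in>pairs n. w d e)"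
  by (simp add: ser_def)

lemma ser_nth_0 [simp]: "ser w $ 0 = 0"
  by (simp add: ser_nth)

lemma ser_cong:
  assumes "\<And>d e. 0 < d \<Longrightarrow> 0 < e \<Longrightarrow> v d e = w d e"
  shows "ser v = ser w"
  by (rule fps_ext) (auto simp: ser_nth pairs_def assms intro!: sum.cong)

lemma ser_mult_nth: "(ser v * ser w) $ n = (\<Sum>(a, b, x, y)\<in>quads n. v a x * w b y)"
proof -
  have "(ser v * ser w) $ n = (\<Sum>i=0..n. \<Sum>(p, q)\<in>pairs i \<times> pairs (n - i). case_prod v p * case_prod w q)"
    unfolding fps_mult_nth ser_nth sum_product sum.cartesian_product by simp
  also have "\<dots> = (\<Sum>(i, p, q)\<in>(SIGMA i:{0..n}. pairs i \<times> pairs (n - i)). case_prod v p * case_prod w q)"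
    by (subst sum.Sigma) auto
  also have "\<dots> = (\<Sum>(a, b, x, y)\<in>quads n. v a x * w b y)"
    by (rule sum.reindex_bij_witness[where i = "\<lambda>(a, b, x, y). (a * x, (a, x), (b, y))"
          and j = "\<lambda>(i, (a, x), (b, y)). (a, b, x, y)"])
      (auto simp: quads_def pairs_def)
  finally show ?thesis .
qed

text \<open>\<open>dil f\<close> is $f(q^2)$.\<close>

definition dil :: "real fps \<Rightarrow> real fps" where
  "dil f = f oo fps_X ^ 2"

lemma dil_nth: "dil f $ n = (if even n then f $ (n div 2) else 0)"
  unfolding dil_def by (simp add: fps_nth_compose_X_power)

lemma dil_nth_double [simp]: "dil f $ (2 * n) = f $ n"
  by (simp add: dil_nth)

lemma dil_nth_0 [simp]: "dil f $ 0 = f $ 0"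
  by (simp add: dil_nth)

lemma dil_nth_odd: "odd n \<Longrightarrow> dil f $ n = 0"
  by (simp add: dil_nth)

lemma dil_add: "dil (f + g) = dil f + dil g"
  by (rule fps_ext) (simp add: dil_nth)

lemma dil_diff: "dil (f - g) = dil f - dil g"
  by (rule fps_ext) (simp add: dil_nth)

lemma dil_uminus: "dil (- f) = - dil f"
  by (rule fps_ext) (simp add: dil_nth)

lemma dil_mult: "dil (f * g) = dil f * dil g"
  unfolding dil_def by (rule fps_compose_mult_distrib) simp

lemma dil_1: "dil 1 = 1"
  by (simp add: dil_def)

lemma dil_power: "dil (f ^ n) = dil f ^ n"
  by (induction n) (simp_all add: dil_1 dil_mult)

lemma dil_numeral: "dil (numeral k) = numeral k"
  by (simp add: dil_def numeral_fps_const)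

lemmas dil_hom = dil_add dil_diff dil_uminus dil_mult dil_1 dil_power dil_numeral

lemma dil_ser: "dil (ser w) = ser (\<lambda>d e. if even d then w (d div 2) e else 0)"
proof (rule fps_ext)
  fix n
  show "dil (ser w) $ n = ser (\<lambda>d e. if even d then w (d div 2) e else 0) $ n"
  proof (cases "even n")
    case True
    have "(\<Sum>(d, e)\<in>pairs n. if even d then w (d div 2) e else 0) = (\<Sum>(d, e)\<in>{(d, e)\<in>pairs n. even d}. w (d div 2) e)"
      by (rule sum.mono_neutral_cong_right) (auto split: if_splits)
    also have "\<dots> = (\<Sum>(d, e)\<in>pairs (n div 2). w d e)"
      by (rule sum.reindex_bij_witness[where i = "\<lambda>(d, e). (2 * d, e)" and j = "\<lambda>(d, e). (d div 2, e)"])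
        (use True in \<open>auto simp: pairs_def elim!: evenE\<close>)
    finally show ?thesis
      using True by (simp add: dil_nth ser_nth)
  next
    case False
    then have "(\<Sum>(d, e)\<in>pairs n. if even d then w (d div 2) e else 0) = 0"
      by (intro sum.neutral) (auto simp: pairs_def)
    then show ?thesis
      using False by (simp add: dil_nth ser_nth)
  qed
qed

lemma numeral_mult_nth [simp]: "(numeral k * f) $ n = numeral k * (f $ n :: real)"
  by (simp add: numeral_fps_const)

definition odd_series :: "real fps \<Rightarrow> bool" where
  "odd_series f \<longleftrightarrow> (\<forall>n. even n \<longrightarrow> f $ n = 0)"

lemma odd_series_nth: "odd_series f \<Longrightarrow> even n \<Longrightarrow> f $ n = 0"
  by (simp add: odd_series_def)

lemma odd_series_dil_mult: "odd_series f \<Longrightarrow> odd_series (dil g * f)"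
  by (auto simp: odd_series_def fps_mult_nth dil_nth intro!: sum.neutral)

lemma odd_series_mult_dil: "odd_series f \<Longrightarrow> odd_series (f * dil g)"
  by (subst mult.commute) (rule odd_series_dil_mult)

lemma odd_series_ser:
  assumes "\<And>d e. 0 < d \<Longrightarrow> 0 < e \<Longrightarrow> even (d * e) \<Longrightarrow> w d e = 0"
  shows "odd_series (ser w)"
  by (auto simp: odd_series_def ser_nth pairs_def assms intro!: sum.neutral)

text \<open>For odd \<open>n\<close>, taking \<open>F(u, v) = f(u) g(v)\<close> supported on odd \<open>u\<close> and even \<open>v\<close> in Liouville's identity
  leaves only terms in which one of \<open>a\<close>, \<open>b\<close> is even and \<open>x\<close>, \<open>y\<close> are odd. This separates the two
  factors of a product of power series by the parity of the exponent.\<close>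

theorem liouville_odd:
  fixes f g :: "int \<Rightarrow> real"
  assumes n: "odd n" and f: "\<And>u. f (- u) = f u" and g: "\<And>v. g (- v) = g v"
  shows "(\<Sum>(a, b, x, y)\<in>quads n. if even a \<and> odd x
        then f (int a - int b) * g (int x + int y) - f (int a + int b) * g (int x - int y) else 0) =
    (\<Sum>(d, e)\<in>pairs n. f (int d) * ((\<Sum>k=1..(e - 1) div 2. g (2 * int k)) - (real d - 1) / 2 * g 0))"
    (is "sum ?h _ = ?rhs")
proof -
  define F where "F = (\<lambda>u v :: int. if odd u \<and> even v then f u * g v else 0)"
  define h where "h = (\<lambda>a b x y :: nat. if even a \<and> odd x
        then f (int a - int b) * g (int x + int y) - f (int a + int b) * g (int x - int y) else 0)"
  have f': "f (int b - int a) = f (int a - int b)" for a b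
    using f[of "int a - int b"] by simp
  have g': "g (int b - int a) = g (int a - int b)" for a b
    using g[of "int a - int b"] by simp
  have "(\<Sum>(a, b, x, y)\<in>quads n. F (int a - int b) (int x + int y) - F (int a + int b) (int x - int y)) =
      (\<Sum>(a, b, x, y)\<in>quads n. h a b x y + h b a y x)"
  proof (rule sum.cong[OF refl], clarify)
    fix a b x y assume "(a, b, x, y) \<in> quads n"
    then have "odd (a * x + b * y)" using n by (auto simp: quads_def)
    then show "F (int a - int b) (int x + int y) - F (int a + int b) (int x - int y) = h a b x y + h b a y x"
      unfolding F_def h_def using f'[of a b] g'[of x y]
      by (cases "even a"; cases "even b"; cases "even x"; cases "even y") (simp_all add: add.commute)
  qed
  also have "\<dots> = (\<Sum>(a, b, x, y)\<in>quads n. h a b x y) + (\<Sum>(a, b, x, y)\<in>quads n. h b a y x)"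
    unfolding sum.distrib[symmetric] by (rule sum.cong) auto
  also have "(\<Sum>(a, b, x, y)\<in>quads n. h b a y x) = (\<Sum>(a, b, x, y)\<in>quads n. h a b x y)"
    by (rule sum.reindex_bij_witness[where i = "\<lambda>(a, b, x, y). (b, a, y, x)" and j = "\<lambda>(a, b, x, y). (b, a, y, x)"])
      (auto simp: quads_def)
  finally have 1: "2 * sum ?h (quads n) =
      (\<Sum>(a, b, x, y)\<in>quads n. F (int a - int b) (int x + int y) - F (int a + int b) (int x - int y))"
    by (simp add: h_def)
  have "(\<Sum>(a, b, x, y)\<in>quads n. F (int a - int b) (int x + int y) - F (int a + int b) (int x - int y)) =
    (\<Sum>(a, b, x, y)\<in>{(a, b, x, y)\<in>quads n. a = b}.
      F 0 (int x + int y) - F (int x + int y) 0 - 2 * F (int y) (int a) + 2 * F (int a) (int x))"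
    by (rule liouville_identity) (auto simp: F_def f g)
  \<comment> \<open>On the diagonal n = a (x + y) with a and x + y odd, so F(0, x + y) and F(y, a)
    vanish by parity. What remains is indexed by d = a, e = x + y and a splitting point x <
    e.\<close>
  also have "\<dots> = (\<Sum>((d, e), x)\<in>(SIGMA (d, e):pairs n. {1..<e}). - f (int e) * g 0 + (if even x then 2 * f (int d) * g (int x) else 0))"
  proof (rule sum.reindex_bij_witness[where j = "\<lambda>(a, b, x, y). ((a, x + y), x)" and i = "\<lambda>((d, e), x). (d, d, x, e - x)"], goal_cases)
    case (5 p)
    obtain a b x y where p: "p = (a, b, x, y)" by (cases p)
    with 5 have "b = a" "n = a * (x + y)" by (auto simp: quads_def algebra_simps)
    then have "odd a" "odd (x + y)" using n by auto
    then have "odd (int x + int y)" by presburger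
    then show ?case using \<open>odd a\<close> \<open>b = a\<close> unfolding p by (auto simp: F_def)
  qed (auto simp: quads_def pairs_def simp flip: distrib_left)
  also have "\<dots> = (\<Sum>(d, e)\<in>pairs n. \<Sum>x\<in>{1..<e}. - f (int e) * g 0 + (if even x then 2 * f (int d) * g (int x) else 0))"
    unfolding case_prod_unfold by (subst sum.Sigma) (auto simp: case_prod_unfold)
  also have "\<dots> = (\<Sum>(d, e)\<in>pairs n. - (real e - 1) * f (int e) * g 0 + 2 * f (int d) * (\<Sum>k=1..(e - 1) div 2. g (2 * int k)))"
  proof (rule sum.cong[OF refl], clarify)
    fix d e assume "(d, e) \<in> pairs n"
    then have e: "odd e" using n by (auto simp: pairs_def)
    have "(\<Sum>x\<in>{1..<e}. if even x then 2 * f (int d) * g (int x) else 0) = (\<Sum>x\<in>{x\<in>{1..<e}. even x}. 2 * f (int d) * g (int x))"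
      by (rule sum.mono_neutral_cong_right) auto
    also have "\<dots> = (\<Sum>k=1..(e - 1) div 2. 2 * f (int d) * g (2 * int k))"
      by (rule sum.reindex_bij_witness[where i = "\<lambda>k. 2 * k" and j = "\<lambda>x. x div 2"]) (use e in \<open>auto elim!: evenE oddE\<close>)
    also have "\<dots> = 2 * f (int d) * (\<Sum>k=1..(e - 1) div 2. g (2 * int k))"
      by (simp add: sum_distrib_left)
    finally show "(\<Sum>x\<in>{1..<e}. - f (int e) * g 0 + (if even x then 2 * f (int d) * g (int x) else 0)) =
        - (real e - 1) * f (int e) * g 0 + 2 * f (int d) * (\<Sum>k=1..(e - 1) div 2. g (2 * int k))"
      using e by (simp add: sum.distrib sum_subtractf of_nat_diff odd_pos Suc_leI algebra_simps)
  qed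
  also have "\<dots> = (\<Sum>(d, e)\<in>pairs n. - (real e - 1) * f (int e) * g 0) + (\<Sum>(d, e)\<in>pairs n. 2 * f (int d) * (\<Sum>k=1..(e - 1) div 2. g (2 * int k)))"
    unfolding sum.distrib[symmetric] by (rule sum.cong) auto
  also have "(\<Sum>(d, e)\<in>pairs n. - (real e - 1) * f (int e) * g 0) = (\<Sum>(d, e)\<in>pairs n. - (real d - 1) * f (int d) * g 0)"
    by (rule sum_pairs_swap)
  also have "\<dots> + (\<Sum>(d, e)\<in>pairs n. 2 * f (int d) * (\<Sum>k=1..(e - 1) div 2. g (2 * int k))) = 2 * ?rhs"
    unfolding sum.distrib[symmetric] sum_distrib_left[where A = "pairs n"] by (rule sum.cong) (auto simp: field_simps)
  finally show ?thesis using 1 by simp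
qed

section \<open>The theta series\<close>

definition theta :: "real fps" where
  "theta = Abs_fps (\<lambda>n. real (card {j :: int. j\<^sup>2 = int n}))"

lemma finite_int_square_le [simp, intro]: "finite {j :: int. j\<^sup>2 \<le> int n}"
proof (rule finite_subset)
  show "{j :: int. j\<^sup>2 \<le> int n} \<subseteq> {- int n..int n}"
  proof clarify
    fix j :: int assume j: "j\<^sup>2 \<le> int n"
    have "\<bar>j\<bar> \<le> j\<^sup>2"
    proof (cases "j = 0")
      case False
      then have "\<bar>j\<bar> * 1 \<le> \<bar>j\<bar> * \<bar>j\<bar>" by (intro mult_left_mono) linarith+
      then show ?thesis by (simp add: power2_eq_square)
    qed simp
    with j show "j \<in> {- int n..int n}" by auto
  qed
qed simp

lemma finite_int_square_eq [simp, intro]: "finite {j :: int. j\<^sup>2 = int n}"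
  by (rule finite_subset[OF _ finite_int_square_le[of n]]) auto

lemma theta_nth: "theta $ n = real (card {j :: int. j\<^sup>2 = int n})"
  by (simp add: theta_def)

lemma theta_mult_nth: "(theta * f) $ n = (\<Sum>j\<in>{j :: int. j\<^sup>2 \<le> int n}. f $ (n - nat (j\<^sup>2)))"
proof -
  have "(theta * f) $ n = (\<Sum>i=0..n. \<Sum>j\<in>{j :: int. j\<^sup>2 = int i}. f $ (n - i))"
    by (simp add: fps_mult_nth theta_nth)
  also have "\<dots> = (\<Sum>(i, j)\<in>(SIGMA i:{0..n}. {j :: int. j\<^sup>2 = int i}). f $ (n - i))"
    by (subst sum.Sigma) auto
  also have "\<dots> = (\<Sum>j\<in>{j :: int. j\<^sup>2 \<le> int n}. f $ (n - nat (j\<^sup>2)))"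
    by (rule sum.reindex_bij_witness[where i = "\<lambda>j. (nat (j\<^sup>2), j)" and j = snd]) (auto simp: nat_le_iff)
  finally show ?thesis .
qed

lemma theta_nth_even:
  assumes "even n"
  shows "theta $ n = dil (dil theta) $ n"
proof -
  obtain m where m: "n = 2 * m" using assms by (elim evenE)
  show ?thesis
  proof (cases "even m")
    case True
    then obtain k where k: "m = 2 * k" by (elim evenE)
    have "card {j :: int. j\<^sup>2 = int n} = card {j :: int. j\<^sup>2 = int k}"
    proof (rule bij_betw_same_card[symmetric], rule bij_betw_byWitness[where f = "\<lambda>j. 2 * j" and f' = "\<lambda>j. j div 2"])
      have "even j" if "j\<^sup>2 = int n" for j :: int
      proof -
        have "even (j\<^sup>2)" using that assms by simp
        then show ?thesis by simp
      qed
      then show "\<forall>a'\<in>{j :: int. j\<^sup>2 = int n}. 2 * (a' div 2) = a'"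
        "(\<lambda>j. j div 2) ` {j :: int. j\<^sup>2 = int n} \<subseteq> {j. j\<^sup>2 = int k}"
        using m k by (fastforce elim!: evenE simp: power_mult_distrib)+
    qed (use m k in \<open>auto simp: power_mult_distrib\<close>)
    then show ?thesis using m k by (simp add: theta_nth dil_nth)
  next
    case False
    have "j\<^sup>2 \<noteq> int n" for j :: int
    proof
      assume j: "j\<^sup>2 = int n"
      then have "even (j\<^sup>2)" using assms by simp
      then have "even j" by simp
      then obtain i where "j = 2 * i" by (elim evenE)
      then have "2 * i\<^sup>2 = int m" using j m by (simp add: power_mult_distrib)
      then show False using False by presburger
    qed
    then show ?thesis using m False by (simp add: theta_nth dil_nth)
  qed
qed

lemma theta_nth_0 [simp]: "theta $ 0 = 1"
proof -
  have "{j :: int. j\<^sup>2 = 0} = {0}" by auto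
  then show ?thesis by (simp add: theta_nth)
qed

text \<open>The part of \<open>theta\<close> with odd j, since the even j give theta(q^4). Its
  exponents are odd squares, hence 1 modulo 8; the dissections by residue classes rest on
  this.\<close>

definition theta_odd :: "real fps" where
  "theta_odd = theta - dil (dil theta)"

lemma odd_series_theta_odd: "odd_series theta_odd"
  by (simp add: odd_series_def theta_odd_def theta_nth_even)

lemma theta_split: "theta = dil (dil theta) + theta_odd"
  by (simp add: theta_odd_def)

lemma theta_odd_mod_8:
  assumes "theta_odd $ n \<noteq> 0"
  shows "n mod 8 = 1"
proof -
  have "odd n" using assms odd_series_nth[OF odd_series_theta_odd] by blast
  then have "dil (dil theta) $ n = 0" by (simp add: dil_nth)
  then have "theta $ n \<noteq> 0" using assms by (simp add: theta_odd_def)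
  then have "{j :: int. j\<^sup>2 = int n} \<noteq> {}" unfolding theta_nth by (metis card.empty of_nat_0)
  then obtain j :: int where j: "j\<^sup>2 = int n" by blast
  then have "odd (j\<^sup>2)" using \<open>odd n\<close> by simp
  then have "odd j" by simp
  then obtain i where i: "j = 2 * i + 1" by (elim oddE)
  have "even (i * (i + 1))" by simp
  then obtain t where t: "i * (i + 1) = 2 * t" by (elim evenE)
  have "int n = 4 * (i * (i + 1)) + 1" using j i by (simp add: power2_eq_square algebra_simps)
  then have "int n = 8 * t + 1" using t by simp
  then show ?thesis by presburger
qed

lemma theta_square_nth: "(theta\<^sup>2) $ n = real (card {(x :: int, y :: int). x\<^sup>2 + y\<^sup>2 = int n})"
proof -
  have "(theta\<^sup>2) $ n = (\<Sum>j\<in>{j :: int. j\<^sup>2 \<le> int n}. real (card {k :: int. k\<^sup>2 = int (n - nat (j\<^sup>2))}))"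
    unfolding power2_eq_square theta_mult_nth theta_nth ..
  also have "\<dots> = real (card (SIGMA j:{j :: int. j\<^sup>2 \<le> int n}. {k :: int. k\<^sup>2 = int (n - nat (j\<^sup>2))}))"
    by (subst card_SigmaI) (use finite_int_square_eq in \<open>simp_all only: of_nat_sum finite_int_square_le ball_simps simp_thms\<close>)
  also have "(SIGMA j:{j :: int. j\<^sup>2 \<le> int n}. {k :: int. k\<^sup>2 = int (n - nat (j\<^sup>2))}) = {(x :: int, y :: int). x\<^sup>2 + y\<^sup>2 = int n}"
  proof -
    have "x\<^sup>2 \<le> int n \<and> y\<^sup>2 = int (n - nat (x\<^sup>2)) \<longleftrightarrow> x\<^sup>2 + y\<^sup>2 = int n" for x y :: int
    proof (cases "x\<^sup>2 \<le> int n")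
      case True
      then have "int (n - nat (x\<^sup>2)) = int n - x\<^sup>2" by (simp add: of_nat_diff nat_le_iff)
      then show ?thesis using True by linarith
    next
      case False
      then show ?thesis using zero_le_power2[of y] by linarith
    qed
    then show ?thesis by blast
  qed
  finally show ?thesis .
qed

text \<open>The map (x, y) -> (x + y, x - y) doubles a sum of two squares. It is invertible on the
  solutions for 2 n because x^2 + y^2 even forces x + y even.\<close>

lemma theta_square_nth_double: "(theta\<^sup>2) $ (2 * n) = (theta\<^sup>2) $ n"
proof -
  have "card {(x :: int, y :: int). x\<^sup>2 + y\<^sup>2 = int n} = card {(x :: int, y :: int). x\<^sup>2 + y\<^sup>2 = int (2 * n)}"
  proof (rule bij_betw_same_card, rule bij_betw_byWitness[where f = "\<lambda>(x, y). (x + y, x - y)"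
        and f' = "\<lambda>(x, y). ((x + y) div 2, (x - y) div 2)"])
    have "\<exists>u v. x = u + v \<and> y = u - v \<and> u\<^sup>2 + v\<^sup>2 = int n" if "x\<^sup>2 + y\<^sup>2 = int (2 * n)" for x y :: int
    proof -
      have "even (x\<^sup>2 + y\<^sup>2)" using that by simp
      then have "even (x + y)" by simp
      then obtain u where u: "x + y = 2 * u" by (elim evenE)
      define v where "v = x - u"
      have xy: "x = u + v" "y = u - v" using u by (simp_all add: v_def)
      have "2 * (u\<^sup>2 + v\<^sup>2) = 2 * int n"
        using that unfolding xy by (simp add: power2_eq_square algebra_simps)
      then show ?thesis using xy by (intro exI[of _ u] exI[of _ v]) simp
    qed
    note * = this
    show "\<forall>a'\<in>{(x :: int, y :: int). x\<^sup>2 + y\<^sup>2 = int (2 * n)}.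
        (case case a' of (x, y) \<Rightarrow> ((x + y) div 2, (x - y) div 2) of (x, y) \<Rightarrow> (x + y, x - y)) = a'"
    proof
      fix p assume "p \<in> {(x :: int, y :: int). x\<^sup>2 + y\<^sup>2 = int (2 * n)}"
      then obtain u v where "p = (u + v, u - v)" using * by blast
      then show "(case case p of (x, y) \<Rightarrow> ((x + y) div 2, (x - y) div 2) of (x, y) \<Rightarrow> (x + y, x - y)) = p" by simp
    qed
    show "(\<lambda>(x, y). ((x + y) div 2, (x - y) div 2)) ` {(x :: int, y :: int). x\<^sup>2 + y\<^sup>2 = int (2 * n)}
        \<subseteq> {(x, y). x\<^sup>2 + y\<^sup>2 = int n}"
    proof (rule subsetI, erule imageE)
      fix q p :: "int \<times> int"
      assume "p \<in> {(x, y). x\<^sup>2 + y\<^sup>2 = int (2 * n)}" and q: "q = (case p of (x, y) \<Rightarrow> ((x + y) div 2, (x - y) div 2))"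
      then obtain u v where "p = (u + v, u - v)" "u\<^sup>2 + v\<^sup>2 = int n" using * by blast
      then show "q \<in> {(x, y). x\<^sup>2 + y\<^sup>2 = int n}" using q by simp
    qed
  qed (auto simp: power2_eq_square algebra_simps)
  then show ?thesis by (simp add: theta_square_nth)
qed

lemma odd_series_mult_odd:
  assumes "odd_series f" "odd_series g" "odd n"
  shows "(f * g) $ n = 0"
  unfolding fps_mult_nth
proof (rule sum.neutral, safe)
  fix i assume "i \<in> {0..n}"
  then show "f $ i * g $ (n - i) = 0"
    using assms by (cases "even i") (auto simp: odd_series_def)
qed

text \<open>With theta = c + b, the even part of theta(q)^2 is c^2 + b^2. It is also theta(q^2)^2,
  because n and 2 n have equally many representations as sums of two squares.\<close>

lemma dil_theta_square: "(dil theta)\<^sup>2 = (dil (dil theta))\<^sup>2 + theta_odd\<^sup>2"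
proof (rule fps_ext)
  fix n
  let ?c = "dil (dil theta)"
  show "((dil theta)\<^sup>2) $ n = (?c\<^sup>2 + theta_odd\<^sup>2) $ n"
  proof (cases "even n")
    case True
    have "(?c * theta_odd) $ n = 0"
      using True by (intro odd_series_nth odd_series_dil_mult odd_series_theta_odd)
    moreover have "theta\<^sup>2 = ?c\<^sup>2 + theta_odd\<^sup>2 + 2 * (?c * theta_odd)"
      by (subst (1) theta_split) (simp add: power2_sum)
    ultimately have "(theta\<^sup>2) $ n = (?c\<^sup>2 + theta_odd\<^sup>2) $ n"
      by simp
    moreover have "(theta\<^sup>2) $ n = (dil (theta\<^sup>2)) $ n"
      using True theta_square_nth_double[of "n div 2"] by (simp add: dil_nth)
    ultimately show ?thesis by (simp add: dil_power)
  next
    case False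
    then have "(theta_odd\<^sup>2) $ n = 0"
      unfolding power2_eq_square by (intro odd_series_mult_odd odd_series_theta_odd)
    moreover have "((dil theta)\<^sup>2) $ n = 0" "((dil (dil theta))\<^sup>2) $ n = 0"
      using False by (simp_all add: dil_nth flip: dil_power)
    ultimately show ?thesis by simp
  qed
qed

section \<open>The logarithmic derivative of the theta series\<close>

text \<open>Index set for the coefficient of \<open>theta * ser w\<close> at n: j comes from
  \<open>theta\<close>, the pair d, e from the Lambert series. The equation is additive over the
  integers to avoid truncated subtraction.\<close>

definition triples :: "nat \<Rightarrow> (int \<times> nat \<times> nat) set" where
  "triples n = {(j, d, e). 0 < d \<and> 0 < e \<and> j\<^sup>2 + int d * int e = int n}"

lemma triples_conv_Sigma:
  "triples n = (SIGMA j:{j :: int. j\<^sup>2 \<le> int n}. pairs (n - nat (j\<^sup>2)))"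
proof -
  have "0 < d \<and> 0 < e \<and> j\<^sup>2 + int d * int e = int n \<longleftrightarrow> j\<^sup>2 \<le> int n \<and> (d, e) \<in> pairs (n - nat (j\<^sup>2))"
    for j :: int and d e
  proof (cases "j\<^sup>2 \<le> int n")
    case True
    then have "int (n - nat (j\<^sup>2)) = int n - j\<^sup>2" by (simp add: of_nat_diff nat_le_iff)
    then have "d * e = n - nat (j\<^sup>2) \<longleftrightarrow> int d * int e = int n - j\<^sup>2"
      by (metis of_nat_eq_iff of_nat_mult)
    then show ?thesis using True unfolding pairs_def by auto
  next
    case False
    moreover have "0 \<le> int d * int e" by simp
    ultimately have "j\<^sup>2 + int d * int e \<noteq> int n" by linarith
    then show ?thesis using False by blast
  qed
  note * = this
  show ?thesis
    unfolding triples_def set_eq_iff split_paired_All mem_Collect_eq case_prod_conv mem_Sigma_iff * by blast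
qed

lemma finite_triples [simp, intro]: "finite (triples n)"
  unfolding triples_conv_Sigma by (rule finite_SigmaI) auto

lemma theta_mult_ser_nth: "(theta * ser w) $ n = (\<Sum>(j, d, e)\<in>triples n. w d e)"
  unfolding theta_mult_nth ser_nth triples_conv_Sigma by (subst sum.Sigma) auto

lemma sum_triples_swap:
  "(\<Sum>(j, d, e)\<in>{(j, d, e)\<in>triples n. int e < 2 * j + int d}. h j d e) =
   (\<Sum>(j, d, e)\<in>{(j, d, e)\<in>triples n. 2 * j + int d < int e}. h (- j) e d)"
  by (rule sum.reindex_bij_witness[where i = "\<lambda>(j, d, e). (- j, e, d)" and j = "\<lambda>(j, d, e). (- j, e, d)"])
    (auto simp: triples_def mult.commute)

text \<open>A translation of the binary quadratic form with coefficients \<open>d, 2 j, -e\<close>, composed with \<open>j \<mapsto> -j\<close>.\<close>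

lemma sum_triples_involution:
  fixes q :: "int \<Rightarrow> nat \<Rightarrow> nat \<Rightarrow> real"
  assumes "\<And>j d e e'. int e' = int e - 2 * j - int d \<Longrightarrow> q (- j - int d) d e' = - q j d e"
  shows "(\<Sum>(j, d, e)\<in>{(j, d, e)\<in>triples n. 2 * j + int d < int e}. q j d e) = 0"
proof -
  let ?P = "{(j, d, e)\<in>triples n. 2 * j + int d < int e}"
  let ?t = "\<lambda>(j, d, e). (- j - int d, d, nat (int e - 2 * j - int d))"
  have t: "?t p \<in> ?P" "?t (?t p) = p" if "p \<in> ?P" for p
  proof -
    obtain j d e where p: "p = (j, d, e)" by (cases p)
    define e' where "e' = nat (int e - 2 * j - int d)"
    have e': "int e' = int e - 2 * j - int d" "0 < e'" using that unfolding p e'_def by auto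
    have jde: "0 < d" "0 < e" "j\<^sup>2 + int d * int e = int n"
      using that unfolding p by (simp_all add: triples_def)
    have tp: "?t p = (- j - int d, d, e')" unfolding p e'_def by simp
    have "(- j - int d)\<^sup>2 + int d * int e' = int n"
      unfolding e'(1) jde(3)[symmetric] by (simp add: power2_eq_square algebra_simps)
    then show "?t p \<in> ?P" unfolding tp using jde e' by (simp add: triples_def)
    have "nat (int e' - 2 * (- j - int d) - int d) = e" unfolding e'(1) by simp
    then show "?t (?t p) = p" unfolding tp p by simp
  qed
  have "(\<Sum>(j, d, e)\<in>?P. q j d e) = (\<Sum>p\<in>?P. case ?t p of (j, d, e) \<Rightarrow> q j d e)"
    by (rule sum.reindex_bij_witness[where i = ?t and j = ?t]) (use t in \<open>simp_all only:\<close>)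
  also have "\<dots> = (\<Sum>(j, d, e)\<in>?P. - q j d e)"
  proof (rule sum.cong[OF refl])
    fix p assume p: "p \<in> ?P"
    obtain j d e where "p = (j, d, e)" by (cases p)
    then show "(case ?t p of (j, d, e) \<Rightarrow> q j d e) = (case p of (j, d, e) \<Rightarrow> - q j d e)"
      using p assms[of "nat (int e - 2 * j - int d)" e j d] by simp
  qed
  also have "\<dots> = - (\<Sum>(j, d, e)\<in>?P. q j d e)"
    unfolding sum_negf[symmetric] by (rule sum.cong) auto
  finally show ?thesis by simp
qed

lemma sum_triples_split:
  fixes h :: "int \<Rightarrow> nat \<Rightarrow> nat \<Rightarrow> real"
  shows "(\<Sum>(j, d, e)\<in>triples n. h j d e) =
    (\<Sum>(j, d, e)\<in>{(j, d, e)\<in>triples n. 2 * j + int d < int e}. h j d e + h (- j) e d) +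
    (\<Sum>(j, d, e)\<in>{(j, d, e)\<in>triples n. int e = 2 * j + int d}. h j d e)"
proof -
  let ?h = "\<lambda>(j, d, e). h j d e"
  let ?P = "{(j, d, e)\<in>triples n. 2 * j + int d < int e}" and ?N = "{(j, d, e)\<in>triples n. int e < 2 * j + int d}"
    and ?Z = "{(j, d, e)\<in>triples n. int e = 2 * j + int d}"
  have fin: "finite ?P" "finite ?N" "finite ?Z"
    by (rule finite_subset[OF _ finite_triples[of n]]; blast)+
  have "sum ?h (triples n) = sum ?h (?P \<union> ?N \<union> ?Z)"
    by (rule arg_cong[where f = "sum ?h"]) auto
  also have "\<dots> = sum ?h (?P \<union> ?N) + sum ?h ?Z"
    using fin by (intro sum.union_disjoint) auto
  also have "sum ?h (?P \<union> ?N) = sum ?h ?P + sum ?h ?N"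
    using fin by (intro sum.union_disjoint) auto
  also have "sum ?h ?N = (\<Sum>(j, d, e)\<in>?P. h (- j) e d)"
    by (rule sum_triples_swap)
  also have "sum ?h ?P + \<dots> = (\<Sum>(j, d, e)\<in>?P. h j d e + h (- j) e d)"
    unfolding sum.distrib[symmetric] by (rule sum.cong) auto
  finally show ?thesis .
qed

lemma sum_odd_numbers: "(\<Sum>d\<in>{d\<in>{1..<2 * s}. odd d}. real d) = (real s)\<^sup>2"
proof (induction s)
  case (Suc s)
  have "{d\<in>{1..<2 * Suc s}. odd d} = insert (2 * s + 1) {d\<in>{1..<2 * s}. odd d}"
    by (auto simp: less_Suc_eq)
  then show ?case using Suc by (simp add: power2_eq_square algebra_simps)
qed simp

text \<open>On the boundary e = 2 j + d the equation becomes n = (j + d)^2 with j + d > 0. So n =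
  s^2, d runs through 1, ..., 2 s - 1, and the odd ones add up to s^2, while the coefficient of
  \<open>theta\<close> at s^2 is 2.\<close>

lemma sum_triples_boundary:
  "(\<Sum>(j, d, e)\<in>{(j, d, e)\<in>triples n. int e = 2 * j + int d}. if odd d then real d else 0) = real n * theta $ n / 2"
proof (cases "\<exists>s > 0. n = s\<^sup>2")
  case True
  then obtain s :: nat where s: "s > 0" "n = s\<^sup>2" by blast
  have eq: "\<bar>j + int d\<bar> = int s" if "(j, d, e) \<in> triples n" "int e = 2 * j + int d" for j d e
  proof -
    have "(j + int d)\<^sup>2 = (int s)\<^sup>2"
      using that s by (simp add: triples_def power2_eq_square algebra_simps)
    then have "j + int d = int s \<or> j + int d = - int s" by (simp add: power2_eq_iff)
    then show ?thesis by linarith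
  qed
  have "(\<Sum>(j, d, e)\<in>{(j, d, e)\<in>triples n. int e = 2 * j + int d}. if odd d then real d else 0) =
      (\<Sum>d\<in>{1..<2 * s}. if odd d then real d else 0)"
  proof (rule sum.reindex_bij_witness[where j = "\<lambda>(j, d, e). d" and i = "\<lambda>d. (int s - int d, d, 2 * s - d)"], goal_cases)
    case (1 p)
    then obtain j d e where p: "p = (j, d, e)" "(j, d, e) \<in> triples n" "int e = 2 * j + int d" by auto
    have "j + int d > 0" using p by (auto simp: triples_def)
    then have "j = int s - int d" using eq[OF p(2,3)] by simp
    then show ?case using p by auto
  next
    case (2 p)
    then obtain j d e where p: "p = (j, d, e)" "(j, d, e) \<in> triples n" "int e = 2 * j + int d" by auto
    have "j + int d > 0" using p by (auto simp: triples_def)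
    then have "j = int s - int d" using eq[OF p(2,3)] by simp
    then show ?case using p by (auto simp: triples_def)
  next
    case (4 d)
    then have "int (2 * s - d) = 2 * int s - int d" by auto
    then show ?case using 4 s by (auto simp: triples_def power2_eq_square algebra_simps)
  qed auto
  also have "\<dots> = (\<Sum>d\<in>{d\<in>{1..<2 * s}. odd d}. real d)"
    by (rule sum.mono_neutral_cong_right) (auto split: if_splits)
  also have "\<dots> = real n" using s sum_odd_numbers[of s] by simp
  also have "{j :: int. j\<^sup>2 = int n} = {int s, - int s}"
    using s by (auto simp: power2_eq_iff)
  then have "theta $ n = 2" using s by (simp add: theta_nth)
  ultimately show ?thesis by simp
next
  case False
  have empty: "{(j, d, e)\<in>triples n. int e = 2 * j + int d} = {}"
  proof (rule ccontr)
    assume "\<not> ?thesis"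
    then obtain j d e where p: "(j, d, e) \<in> triples n" "int e = 2 * j + int d" by auto
    then have "j + int d > 0" by (auto simp: triples_def)
    moreover have "int n = (j + int d)\<^sup>2" using p by (simp add: triples_def power2_eq_square algebra_simps)
    ultimately have "nat (j + int d) > 0" "n = (nat (j + int d))\<^sup>2"
      by (simp_all add: nat_power_eq[symmetric])
    then show False using False by blast
  qed
  have zero: "real n * theta $ n = 0"
  proof (cases "n = 0")
    case nz: False
    have "j\<^sup>2 \<noteq> int n" for j :: int
    proof
      assume j: "j\<^sup>2 = int n"
      then have "n = (nat \<bar>j\<bar>)\<^sup>2" by (metis nat_int nat_power_eq power2_abs abs_ge_zero)
      moreover have "nat \<bar>j\<bar> > 0" using j nz by auto
      ultimately show False using False by blast
    qed
    then show ?thesis by (simp add: theta_nth)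
  qed simp
  show ?thesis unfolding empty zero by simp
qed

text \<open>The summand is corrected by a function odd in \<open>j\<close>, which does not change the sum, so that it becomes
  antisymmetric under the involution; only the boundary \<open>e = 2 j + d\<close> survives.\<close>

theorem theta_log_derivative:
  "(theta * ser (\<lambda>d e. if odd e then if odd d then 2 * real d else - 2 * real d else 0)) $ n = real n * theta $ n"
proof -
  define w where "w = (\<lambda>d e :: nat. if odd e then if odd d then real d else - real d else 0)"
  \<comment> \<open>For odd d the shift e -> e - 2 j - d flips the parity of e, so the contribution
    d + e of two odd numbers has to be cancelled by one of mixed parity; the terms linear in j
    supply what \<open>w\<close> lacks there.\<close>
  define p where "p = (\<lambda>(j :: int) (d :: nat) (e :: nat). if odd d \<and> even e then real_of_int j
      else if even d \<and> odd e then - real_of_int j else 0)"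
  define h where "h = (\<lambda>j d e. w d e + p j d e)"
  have "(\<Sum>(j, d, e)\<in>triples n. p j d e) = (\<Sum>(j, d, e)\<in>triples n. - p j d e)"
    by (rule sum.reindex_bij_witness[where i = "\<lambda>(j, d, e). (- j, d, e)" and j = "\<lambda>(j, d, e). (- j, d, e)"])
      (auto simp: triples_def p_def)
  also have "\<dots> = - (\<Sum>(j, d, e)\<in>triples n. p j d e)"
    unfolding sum_negf[symmetric] by (rule sum.cong) auto
  finally have "(\<Sum>(j, d, e)\<in>triples n. w d e) = (\<Sum>(j, d, e)\<in>triples n. w d e) + (\<Sum>(j, d, e)\<in>triples n. p j d e)"
    by simp
  also have "\<dots> = (\<Sum>(j, d, e)\<in>triples n. h j d e)"
    unfolding sum.distrib[symmetric] h_def by (rule sum.cong) auto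
  also have "\<dots> = (\<Sum>(j, d, e)\<in>{(j, d, e)\<in>triples n. 2 * j + int d < int e}. h j d e + h (- j) e d) +
    (\<Sum>(j, d, e)\<in>{(j, d, e)\<in>triples n. int e = 2 * j + int d}. h j d e)"
    by (rule sum_triples_split)
  also have "(\<Sum>(j, d, e)\<in>{(j, d, e)\<in>triples n. 2 * j + int d < int e}. h j d e + h (- j) e d) = 0"
  proof (rule sum_triples_involution)
    fix j :: int and d e e' :: nat
    assume e': "int e' = int e - 2 * j - int d"
    then have par: "even e' \<longleftrightarrow> (even e \<longleftrightarrow> even d)" by presburger
    have "real_of_int (int e') = real_of_int (int e - 2 * j - int d)" using e' by (rule arg_cong)
    then have "real e' = real e - 2 * real_of_int j - real d" by simp
    then show "h (- j - int d) d e' + h (- (- j - int d)) e' d = - (h j d e + h (- j) e d)"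
      using par unfolding h_def w_def p_def by (cases "even d"; cases "even e") simp_all
  qed
  also have "(\<Sum>(j, d, e)\<in>{(j, d, e)\<in>triples n. int e = 2 * j + int d}. h j d e) =
      (\<Sum>(j, d, e)\<in>{(j, d, e)\<in>triples n. int e = 2 * j + int d}. if odd d then real d else 0)"
  proof (rule sum.cong[OF refl], clarify)
    fix j d e assume "int e = 2 * j + int d"
    then have "even e \<longleftrightarrow> even d" by presburger
    then show "h j d e = (if odd d then real d else 0)" by (simp add: h_def w_def p_def)
  qed
  also have "\<dots> = real n * theta $ n / 2" by (rule sum_triples_boundary)
  finally have "2 * (\<Sum>(j, d, e)\<in>triples n. w d e) = real n * theta $ n" by simp
  moreover have "2 * (\<Sum>(j, d, e)\<in>triples n. w d e) =
      (\<Sum>(j, d, e)\<in>triples n. if odd e then if odd d then 2 * real d else - 2 * real d else 0)"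
    unfolding sum_distrib_left w_def by (rule sum.cong) auto
  ultimately show ?thesis by (simp add: theta_mult_ser_nth)
qed

section \<open>Products of divisor sums\<close>

lemma ser_swap: "ser (\<lambda>d e. w e d) = ser w"
  unfolding fps_eq_iff ser_nth by (intro allI sum_pairs_swap)

lemma ser_add: "ser (\<lambda>d e. v d e + w d e) = ser v + ser w"
  by (rule fps_ext) (simp add: ser_nth sum.distrib case_prod_unfold)

lemma ser_numeral: "ser (\<lambda>d e. numeral k * w d e) = numeral k * ser w"
  by (rule fps_ext) (simp add: ser_nth sum_distrib_left case_prod_unfold)

lemma dil_ser': "dil (ser w) = ser (\<lambda>d e. if even e then w d (e div 2) else 0)"
proof -
  have "dil (ser w) = dil (ser (\<lambda>d e. w e d))" by (rule arg_cong[OF ser_swap[symmetric]])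
  also have "\<dots> = ser (\<lambda>d e. if even d then w e (d div 2) else 0)" by (rule dil_ser)
  also have "\<dots> = ser (\<lambda>d e. if even e then w d (e div 2) else 0)" by (rule ser_swap)
  finally show ?thesis .
qed

definition ser_eo :: "(nat \<Rightarrow> nat \<Rightarrow> real) \<Rightarrow> real fps" where
  "ser_eo w = ser (\<lambda>d e. if even d \<and> odd e then w d e else 0)"

definition ser_oo :: "(nat \<Rightarrow> nat \<Rightarrow> real) \<Rightarrow> real fps" where
  "ser_oo w = ser (\<lambda>d e. if odd d \<and> odd e then w d e else 0)"

lemma ser_eo_conv_dil: "ser_eo w = dil (ser (\<lambda>d e. if odd e then w (2 * d) e else 0))"
  unfolding ser_eo_def dil_ser by (rule ser_cong) (auto elim!: evenE)

lemma odd_series_ser_oo: "odd_series (ser_oo w)"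
  unfolding ser_oo_def by (rule odd_series_ser) auto

lemma ser_oo_nth: "odd n \<Longrightarrow> ser_oo w $ n = (\<Sum>(d, e)\<in>pairs n. w d e)"
  unfolding ser_oo_def ser_nth by (rule sum.cong) (auto simp: pairs_def)

lemma ser_oo_swap: "ser_oo (\<lambda>d e. w e d) = ser_oo w"
  unfolding ser_oo_def by (subst ser_swap[symmetric]) (rule ser_cong, auto)

text \<open>Halving an even e leaves the weight unchanged, so the even exponents reproduce the
  series itself. Such relations, with k = 1 here and a numeral k in \<open>ser_split_odd_d\<close>,
  reduce identities of Lambert series to odd exponents.\<close>

lemma ser_split_odd_e:
  assumes "\<And>d e. 0 < d \<Longrightarrow> 0 < e \<Longrightarrow> odd e \<Longrightarrow> even d \<Longrightarrow> w d e = 0"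
    and "\<And>d e. 0 < d \<Longrightarrow> 0 < e \<Longrightarrow> w d (2 * e) = w d e"
  shows "ser w = dil (ser w) + ser_oo w"
  unfolding dil_ser' ser_oo_def ser_add[symmetric]
  by (rule ser_cong) (auto elim!: evenE simp: assms)

lemma ser_split_odd_d:
  assumes "\<And>d e. 0 < d \<Longrightarrow> 0 < e \<Longrightarrow> odd d \<Longrightarrow> even e \<Longrightarrow> w d e = 0"
    and "\<And>d e. 0 < d \<Longrightarrow> 0 < e \<Longrightarrow> w (2 * d) e = numeral k * w d e"
  shows "ser w = numeral k * dil (ser w) + ser_oo w"
  unfolding dil_ser ser_oo_def ser_numeral[symmetric] ser_add[symmetric]
  by (rule ser_cong) (auto elim!: evenE simp: assms)

lemma ser_eo_mult_ser_oo_nth: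
  "(ser_eo v * ser_oo w) $ n =
    (\<Sum>(a, b, x, y)\<in>quads n. if even a \<and> odd b \<and> odd x \<and> odd y then v a x * w b y else 0)"
  unfolding ser_eo_def ser_oo_def ser_mult_nth by (rule sum.cong) auto

lemma liouville_ser:
  fixes f g :: "int \<Rightarrow> real"
  assumes n: "odd n" and f: "\<And>u. f (- u) = f u" and g: "\<And>v. g (- v) = g v"
    and t: "\<And>a b x y. (a, b, x, y) \<in> quads n \<Longrightarrow> even a \<Longrightarrow> odd b \<Longrightarrow> odd x \<Longrightarrow> odd y \<Longrightarrow>
      f (int a - int b) * g (int x + int y) - f (int a + int b) * g (int x - int y) = t a b x y"
    and r: "\<And>d e. (d, e) \<in> pairs n \<Longrightarrow> odd d \<Longrightarrow> odd e \<Longrightarrow>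
      f (int d) * ((\<Sum>k=1..(e - 1) div 2. g (2 * int k)) - (real d - 1) / 2 * g 0) = r d e"
  shows "(\<Sum>(a, b, x, y)\<in>quads n. if even a \<and> odd b \<and> odd x \<and> odd y then t a b x y else 0) = ser_oo r $ n"
proof -
  have "(\<Sum>(a, b, x, y)\<in>quads n. if even a \<and> odd b \<and> odd x \<and> odd y then t a b x y else 0) =
    (\<Sum>(a, b, x, y)\<in>quads n. if even a \<and> odd x
        then f (int a - int b) * g (int x + int y) - f (int a + int b) * g (int x - int y) else 0)"
  proof (rule sum.cong[OF refl], clarify)
    fix a b x y assume q: "(a, b, x, y) \<in> quads n"
    then have "odd (a * x + b * y)" using n by (auto simp: quads_def)
    then show "(if even a \<and> odd b \<and> odd x \<and> odd y then t a b x y else 0) = (if even a \<and> odd x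
        then f (int a - int b) * g (int x + int y) - f (int a + int b) * g (int x - int y) else 0)"
      using t[OF q] by auto
  qed
  also have "\<dots> = (\<Sum>(d, e)\<in>pairs n. f (int d) * ((\<Sum>k=1..(e - 1) div 2. g (2 * int k)) - (real d - 1) / 2 * g 0))"
    by (rule liouville_odd[where f = f and g = g]) (fact n f g)+
  also have "\<dots> = (\<Sum>(d, e)\<in>pairs n. r d e)"
  proof (rule sum.cong[OF refl], clarify)
    fix d e assume p: "(d, e) \<in> pairs n"
    then have "odd (d * e)" using n by (simp add: pairs_def)
    then show "f (int d) * ((\<Sum>k=1..(e - 1) div 2. g (2 * int k)) - (real d - 1) / 2 * g 0) = r d e"
      using r[OF p] by simp
  qed
  finally show ?thesis using n by (simp add: ser_oo_nth)
qed

lemma odd_series_eqI: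
  assumes "odd_series f" "odd_series g" "\<And>n. odd n \<Longrightarrow> f $ n = g $ n"
  shows "f = g"
proof (rule fps_ext)
  fix n show "f $ n = g $ n"
    using assms by (cases "even n") (simp_all add: odd_series_def)
qed

lemma odd_series_add: "odd_series f \<Longrightarrow> odd_series g \<Longrightarrow> odd_series (f + g)"
  by (simp add: odd_series_def)

lemma odd_series_diff: "odd_series f \<Longrightarrow> odd_series g \<Longrightarrow> odd_series (f - g)"
  by (simp add: odd_series_def)

lemma odd_series_numeral: "odd_series f \<Longrightarrow> odd_series (numeral k * f)"
  by (simp add: odd_series_def)

lemmas odd_series_intros = odd_series_add odd_series_diff odd_series_numeral odd_series_dil_mult
  odd_series_mult_dil odd_series_ser_oo odd_series_theta_odd

text \<open>The digits are the exponents of the divisors. In \<open>odd_div1\<close> and \<open>odd_div3\<close> the divisor is odd, in \<open>odd_codiv1\<close> and \<open>odd_codiv5\<close> the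
  complementary divisor is odd, and in \<open>odd_sigma1\<close> and \<open>odd_sigma3\<close> both are.\<close>

definition odd_sigma1 :: "real fps" where "odd_sigma1 = ser_oo (\<lambda>d e. real d)"
definition odd_sigma3 :: "real fps" where "odd_sigma3 = ser_oo (\<lambda>d e. real d ^ 3)"
definition odd_div1 :: "real fps" where "odd_div1 = ser (\<lambda>d e. if odd d then real d else 0)"
definition odd_div3 :: "real fps" where "odd_div3 = ser (\<lambda>d e. if odd d then real d ^ 3 else 0)"
definition odd_codiv1 :: "real fps" where "odd_codiv1 = ser (\<lambda>d e. if odd e then real d else 0)"
definition odd_codiv5 :: "real fps" where "odd_codiv5 = ser (\<lambda>d e. if odd e then real d ^ 5 else 0)"

lemma sum_even_squares: "(\<Sum>k=1..m. (2 * real k)\<^sup>2) = real m * (real m + 1) * (2 * real m + 1) * 2 / 3"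
  by (induction m) (simp_all add: power2_eq_square field_simps)

lemma sum_even_fourth_powers:
  "(\<Sum>k=1..m. (2 * real k) ^ 4) =
    16 * real m * (real m + 1) * (2 * real m + 1) * (3 * real m ^ 2 + 3 * real m - 1) / 30"
  by (induction m) (simp_all add: power2_eq_square power4_eq_xxxx field_simps)

lemma real_half_pred:
  assumes "odd e"
  shows "real ((e - 1) div 2) = (real e - 1) / 2"
  using assms by (auto elim!: oddE)

lemma ser_eo_0 [simp]: "ser_eo (\<lambda>d e. 0) = 0"
  by (rule fps_ext) (simp add: ser_eo_def ser_nth)

lemma numeral_mult_ser_oo_divide:
  "numeral k * ser_oo (\<lambda>d e. (u d e - v d e) / numeral k) = ser_oo u - ser_oo v"
  by (rule fps_ext)
    (simp add: ser_oo_def ser_nth sum_distrib_left flip: sum_subtractf, rule sum.cong, auto)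

text \<open>There is room for three products because \<open>eis3_chi8_identity\<close> has three;
  elsewhere zero weights fill the gaps. Letting f depend on n admits the factor
  \<open>psi8 n\<close> in \<open>eis2_psi8_identity\<close>.\<close>

theorem liouville_series:
  fixes f :: "nat \<Rightarrow> int \<Rightarrow> real" and g :: "int \<Rightarrow> real"
  assumes f: "\<And>n u. f n (- u) = f n u" and g: "\<And>v. g (- v) = g v"
    and t: "\<And>n a b x y. (a, b, x, y) \<in> quads n \<Longrightarrow> even a \<Longrightarrow> odd b \<Longrightarrow> odd x \<Longrightarrow> odd y \<Longrightarrow>
      f n (int a - int b) * g (int x + int y) - f n (int a + int b) * g (int x - int y) =
        v\<^sub>1 a x * w\<^sub>1 b y + v\<^sub>2 a x * w\<^sub>2 b y + v\<^sub>3 a x * w\<^sub>3 b y"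
    and r: "\<And>n d e. (d, e) \<in> pairs n \<Longrightarrow> odd d \<Longrightarrow> odd e \<Longrightarrow>
      f n (int d) * ((\<Sum>k=1..(e - 1) div 2. g (2 * int k)) - (real d - 1) / 2 * g 0) = r d e"
  shows "ser_eo v\<^sub>1 * ser_oo w\<^sub>1 + ser_eo v\<^sub>2 * ser_oo w\<^sub>2 + ser_eo v\<^sub>3 * ser_oo w\<^sub>3 = ser_oo r"
    (is "?S = _")
proof (rule odd_series_eqI)
  fix n :: nat assume n: "odd n"
  have "(\<Sum>(a, b, x, y)\<in>quads n. if even a \<and> odd b \<and> odd x \<and> odd y then
      v\<^sub>1 a x * w\<^sub>1 b y + v\<^sub>2 a x * w\<^sub>2 b y + v\<^sub>3 a x * w\<^sub>3 b y else 0) = ser_oo r $ n"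
    by (rule liouville_ser[OF n, where f = "f n" and g = g]) (fact f g t r)+
  also have "(\<Sum>(a, b, x, y)\<in>quads n. if even a \<and> odd b \<and> odd x \<and> odd y then
      v\<^sub>1 a x * w\<^sub>1 b y + v\<^sub>2 a x * w\<^sub>2 b y + v\<^sub>3 a x * w\<^sub>3 b y else 0) =
      ?S $ n"
    unfolding fps_add_nth ser_eo_mult_ser_oo_nth sum.distrib[symmetric]
    by (rule sum.cong) auto
  finally show "?S $ n = ser_oo r $ n"
    by simp
qed (auto simp: ser_eo_conv_dil intro!: odd_series_intros)

lemma odd_sigma1_alt: "odd_sigma1 = ser_oo (\<lambda>b y. real y)"
  unfolding odd_sigma1_def by (rule ser_oo_swap)

lemma odd_sigma3_alt: "odd_sigma3 = ser_oo (\<lambda>b y. real y ^ 3)"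
  unfolding odd_sigma3_def by (rule ser_oo_swap)

lemma dil_odd_div1: "dil odd_div1 = ser_eo (\<lambda>a x. real x)"
  unfolding odd_div1_def ser_eo_conv_dil by (subst ser_swap[symmetric]) simp

lemma dil_odd_div3: "dil odd_div3 = ser_eo (\<lambda>a x. real x ^ 3)"
  unfolding odd_div3_def ser_eo_conv_dil by (subst ser_swap[symmetric]) simp

text \<open>From (x + y)^2 - (x - y)^2 = 4 x y. Equivalently, \<open>odd_sigma3\<close> is
  \<open>odd_sigma1\<close> times the weight 2 form \<open>dil (1 + 24 * odd_div1)\<close>.\<close>

lemma odd_sigma1_mult_dil_odd_div1: "24 * (dil odd_div1 * odd_sigma1) = odd_sigma3 - odd_sigma1"
proof -
  have "ser_eo (\<lambda>a x. real x) * ser_oo (\<lambda>b y. real y) + ser_eo (\<lambda>a x. 0) * ser_oo (\<lambda>b y. 0) +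
      ser_eo (\<lambda>a x. 0) * ser_oo (\<lambda>b y. 0) = ser_oo (\<lambda>d e. (real e ^ 3 - real e) / 24)"
  proof (rule liouville_series[where f = "\<lambda>n u. 1 / 4" and g = "\<lambda>v. (real_of_int v)\<^sup>2"], goal_cases)
    case (4 n d e)
    have "(\<Sum>k=1..(e - 1) div 2. (real_of_int (2 * int k))\<^sup>2) = (real e ^ 3 - real e) / 6"
      using sum_even_squares[of "(e - 1) div 2"] unfolding real_half_pred[OF 4(3)]
      by (simp add: power3_eq_cube field_simps)
    then show ?case by simp
  qed (simp_all add: power2_eq_square algebra_simps)
  then show ?thesis
    unfolding odd_sigma1_alt odd_sigma3_alt dil_odd_div1 by (simp add: numeral_mult_ser_oo_divide)
qed

text \<open>The two products come from (x + y)^4 - (x - y)^4 = 8 (x^3 y + x y^3), the fifth powers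
  from summing fourth powers of even numbers. This is the source of the weight 6 series.\<close>

lemma odd_sigma1_mult_dil_odd_div3: "240 * (dil odd_div3 * odd_sigma1 + dil odd_div1 * odd_sigma3) = 3 * ser_oo (\<lambda>d e. real d ^ 5) - 10 * odd_sigma3 + 7 * odd_sigma1"
proof -
  have "ser_eo (\<lambda>a x. real x ^ 3) * ser_oo (\<lambda>b y. real y) + ser_eo (\<lambda>a x. real x) * ser_oo (\<lambda>b y. real y ^ 3) +
      ser_eo (\<lambda>a x. 0) * ser_oo (\<lambda>b y. 0) = ser_oo (\<lambda>d e. (3 * real e ^ 5 + 7 * real e - 10 * real e ^ 3) / 240)"
  proof (rule liouville_series[where f = "\<lambda>n u. 1 / 8" and g = "\<lambda>v. real_of_int v ^ 4"], goal_cases)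
    case (4 n d e)
    have "(\<Sum>k=1..(e - 1) div 2. (real_of_int (2 * int k)) ^ 4) = (3 * real e ^ 5 + 7 * real e - 10 * real e ^ 3) / 30"
      using sum_even_fourth_powers[of "(e - 1) div 2"] unfolding real_half_pred[OF 4(3)]
      by (simp add: power2_eq_square eval_nat_numeral field_simps)
    then show ?case by simp
  qed (simp_all add: eval_nat_numeral algebra_simps)
  moreover have "240 * ser_oo (\<lambda>d e. (3 * real e ^ 5 + 7 * real e - 10 * real e ^ 3) / 240) =
      3 * ser_oo (\<lambda>d e. real d ^ 5) - 10 * odd_sigma3 + 7 * odd_sigma1"
    unfolding numeral_mult_ser_oo_divide odd_sigma3_alt odd_sigma1_alt ser_oo_swap[of "\<lambda>d e. real d ^ 5", symmetric]
    by (rule fps_ext) (simp add: ser_oo_def ser_nth sum_distrib_left flip: sum_subtractf sum.distrib, rule sum.cong, auto)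
  ultimately show ?thesis
    unfolding odd_sigma1_alt[symmetric] odd_sigma3_alt[symmetric] dil_odd_div1[symmetric] dil_odd_div3[symmetric] by simp
qed

text \<open>Now the square is taken in a and b: (a + b)^2 - (a - b)^2 = 4 a b. The diagonal
  contributes d^3 - d^2 e = d^3 - d n up to a factor, and this n makes the result a differential
  equation for \<open>odd_sigma1\<close>.\<close>

lemma odd_sigma1_mult_dil_odd_codiv1: "16 * (dil odd_codiv1 * odd_sigma1) = odd_sigma3 - Abs_fps (\<lambda>n. real n * odd_sigma1 $ n)"
proof -
  have "ser (\<lambda>d e. if odd e then real (2 * d) else 0) = 2 * odd_codiv1"
    unfolding odd_codiv1_def ser_numeral[symmetric] by (rule ser_cong) simp
  then have "dil odd_codiv1 * 2 = ser_eo (\<lambda>a x. real a)"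
    unfolding ser_eo_conv_dil by (simp add: dil_hom mult.commute)
  moreover have "ser_eo (\<lambda>a x. real a) * ser_oo (\<lambda>b y. real b) + ser_eo (\<lambda>a x. 0) * ser_oo (\<lambda>b y. 0) +
      ser_eo (\<lambda>a x. 0) * ser_oo (\<lambda>b y. 0) = ser_oo (\<lambda>d e. (real d ^ 3 - real d * real (d * e)) / 8)"
  proof (rule liouville_series[where f = "\<lambda>n u. - (real_of_int u)\<^sup>2 / 4" and g = "\<lambda>v. 1"], goal_cases)
    case (4 n d e)
    then show ?case
      using real_half_pred[OF 4(3)] by (simp add: eval_nat_numeral field_simps)
  qed (simp_all add: power2_eq_square field_simps)
  moreover have "ser_oo (\<lambda>d e. real d * real (d * e)) = Abs_fps (\<lambda>n. real n * odd_sigma1 $ n)"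
    unfolding odd_sigma1_def by (rule fps_ext) (auto simp: ser_oo_def ser_nth sum_distrib_left pairs_def intro!: sum.cong)
  moreover have "8 * ser_oo (\<lambda>d e. (real d ^ 3 - real d * real (d * e)) / 8) = odd_sigma3 - ser_oo (\<lambda>d e. real d * real (d * e))"
    unfolding odd_sigma3_def by (rule numeral_mult_ser_oo_divide)
  ultimately have "8 * (dil odd_codiv1 * 2 * odd_sigma1) = odd_sigma3 - Abs_fps (\<lambda>n. real n * odd_sigma1 $ n)"
    unfolding odd_sigma1_def by simp
  then show ?thesis by simp
qed

section \<open>Characters modulo 4 and 8\<close>

text \<open>\<open>chi4\<close>, \<open>chi8\<close> and \<open>psi8\<close> are the Kronecker symbols of \<open>-4\<close>, \<open>-8\<close> and \<open>8\<close>; \<open>cos4\<close> and \<open>cos8\<close> agree with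
  $\cos(\pi v/2)$ and $\cos(\pi v/4)$ on even \<open>v\<close>.\<close>

definition chi4 :: "nat \<Rightarrow> real" where
  "chi4 n = (if n mod 4 = 1 then 1 else if n mod 4 = 3 then - 1 else 0)"

definition chi8 :: "nat \<Rightarrow> real" where
  "chi8 n = (if n mod 8 \<in> {1, 3} then 1 else if n mod 8 \<in> {5, 7} then - 1 else 0)"

definition psi8 :: "nat \<Rightarrow> real" where
  "psi8 n = (if n mod 8 \<in> {1, 7} then 1 else if n mod 8 \<in> {3, 5} then - 1 else 0)"

definition cos4 :: "int \<Rightarrow> real" where
  "cos4 v = (if v mod 4 = 0 then 1 else if v mod 4 = 2 then - 1 else 0)"

definition cos8 :: "int \<Rightarrow> real" where
  "cos8 v = (if v mod 8 = 0 then 1 else if v mod 8 = 4 then - 1 else 0)"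

text \<open>The character \<open>psi8\<close> on integers of either sign, since it is evaluated at
  differences a - b.\<close>

definition jac8 :: "int \<Rightarrow> real" where
  "jac8 v = (if v mod 8 \<in> {1, 7} then 1 else if v mod 8 \<in> {3, 5} then - 1 else 0)"

lemma cos4_uminus: "cos4 (- v) = cos4 v"
proof -
  have "(- v) mod 4 = 0 \<longleftrightarrow> v mod 4 = 0" "(- v) mod 4 = 2 \<longleftrightarrow> v mod 4 = 2" by presburger+
  then show ?thesis by (simp only: cos4_def)
qed

lemma cos8_uminus: "cos8 (- v) = cos8 v"
proof -
  have "(- v) mod 8 = 0 \<longleftrightarrow> v mod 8 = 0" "(- v) mod 8 = 4 \<longleftrightarrow> v mod 8 = 4" by presburger+
  then show ?thesis by (simp only: cos8_def)
qed

lemma jac8_uminus: "jac8 (- v) = jac8 v"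
proof -
  have "(- v) mod 8 \<in> {1, 7} \<longleftrightarrow> v mod 8 \<in> {1, 7}" "(- v) mod 8 \<in> {3, 5} \<longleftrightarrow> v mod 8 \<in> {3, 5}"
    unfolding insert_iff empty_iff by presburger+
  then show ?thesis by (simp only: jac8_def)
qed

lemma odd_mod_4: "odd n \<Longrightarrow> n mod 4 = 1 \<or> n mod 4 = (3 :: nat)"
  by presburger

lemma odd_mod_8: "odd n \<Longrightarrow> n mod 8 = 1 \<or> n mod 8 = 3 \<or> n mod 8 = 5 \<or> n mod 8 = (7 :: nat)"
  by presburger

lemma int_add_mod: "(int x + int y) mod int m = (int (x mod m) + int (y mod m)) mod int m"
  by (simp add: zmod_int mod_simps)

lemma int_diff_mod: "(int x - int y) mod int m = (int (x mod m) - int (y mod m)) mod int m"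
  by (simp add: zmod_int mod_simps)

lemma cos4_mod:
  "cos4 (int x + int y) = cos4 (int (x mod 4) + int (y mod 4))"
  "cos4 (int x - int y) = cos4 (int (x mod 4) - int (y mod 4))"
  unfolding cos4_def int_add_mod[of x y 4, unfolded of_nat_numeral] int_diff_mod[of x y 4, unfolded of_nat_numeral]
  by (rule refl)+

lemma cos8_mod:
  "cos8 (int x + int y) = cos8 (int (x mod 8) + int (y mod 8))"
  "cos8 (int x - int y) = cos8 (int (x mod 8) - int (y mod 8))"
  unfolding cos8_def int_add_mod[of x y 8, unfolded of_nat_numeral] int_diff_mod[of x y 8, unfolded of_nat_numeral]
  by (rule refl)+

lemma jac8_mod:
  "jac8 (int x + int y) = jac8 (int (x mod 8) + int (y mod 8))"
  "jac8 (int x - int y) = jac8 (int (x mod 8) - int (y mod 8))"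
  unfolding jac8_def int_add_mod[of x y 8, unfolded of_nat_numeral] int_diff_mod[of x y 8, unfolded of_nat_numeral]
  by (rule refl)+

text \<open>The addition theorem of the cosine: for odd x, cos(pi x / 2) = 0 and sin(pi x / 2) =
  \<open>chi4 x\<close>. Likewise in \<open>cos8_add_diff\<close>, cos(pi x / 4) and sin(pi x / 4)
  are \<open>psi8 x\<close> and \<open>chi8 x\<close> divided by the square root of 2.\<close>

lemma cos4_add_diff:
  assumes "odd x" "odd y"
  shows "cos4 (int x + int y) = - chi4 x * chi4 y" "cos4 (int x - int y) = chi4 x * chi4 y"
  unfolding cos4_mod[of x y] using odd_mod_4[OF assms(1)] odd_mod_4[OF assms(2)]
  by (auto simp: cos4_def chi4_def)

lemma cos8_add_diff:
  assumes "odd x" "odd y"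
  shows "cos8 (int x + int y) = (psi8 x * psi8 y - chi8 x * chi8 y) / 2"
    "cos8 (int x - int y) = (psi8 x * psi8 y + chi8 x * chi8 y) / 2"
  unfolding cos8_mod[of x y] using odd_mod_8[OF assms(1)] odd_mod_8[OF assms(2)]
  by (elim disjE; simp add: cos8_def chi8_def psi8_def)+

lemma chi4_even [simp]: "even n \<Longrightarrow> chi4 n = 0"
proof -
  assume "even n"
  then have "n mod 4 \<noteq> 1" "n mod 4 \<noteq> 3" by presburger+
  then show ?thesis by (simp add: chi4_def)
qed

lemma chi8_even [simp]: "even n \<Longrightarrow> chi8 n = 0"
proof -
  assume "even n"
  then have "n mod 8 \<noteq> 1" "n mod 8 \<noteq> 3" "n mod 8 \<noteq> 5" "n mod 8 \<noteq> 7" by presburger+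
  then show ?thesis by (simp add: chi8_def)
qed

lemma psi8_even [simp]: "even n \<Longrightarrow> psi8 n = 0"
proof -
  assume "even n"
  then have "n mod 8 \<noteq> 1" "n mod 8 \<noteq> 3" "n mod 8 \<noteq> 5" "n mod 8 \<noteq> 7" by presburger+
  then show ?thesis by (simp add: psi8_def)
qed

lemma psi8_mult_chi4: "psi8 n * chi4 n = chi8 n"
proof (cases "even n")
  case False
  have "n mod 4 = n mod 8 mod 4" by (simp add: mod_mod_cancel)
  then show ?thesis using odd_mod_8[of n] False by (auto simp: psi8_def chi4_def chi8_def)
qed simp

lemma psi8_square: "odd n \<Longrightarrow> psi8 n * psi8 n = 1"
  using odd_mod_8[of n] by (auto simp: psi8_def)

lemma chi4_square: "odd n \<Longrightarrow> chi4 n * chi4 n = 1"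
  using odd_mod_4[of n] by (auto simp: chi4_def)

lemma chi8_square: "odd n \<Longrightarrow> chi8 n * chi8 n = 1"
  using odd_mod_8[of n] by (auto simp: chi8_def)

lemma chi4_mult: "chi4 (m * n) = chi4 m * chi4 n"
proof (cases "even m \<or> even n")
  case False
  then have "odd m" "odd n" by auto
  from odd_mod_4[OF this(1)] odd_mod_4[OF this(2)] show ?thesis
    unfolding chi4_def mod_mult_eq[of m 4 n, symmetric] by (elim disjE; simp)
qed auto

lemma chi8_mult: "chi8 (m * n) = chi8 m * chi8 n"
proof (cases "even m \<or> even n")
  case False
  then have "odd m" "odd n" by auto
  from odd_mod_8[OF this(1)] odd_mod_8[OF this(2)] show ?thesis
    unfolding chi8_def mod_mult_eq[of m 8 n, symmetric] by (elim disjE; simp)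
qed auto

lemma psi8_mult: "psi8 (m * n) = psi8 m * psi8 n"
proof (cases "even m \<or> even n")
  case False
  then have "odd m" "odd n" by auto
  from odd_mod_8[OF this(1)] odd_mod_8[OF this(2)] show ?thesis
    unfolding psi8_def mod_mult_eq[of m 8 n, symmetric] by (elim disjE; simp)
qed auto

lemma chi4_1 [simp]: "chi4 1 = 1" "chi4 (Suc 0) = 1"
  by (simp_all add: chi4_def)

lemma chi8_1 [simp]: "chi8 1 = 1" "chi8 (Suc 0) = 1"
  by (simp_all add: chi8_def)

lemma cos4_0 [simp]: "cos4 0 = 1"
  by (simp add: cos4_def)

lemma cos8_0 [simp]: "cos8 0 = 1"
  by (simp add: cos8_def)

lemma cos4_double: "cos4 (2 * int k) = (if even k then 1 else - 1)"
proof (cases "even k")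
  case True
  then have "2 * int k mod 4 = 0" by presburger
  then show ?thesis using True by (simp add: cos4_def)
next
  case False
  then have "2 * int k mod 4 = 2" by presburger
  then show ?thesis using False by (simp add: cos4_def)
qed

lemma sum_cos4: "odd e \<Longrightarrow> (\<Sum>k=1..(e - 1) div 2. cos4 (2 * int k)) = (chi4 e - 1) / 2"
proof -
  have "(\<Sum>k=1..m. cos4 (2 * int k)) = (chi4 (2 * m + 1) - 1) / 2" for m
  proof (induction m)
    case (Suc m)
    have "chi4 (2 * Suc m + 1) = chi4 (2 * m + 1) + 2 * cos4 (2 * int (Suc m))"
    proof (cases "even m")
      case True
      then have "(2 * Suc m + 1) mod 4 = 3" "(2 * m + 1) mod 4 = 1" by presburger+
      then show ?thesis using True unfolding cos4_double by (simp only: chi4_def) simp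
    next
      case False
      then have "(2 * Suc m + 1) mod 4 = 1" "(2 * m + 1) mod 4 = 3" by presburger+
      then show ?thesis using False unfolding cos4_double by (simp only: chi4_def) simp
    qed
    then show ?case using Suc by simp
  qed simp
  moreover assume "odd e"
  then have "2 * ((e - 1) div 2) + 1 = e" by presburger
  ultimately show ?thesis by metis
qed

lemma sum_cos8: "odd e \<Longrightarrow> (\<Sum>k=1..(e - 1) div 2. cos8 (2 * int k)) = (chi8 e - 1) / 2"
proof -
  have "(\<Sum>k=1..m. cos8 (2 * int k)) = (chi8 (2 * m + 1) - 1) / 2" for m
  proof (induction m)
    case (Suc m)
    have "chi8 (2 * Suc m + 1) = chi8 (2 * m + 1) + 2 * cos8 (2 * int (Suc m))"
    proof -
      consider "m mod 4 = 0" | "m mod 4 = 1" | "m mod 4 = 2" | "m mod 4 = 3" by linarith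
      then show ?thesis
      proof cases
        case 1
        then have "(2 * Suc m + 1) mod 8 = 3" "(2 * m + 1) mod 8 = 1" "2 * int (Suc m) mod 8 = 2" by presburger+
        then show ?thesis by (simp only: chi8_def cos8_def) simp
      next
        case 2
        then have "(2 * Suc m + 1) mod 8 = 5" "(2 * m + 1) mod 8 = 3" "2 * int (Suc m) mod 8 = 4" by presburger+
        then show ?thesis by (simp only: chi8_def cos8_def) simp
      next
        case 3
        then have "(2 * Suc m + 1) mod 8 = 7" "(2 * m + 1) mod 8 = 5" "2 * int (Suc m) mod 8 = 6" by presburger+
        then show ?thesis by (simp only: chi8_def cos8_def) simp
      next
        case 4
        then have "(2 * Suc m + 1) mod 8 = 1" "(2 * m + 1) mod 8 = 7" "2 * int (Suc m) mod 8 = 0" by presburger+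
        then show ?thesis by (simp only: chi8_def cos8_def) simp
      qed
    qed
    then show ?case using Suc by simp
  qed simp
  moreover assume "odd e"
  then have "2 * ((e - 1) div 2) + 1 = e" by presburger
  ultimately show ?thesis by metis
qed

text \<open>The arguments differ by 2 a, which is 4 modulo 8, and adding 4 changes the sign of the
  character at odd arguments.\<close>

lemma jac8_add_diff:
  assumes "a mod 8 \<in> {2, 6}" "odd b"
  shows "jac8 (int a + int b) = - jac8 (int a - int b)"
  unfolding jac8_mod[of a b] using assms(1) odd_mod_8[OF assms(2)]
  by (elim disjE insertE emptyE; simp add: jac8_def)

lemma jac8_diff:
  assumes "a mod 8 \<in> {0, 4}" "odd b"
  shows "jac8 (int a - int b) = jac8 (int a + int b)"
  unfolding jac8_mod[of a b] using assms(1) odd_mod_8[OF assms(2)]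
  by (elim disjE insertE emptyE; simp add: jac8_def)

lemma jac8_int: "jac8 (int n) = psi8 n"
proof -
  have "int n mod 8 = int (n mod 8)" by (simp add: zmod_int)
  then show ?thesis by (auto simp: jac8_def psi8_def)
qed

text \<open>Since 4 divides a and x - y is even, a x + b y is congruent to (a + b) y modulo 8, and
  the two factors \<open>psi8 (a + b)\<close> cancel.\<close>

lemma psi8_mult_jac8:
  assumes "a mod 8 \<in> {0, 4}" "odd b" "odd x" "odd y"
  shows "psi8 (a * x + b * y) * jac8 (int a + int b) = psi8 y"
proof -
  have ax: "(a * x) mod 8 = a mod 8"
    using assms(1) odd_mod_8[OF assms(3)] unfolding mod_mult_eq[of a 8 x, symmetric]
      by (elim disjE insertE emptyE; simp)
  have "psi8 (a * x + b * y) = psi8 (a + b) * psi8 y"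
  proof -
    have "psi8 (a * x + b * y) = psi8 (a * y + b * y)"
    proof -
      have "(a * y) mod 8 = a mod 8"
        using assms(1) odd_mod_8[OF assms(4)] unfolding mod_mult_eq[of a 8 y, symmetric]
      by (elim disjE insertE emptyE; simp)
      then have "(a * x + b * y) mod 8 = (a * y + b * y) mod 8"
        using ax by (metis mod_add_left_eq)
      then show ?thesis by (simp only: psi8_def)
    qed
    then show ?thesis by (simp add: psi8_mult flip: distrib_right)
  qed
  moreover have "jac8 (int a + int b) = psi8 (a + b)" by (simp flip: jac8_int)
  moreover have "even a" using assms(1) by (auto, presburger+)
  then have "odd (a + b)" using assms(2) by simp
  ultimately show ?thesis using psi8_square[of "a + b"] by simp
qed

text \<open>Eisenstein series without constant term: \<open>eis1_chi4\<close>, \<open>eis1_chi8\<close> have weight 1, \<open>eis2_psi8\<close> has weight 2, and \<open>eis3_chi4\<close>, \<open>eis3_chi8\<close> have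
  weight 3.\<close>

definition eis1_chi4 :: "real fps" where "eis1_chi4 = ser (\<lambda>d e. chi4 d)"
definition eis1_chi8 :: "real fps" where "eis1_chi8 = ser (\<lambda>d e. chi8 d)"
definition eis2_psi8 :: "real fps" where "eis2_psi8 = ser (\<lambda>d e. real d * psi8 e)"
definition eis3_chi4 :: "real fps" where "eis3_chi4 = ser (\<lambda>d e. (real d)\<^sup>2 * chi4 e)"
definition eis3_chi8 :: "real fps" where "eis3_chi8 = ser (\<lambda>d e. (real d)\<^sup>2 * chi8 e)"

lemma eis1_chi4_split: "eis1_chi4 = dil eis1_chi4 + ser_oo (\<lambda>d e. chi4 d)"
  unfolding eis1_chi4_def by (rule ser_split_odd_e) auto

lemma eis1_chi8_split: "eis1_chi8 = dil eis1_chi8 + ser_oo (\<lambda>d e. chi8 d)"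
  unfolding eis1_chi8_def by (rule ser_split_odd_e) auto

lemma eis2_psi8_split: "eis2_psi8 = 2 * dil eis2_psi8 + ser_oo (\<lambda>d e. real d * psi8 e)"
  unfolding eis2_psi8_def by (rule ser_split_odd_d) auto

lemma eis3_chi4_split: "eis3_chi4 = 4 * dil eis3_chi4 + ser_oo (\<lambda>d e. (real d)\<^sup>2 * chi4 e)"
  unfolding eis3_chi4_def by (rule ser_split_odd_d) (auto simp: power_mult_distrib)

lemma eis3_chi8_split: "eis3_chi8 = 4 * dil eis3_chi8 + ser_oo (\<lambda>d e. (real d)\<^sup>2 * chi8 e)"
  unfolding eis3_chi8_def by (rule ser_split_odd_d) (auto simp: power_mult_distrib)

lemma ser_eo_eis1_chi4: "ser_eo (\<lambda>a x. chi4 x) = dil eis1_chi4"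
  unfolding ser_eo_conv_dil eis1_chi4_def
  by (subst ser_swap[symmetric], rule arg_cong[where f = dil], rule ser_cong) auto

lemma ser_eo_eis1_chi8: "ser_eo (\<lambda>a x. chi8 x) = dil eis1_chi8"
  unfolding ser_eo_conv_dil eis1_chi8_def
  by (subst ser_swap[symmetric], rule arg_cong[where f = dil], rule ser_cong) auto

lemma ser_eo_dil_eis1_chi4: "ser_eo (\<lambda>a x. if 4 dvd a then chi4 x else 0) = dil (dil eis1_chi4)"
proof -
  have div4: "4 dvd 2 * d \<longleftrightarrow> even d" for d :: nat by presburger
  have eis1_chi4: "eis1_chi4 = ser (\<lambda>d e. chi4 e)" unfolding eis1_chi4_def by (rule ser_swap)
  have "ser (\<lambda>d e. if odd e then if 4 dvd 2 * d then chi4 e else 0 else 0) = dil eis1_chi4"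
    unfolding eis1_chi4 dil_ser div4 by (rule ser_cong) simp
  then show ?thesis by (simp add: ser_eo_conv_dil)
qed

lemma ser_eo_eis3_chi4: "ser_eo (\<lambda>a x. (real a)\<^sup>2 * chi4 x) = 4 * dil eis3_chi4"
proof -
  have "ser (\<lambda>d e. if odd e then (real (2 * d))\<^sup>2 * chi4 e else 0) = 4 * eis3_chi4"
    unfolding eis3_chi4_def ser_numeral[symmetric] by (rule ser_cong) (auto simp: power_mult_distrib)
  then show ?thesis by (simp add: ser_eo_conv_dil dil_hom)
qed

lemma ser_eo_eis3_chi8: "ser_eo (\<lambda>a x. (real a)\<^sup>2 * chi8 x) = 4 * dil eis3_chi8"
proof -
  have "ser (\<lambda>d e. if odd e then (real (2 * d))\<^sup>2 * chi8 e else 0) = 4 * eis3_chi8"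
    unfolding eis3_chi8_def ser_numeral[symmetric] by (rule ser_cong) (auto simp: power_mult_distrib)
  then show ?thesis by (simp add: ser_eo_conv_dil dil_hom)
qed

lemma ser_eo_eis2_psi8: "ser_eo (\<lambda>a x. 2 * real a * psi8 x) = 4 * dil eis2_psi8"
proof -
  have "ser (\<lambda>d e. if odd e then 2 * real (2 * d) * psi8 e else 0) = 4 * eis2_psi8"
    unfolding eis2_psi8_def ser_numeral[symmetric] by (rule ser_cong) auto
  then show ?thesis by (simp add: ser_eo_conv_dil dil_hom)
qed

text \<open>In terms of A = 1 + 4 \<open>eis1_chi4\<close> this reads
  \<open>dil A * (A - dil A) = 4 * odd_sigma1\<close>, the same relation that theta(q)^2 satisfies
  by \<open>jacobi_theta\<close>.\<close>

lemma eis1_chi4_identity: "4 * (dil eis1_chi4 * (eis1_chi4 - dil eis1_chi4)) = odd_sigma1 - (eis1_chi4 - dil eis1_chi4)"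
proof -
  have "ser_eo (\<lambda>a x. chi4 x) * ser_oo (\<lambda>b y. chi4 y) + ser_eo (\<lambda>a x. 0) * ser_oo (\<lambda>b y. 0) +
      ser_eo (\<lambda>a x. 0) * ser_oo (\<lambda>b y. 0) = ser_oo (\<lambda>d e. (real d - chi4 e) / 4)"
  proof (rule liouville_series[where f = "\<lambda>n u. - 1 / 2" and g = cos4], goal_cases)
    case (4 n d e)
    then show ?case unfolding sum_cos4[OF 4(3)] by (simp add: field_simps)
  qed (simp_all add: cos4_uminus cos4_add_diff)
  moreover have r: "eis1_chi4 - dil eis1_chi4 = ser_oo (\<lambda>b y. chi4 y)"
    unfolding ser_oo_swap[of "\<lambda>d e. chi4 d"] by (subst eis1_chi4_split) simp
  moreover have "4 * ser_oo (\<lambda>d e. (real d - chi4 e) / 4) = odd_sigma1 - (eis1_chi4 - dil eis1_chi4)"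
    unfolding odd_sigma1_def r by (rule numeral_mult_ser_oo_divide)
  ultimately show ?thesis by (simp add: ser_eo_eis1_chi4)
qed

lemma eis1_chi8_identity: "2 * (dil eis1_chi8 * (eis1_chi8 - dil eis1_chi8)) = odd_sigma1 - (eis1_chi8 - dil eis1_chi8)"
proof -
  have "ser_eo (\<lambda>a x. chi8 x) * ser_oo (\<lambda>b y. chi8 y) + ser_eo (\<lambda>a x. 0) * ser_oo (\<lambda>b y. 0) +
      ser_eo (\<lambda>a x. 0) * ser_oo (\<lambda>b y. 0) = ser_oo (\<lambda>d e. (real d - chi8 e) / 2)"
  proof (rule liouville_series[where f = "\<lambda>n u. - 1" and g = cos8], goal_cases)
    case (4 n d e)
    then show ?case unfolding sum_cos8[OF 4(3)] by (simp add: field_simps)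
  qed (simp_all add: cos8_uminus cos8_add_diff field_simps)
  moreover have r: "eis1_chi8 - dil eis1_chi8 = ser_oo (\<lambda>b y. chi8 y)"
    unfolding ser_oo_swap[of "\<lambda>d e. chi8 d"] by (subst eis1_chi8_split) simp
  moreover have "2 * ser_oo (\<lambda>d e. (real d - chi8 e) / 2) = odd_sigma1 - (eis1_chi8 - dil eis1_chi8)"
    unfolding odd_sigma1_def r by (rule numeral_mult_ser_oo_divide)
  ultimately show ?thesis by (simp add: ser_eo_eis1_chi8)
qed

lemma eis3_chi4_identity:
  "4 * (4 * dil eis3_chi4 * (eis1_chi4 - dil eis1_chi4) + dil eis1_chi4 * (eis3_chi4 - 4 * dil eis3_chi4)) = odd_sigma3 - (eis3_chi4 - 4 * dil eis3_chi4)"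
proof -
  have "ser_eo (\<lambda>a x. (real a)\<^sup>2 * chi4 x) * ser_oo (\<lambda>b y. chi4 y) +
      ser_eo (\<lambda>a x. chi4 x) * ser_oo (\<lambda>b y. (real b)\<^sup>2 * chi4 y) +
      ser_eo (\<lambda>a x. 0) * ser_oo (\<lambda>b y. 0) = ser_oo (\<lambda>d e. (real d ^ 3 - (real d)\<^sup>2 * chi4 e) / 4)"
  proof (rule liouville_series[where f = "\<lambda>n u. - (real_of_int u)\<^sup>2 / 2" and g = cos4], goal_cases)
    case (3 n a b x y)
    then show ?case by (simp add: cos4_add_diff power2_eq_square field_simps)
  next
    case (4 n d e)
    then show ?case unfolding sum_cos4[OF 4(3)] by (simp add: eval_nat_numeral field_simps)
  qed (simp_all add: cos4_uminus)
  moreover have r: "eis1_chi4 - dil eis1_chi4 = ser_oo (\<lambda>b y. chi4 y)"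
    unfolding ser_oo_swap[of "\<lambda>d e. chi4 d"] by (subst eis1_chi4_split) simp
  moreover have e: "eis3_chi4 - 4 * dil eis3_chi4 = ser_oo (\<lambda>d e. (real d)\<^sup>2 * chi4 e)"
    by (subst eis3_chi4_split) simp
  moreover have "4 * ser_oo (\<lambda>d e. (real d ^ 3 - (real d)\<^sup>2 * chi4 e) / 4) = odd_sigma3 - (eis3_chi4 - 4 * dil eis3_chi4)"
    unfolding odd_sigma3_def e by (rule numeral_mult_ser_oo_divide)
  ultimately show ?thesis by (simp add: ser_eo_eis1_chi4 ser_eo_eis3_chi4)
qed

text \<open>Taking f = -u^2 raises the weight by 2. The mixed term 2 a b of the squares cancels with
  \<open>cos4\<close>, but with \<open>cos8\<close> it survives and is multiplied by
  \<open>psi8 x * psi8 y\<close>; hence the third product, of weight 2 series.\<close>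

lemma eis3_chi8_identity:
  "2 * (4 * dil eis3_chi8 * (eis1_chi8 - dil eis1_chi8) + dil eis1_chi8 * (eis3_chi8 - 4 * dil eis3_chi8) + 4 * dil eis2_psi8 * (eis2_psi8 - 2 * dil eis2_psi8)) =
    odd_sigma3 - (eis3_chi8 - 4 * dil eis3_chi8)"
proof -
  have "ser_eo (\<lambda>a x. (real a)\<^sup>2 * chi8 x) * ser_oo (\<lambda>b y. chi8 y) +
      ser_eo (\<lambda>a x. chi8 x) * ser_oo (\<lambda>b y. (real b)\<^sup>2 * chi8 y) +
      ser_eo (\<lambda>a x. 2 * real a * psi8 x) * ser_oo (\<lambda>b y. real b * psi8 y) =
      ser_oo (\<lambda>d e. (real d ^ 3 - (real d)\<^sup>2 * chi8 e) / 2)"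
  proof (rule liouville_series[where f = "\<lambda>n u. - (real_of_int u)\<^sup>2" and g = cos8], goal_cases)
    case (3 n a b x y)
    then show ?case by (simp add: cos8_add_diff power2_eq_square field_simps)
  next
    case (4 n d e)
    then show ?case unfolding sum_cos8[OF 4(3)] by (simp add: eval_nat_numeral field_simps)
  qed (simp_all add: cos8_uminus)
  moreover have r: "eis1_chi8 - dil eis1_chi8 = ser_oo (\<lambda>b y. chi8 y)"
    unfolding ser_oo_swap[of "\<lambda>d e. chi8 d"] by (subst eis1_chi8_split) simp
  moreover have e: "eis3_chi8 - 4 * dil eis3_chi8 = ser_oo (\<lambda>d e. (real d)\<^sup>2 * chi8 e)"
    by (subst eis3_chi8_split) simp
  moreover have "eis2_psi8 - 2 * dil eis2_psi8 = ser_oo (\<lambda>d e. real d * psi8 e)"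
    by (subst eis2_psi8_split) simp
  moreover have "2 * ser_oo (\<lambda>d e. (real d ^ 3 - (real d)\<^sup>2 * chi8 e) / 2) = odd_sigma3 - (eis3_chi8 - 4 * dil eis3_chi8)"
    unfolding odd_sigma3_def e by (rule numeral_mult_ser_oo_divide)
  ultimately show ?thesis by (simp add: ser_eo_eis1_chi8 ser_eo_eis3_chi8 ser_eo_eis2_psi8)
qed

text \<open>Here f carries a character. If a is 2 modulo 4, \<open>jac8\<close> changes sign between
  a - b and a + b and the terms cancel; if 4 divides a, the factor \<open>psi8 n\<close> turns
  \<open>jac8\<close> into \<open>psi8 y\<close>, which combines with \<open>chi4 y\<close> to
  \<open>chi8 y\<close>.\<close>

lemma eis2_psi8_identity: "4 * (dil (dil eis1_chi4) * (eis1_chi8 - dil eis1_chi8)) = (eis2_psi8 - 2 * dil eis2_psi8) - (eis1_chi8 - dil eis1_chi8)"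
proof -
  have "ser_eo (\<lambda>a x. if 4 dvd a then chi4 x else 0) * ser_oo (\<lambda>b y. chi8 y) +
      ser_eo (\<lambda>a x. 0) * ser_oo (\<lambda>b y. 0) + ser_eo (\<lambda>a x. 0) * ser_oo (\<lambda>b y. 0) =
      ser_oo (\<lambda>d e. (real d * psi8 e - chi8 e) / 4)"
  proof (rule liouville_series[where f = "\<lambda>n u. - psi8 n * jac8 u / 2" and g = cos4], goal_cases)
    case (3 n a b x y)
    then have n: "n = a * x + b * y" by (simp add: quads_def)
    show ?case
    proof (cases "4 dvd a")
      case True
      then have "a mod 8 \<in> {0, 4}" by (auto, presburger)
      then have "psi8 n * jac8 (int a + int b) = psi8 y" "jac8 (int a - int b) = jac8 (int a + int b)"
        unfolding n using 3 by (intro psi8_mult_jac8 jac8_diff; simp)+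
      then show ?thesis using 3 True psi8_mult_chi4[of y] by (simp add: cos4_add_diff mult.commute)
    next
      case False
      then have "a mod 8 \<in> {2, 6}" using 3(2) by (auto, presburger)
      then have "jac8 (int a + int b) = - jac8 (int a - int b)"
        using 3 by (intro jac8_add_diff)
      then show ?thesis using 3 False by (simp add: cos4_add_diff)
    qed
  next
    case (4 n d e)
    then have "psi8 n * psi8 d = psi8 e"
      using psi8_square[of d] by (auto simp: pairs_def psi8_mult)
    moreover have "psi8 e * chi4 e = chi8 e" by (rule psi8_mult_chi4)
    ultimately show ?case
      unfolding sum_cos4[OF 4(3)] jac8_int by (simp add: field_simps)
  qed (simp_all add: cos4_uminus jac8_uminus)
  moreover have r: "eis1_chi8 - dil eis1_chi8 = ser_oo (\<lambda>b y. chi8 y)"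
    unfolding ser_oo_swap[of "\<lambda>d e. chi8 d"] by (subst eis1_chi8_split) simp
  moreover have n: "eis2_psi8 - 2 * dil eis2_psi8 = ser_oo (\<lambda>d e. real d * psi8 e)"
    by (subst eis2_psi8_split) simp
  moreover have "4 * ser_oo (\<lambda>d e. (real d * psi8 e - chi8 e) / 4) = (eis2_psi8 - 2 * dil eis2_psi8) - (eis1_chi8 - dil eis1_chi8)"
    unfolding n r by (rule numeral_mult_ser_oo_divide)
  ultimately show ?thesis by (simp add: ser_eo_dil_eis1_chi4)
qed

section \<open>Theta series as Eisenstein series\<close>

text \<open>Even and odd part of theta(q)^2, so that \<open>tX - tY\<close> is theta(-q)^2.
  Replacing q by q^2 sends this pair of squares to the arithmetic mean and a geometric mean (Gauss);
  therefore dilations of symmetric polynomials in \<open>tX\<close> and \<open>tY\<close> are again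
  polynomials in \<open>tX\<close> and \<open>tY\<close>.\<close>

definition tX :: "real fps" where "tX = (dil theta)\<^sup>2"
definition tY :: "real fps" where "tY = 2 * dil (dil theta) * theta_odd"

lemma tX_alt: "tX = (dil (dil theta))\<^sup>2 + theta_odd\<^sup>2"
  unfolding tX_def by (rule dil_theta_square)

lemma theta_square: "theta\<^sup>2 = tX + tY"
proof -
  have "theta\<^sup>2 = (dil (dil theta) + theta_odd)\<^sup>2" by (subst theta_split) (rule refl)
  then show ?thesis by (simp add: tX_alt tY_def power2_sum)
qed

lemma dil_tX: "dil tX = (dil (dil theta))\<^sup>2"
  by (simp add: tX_def dil_hom)

lemma dil_tX_tY: "tX = dil tX + dil tY"
proof -
  have "dil (theta\<^sup>2) = tX" by (simp add: tX_def dil_hom)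
  then show ?thesis by (simp add: theta_square dil_hom)
qed

lemma dil_tY: "dil tY = theta_odd\<^sup>2"
proof -
  have "(dil (dil theta))\<^sup>2 + theta_odd\<^sup>2 = dil tX + dil tY"
    unfolding tX_alt[symmetric] by (rule dil_tX_tY)
  then show ?thesis by (simp add: dil_tX)
qed

lemma tY_square: "tY\<^sup>2 = 4 * dil tX * dil tY"
  unfolding dil_tX dil_tY by (simp add: tY_def power_mult_distrib)

lemma odd_series_tY: "odd_series tY"
  unfolding tY_def mult.assoc by (intro odd_series_intros)

lemma tX_nth_0 [simp]: "tX $ 0 = 1"
  by (simp add: tX_def power2_eq_square)

lemma tY_nth_0 [simp]: "tY $ 0 = 0"
  using odd_series_nth[OF odd_series_tY, of 0] by simp

section \<open>Uniqueness of a series from its relation to its own dilation\<close>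

lemma fps_mult_nth_low:
  fixes P d :: "real fps"
  assumes "\<And>k. k < n \<Longrightarrow> d $ k = 0"
  shows "(P * d) $ n = P $ 0 * d $ n"
proof -
  have "(P * d) $ n = (\<Sum>i=0..n. P $ i * d $ (n - i))" by (rule fps_mult_nth)
  also have "\<dots> = P $ 0 * d $ n + (\<Sum>i=Suc 0..n. P $ i * d $ (n - i))"
    by (subst sum.atLeast_Suc_atMost) simp_all
  also have "(\<Sum>i=Suc 0..n. P $ i * d $ (n - i)) = 0"
    using assms by (intro sum.neutral) auto
  finally show ?thesis by simp
qed

text \<open>At n > 0 the coefficient of \<open>dil d\<close> involves d only at n / 2, so the
  equation gives P_0 d_n = 0 once all earlier coefficients vanish. At n = 0 the series and its
  dilation agree, so the constant term is a separate hypothesis.\<close>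

lemma dil_recursion_unique:
  assumes P: "P $ 0 = 1" and d0: "d $ 0 = 0" and eq: "P * (d - k * dil d) + R * dil d = 0"
  shows "d = 0"
proof -
  have "d $ n = 0" for n
  proof (induction n rule: less_induct)
    case (less n)
    show ?case
    proof (cases "n = 0")
      case False
      have dil0: "dil d $ j = 0" if "j \<le> n" for j
        using less[of "j div 2"] that False by (auto simp: dil_nth)
      then have low: "(Q * dil d) $ j = 0" if "j \<le> n" for Q j
        using that by (auto simp: fps_mult_nth intro!: sum.neutral)
      have "(P * (d - k * dil d)) $ n = P $ 0 * (d - k * dil d) $ n"
        by (rule fps_mult_nth_low) (use less low in auto)
      moreover have "(P * (d - k * dil d) + R * dil d) $ n = 0" using eq by simp
      ultimately show ?thesis using low P by simp
    qed (simp add: d0)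
  qed
  then show ?thesis by (simp add: fps_eq_iff)
qed

lemma eis_nth_0 [simp]: "eis1_chi4 $ 0 = 0" "eis1_chi8 $ 0 = 0" "eis2_psi8 $ 0 = 0" "eis3_chi4 $ 0 = 0" "eis3_chi8 $ 0 = 0" "odd_div1 $ 0 = 0" "odd_div3 $ 0 = 0"
  "odd_codiv1 $ 0 = 0" "odd_codiv5 $ 0 = 0"
  by (simp_all add: eis1_chi4_def eis1_chi8_def eis2_psi8_def eis3_chi4_def eis3_chi8_def odd_div1_def odd_div3_def odd_codiv1_def odd_codiv5_def)

lemma odd_sigma_nth_0 [simp]: "odd_sigma1 $ 0 = 0" "odd_sigma3 $ 0 = 0"
  by (simp_all add: odd_sigma1_def odd_sigma3_def ser_oo_def)

lemma odd_div1_split: "odd_div1 = dil odd_div1 + odd_sigma1"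
  unfolding odd_div1_def odd_sigma1_def
  by (subst ser_split_odd_e) (auto simp: ser_oo_def intro!: ser_cong)

lemma theta_log_series:
  "ser (\<lambda>d e. if odd e then if odd d then 2 * real d else - 2 * real d else 0) = 2 * odd_sigma1 - 4 * dil odd_codiv1"
proof -
  have "4 * dil odd_codiv1 = ser (\<lambda>d e. if even d \<and> odd e then 2 * real d else 0)"
    unfolding odd_codiv1_def dil_ser ser_numeral[symmetric] by (rule ser_cong) (auto elim!: evenE)
  moreover have "2 * odd_sigma1 = ser (\<lambda>d e. if odd d \<and> odd e then 2 * real d else 0)"
    unfolding odd_sigma1_def ser_oo_def ser_numeral[symmetric] by (rule ser_cong) auto
  ultimately have "ser (\<lambda>d e. if odd e then if odd d then 2 * real d else - 2 * real d else 0) + 4 * dil odd_codiv1 = 2 * odd_sigma1"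
    by (simp flip: ser_add) (rule ser_cong, auto)
  then show ?thesis by (simp add: algebra_simps)
qed

lemma fps_X_deriv_nth: "(fps_X * fps_deriv f) $ n = real n * f $ n"
  by (cases n) simp_all

lemma theta_deriv: "fps_X * fps_deriv theta = theta * (2 * odd_sigma1 - 4 * dil odd_codiv1)"
  by (rule fps_ext) (simp only: fps_X_deriv_nth theta_log_series[symmetric] theta_log_derivative)

lemma theta_fourth_deriv: "fps_X * fps_deriv (theta ^ 4) = 4 * theta ^ 4 * (2 * odd_sigma1 - 4 * dil odd_codiv1)"
proof -
  have "fps_X * fps_deriv (theta ^ 4) = 4 * theta ^ 3 * (fps_X * fps_deriv theta)"
    by (simp add: fps_deriv_power numeral_fps_const algebra_simps)
  then show ?thesis unfolding theta_deriv by (simp add: eval_nat_numeral algebra_simps)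
qed

lemma theta_fourth: "theta ^ 4 = (tX + tY)\<^sup>2"
  unfolding theta_square[symmetric] by simp

lemma dil_u_v: "dil ((tX + tY)\<^sup>2) = tX\<^sup>2" "dil (4 * tX * tY) = tY\<^sup>2"
  by (simp_all add: dil_hom tY_square flip: dil_tX_tY)

text \<open>This is the odd part of $q\,\frac{d}{dq}\theta^4 = 4\theta^4 L$ with \<open>L = 2 odd_sigma1 - 4 dil odd_codiv1\<close>.\<close>

lemma tX_tY_deriv:
  "fps_X * fps_deriv (4 * tX * tY) = 16 * odd_sigma1 * dil ((tX + tY)\<^sup>2 + 4 * tX * tY) - 16 * dil odd_codiv1 * (4 * tX * tY)"
proof (rule odd_series_eqI)
  have odd: "odd_series (tX * tY)"
    unfolding tX_def dil_power[symmetric] by (intro odd_series_dil_mult odd_series_tY)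
  have odd': "odd_series (4 * tX * tY)"
    unfolding mult.assoc by (intro odd_series_numeral odd)
  show "odd_series (fps_X * fps_deriv (4 * tX * tY))"
    using odd' unfolding odd_series_def fps_X_deriv_nth by simp
  have odd_sigma1: "odd_series odd_sigma1" by (simp add: odd_sigma1_def odd_series_ser_oo)
  show "odd_series (16 * odd_sigma1 * dil ((tX + tY)\<^sup>2 + 4 * tX * tY) - 16 * dil odd_codiv1 * (4 * tX * tY))"
    by (intro odd_series_diff odd_series_mult_dil odd_series_numeral odd_sigma1)
      (unfold mult.assoc, intro odd_series_numeral odd_series_dil_mult odd)
  fix n :: nat assume n: "odd n"
  \<comment> \<open>The even part tX^2 + tY^2 of the fourth power, written as a dilation, plus the
    odd part.\<close>
  have sq: "theta ^ 4 = dil ((tX + tY)\<^sup>2 + 4 * tX * tY) + 2 * (tX * tY)"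
    unfolding theta_fourth by (simp only: dil_add dil_u_v) (simp add: power2_eq_square algebra_simps)
  have "(fps_X * fps_deriv (4 * tX * tY)) $ n = 2 * (fps_X * fps_deriv (theta ^ 4)) $ n"
    unfolding fps_X_deriv_nth sq using n by (simp add: dil_nth mult.assoc)
  also have "\<dots> = (8 * theta ^ 4 * (2 * odd_sigma1 - 4 * dil odd_codiv1)) $ n"
    unfolding theta_fourth_deriv by (simp flip: numeral_mult_nth add: mult.assoc)
  also have "8 * theta ^ 4 * (2 * odd_sigma1 - 4 * dil odd_codiv1) = 16 * odd_sigma1 * dil ((tX + tY)\<^sup>2 + 4 * tX * tY) - 16 * dil odd_codiv1 * (4 * tX * tY)
      + (32 * (odd_sigma1 * (tX * tY)) - 32 * dil (odd_codiv1 * ((tX + tY)\<^sup>2 + 4 * tX * tY)))"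
    unfolding sq dil_mult[of odd_codiv1] by (simp only: ring_distribs mult.assoc mult.left_commute) simp
  also have "\<dots> $ n = (16 * odd_sigma1 * dil ((tX + tY)\<^sup>2 + 4 * tX * tY) - 16 * dil odd_codiv1 * (4 * tX * tY)) $ n"
    using n odd_series_mult_odd[OF odd_sigma1 odd n] by (simp add: dil_nth_odd)
  finally show "(fps_X * fps_deriv (4 * tX * tY)) $ n =
      (16 * odd_sigma1 * dil ((tX + tY)\<^sup>2 + 4 * tX * tY) - 16 * dil odd_codiv1 * (4 * tX * tY)) $ n" .
qed

text \<open>Both sides of each identity satisfy the same first order differential equation, coupled with a relation
  between a series and its even part. This determines all coefficients successively.\<close>

theorem jacobi_theta: "(tX + tY)\<^sup>2 + 4 * tX * tY = 1 + 24 * odd_div1" "tX * tY = 4 * odd_sigma1"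
proof -
  define h where "h = (tX + tY)\<^sup>2 + 4 * tX * tY"
  define d where "d = 4 * tX * tY - 16 * odd_sigma1"
  define e where "e = h - (1 + 24 * odd_div1)"
  have h: "h = 6 * (tX * tY) + dil h"
    unfolding h_def dil_add dil_u_v by (simp add: power2_eq_square algebra_simps)
  have e: "2 * e = 3 * d + 2 * dil e"
  proof -
    have odd_div1: "odd_div1 - dil odd_div1 = odd_sigma1" by (subst (1) odd_div1_split) simp
    have "2 * (e - dil e) = 2 * (h - dil h) - 48 * (odd_div1 - dil odd_div1)"
      by (simp add: e_def dil_hom algebra_simps)
    also have "h - dil h = 6 * (tX * tY)" by (subst (1) h) simp
    finally have "2 * (e - dil e) = 3 * d" unfolding odd_div1 d_def by (simp add: algebra_simps)
    then show ?thesis by (simp add: algebra_simps)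
  qed
  have odd_sigma3: "odd_sigma3 = odd_sigma1 * dil (1 + 24 * odd_div1)"
    using odd_sigma1_mult_dil_odd_div1 by (simp add: dil_hom algebra_simps)
  have "fps_X * fps_deriv odd_sigma1 = Abs_fps (\<lambda>n. real n * odd_sigma1 $ n)"
    unfolding fps_eq_iff fps_X_deriv_nth by simp
  then have odd_sigma1': "fps_X * fps_deriv odd_sigma1 = odd_sigma1 * dil (1 + 24 * odd_div1) - 16 * (dil odd_codiv1 * odd_sigma1)"
    using odd_sigma1_mult_dil_odd_codiv1 odd_sigma3 by (simp add: algebra_simps)
  have "fps_X * fps_deriv d = fps_X * fps_deriv (4 * tX * tY) - 16 * (fps_X * fps_deriv odd_sigma1)"
    by (simp add: d_def numeral_fps_const algebra_simps)
  also have "\<dots> = 16 * (odd_sigma1 * dil e) - 16 * (dil odd_codiv1 * d)"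
    unfolding odd_sigma1' tX_tY_deriv h_def[symmetric] e_def d_def by (simp add: dil_diff algebra_simps)
  finally have d: "fps_X * fps_deriv d = 16 * (odd_sigma1 * dil e) - 16 * (dil odd_codiv1 * d)" .
  have "d $ n = 0 \<and> e $ n = 0" for n
  proof (induction n rule: less_induct)
    case (less n)
    show ?case
    proof (cases "n = 0")
      case True
      then show ?thesis by (simp add: d_def e_def h_def power2_eq_square)
    next
      case False
      have dil0: "dil e $ j = 0" if "j \<le> n" "j > 0" for j
        using less[of "j div 2"] that False by (auto simp: dil_nth)
      have "e $ 0 = 0" using less[of 0] False by simp
      then have dil0: "dil e $ j = 0" if "j \<le> n" for j
        using dil0[of j] that by (cases "j = 0") simp_all
      then have "(odd_sigma1 * dil e) $ n = 0" by (auto simp: fps_mult_nth intro!: sum.neutral)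
      \<comment> \<open>The constant term of \<open>dil odd_codiv1\<close> is 0, so d_n drops out of
        the right side and n d_n = 0 remains.\<close>
      moreover have "(dil odd_codiv1 * d) $ n = dil odd_codiv1 $ 0 * d $ n"
        by (rule fps_mult_nth_low) (use less in auto)
      moreover have "real n * d $ n = (16 * (odd_sigma1 * dil e) - 16 * (dil odd_codiv1 * d)) $ n"
        unfolding d[symmetric] fps_X_deriv_nth ..
      ultimately have "d $ n = 0" using False by simp
      moreover have "2 * e $ n = 3 * d $ n + 2 * dil e $ n"
        using arg_cong[OF e, of "\<lambda>f. f $ n"] by simp
      ultimately show ?thesis using dil0 by simp
    qed
  qed
  then have "d = 0" "e = 0" by (simp_all add: fps_eq_iff)
  then show "(tX + tY)\<^sup>2 + 4 * tX * tY = 1 + 24 * odd_div1"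
    by (simp add: e_def h_def)
  have "4 * (tX * tY) = 4 * (4 * odd_sigma1)" using \<open>d = 0\<close> by (simp add: d_def mult.assoc)
  then show "tX * tY = 4 * odd_sigma1" by (simp only: mult_cancel_left) simp
qed

lemma odd_sigma3_theta: "4 * odd_sigma3 = tX * tY * (tX\<^sup>2 + tY\<^sup>2)"
proof -
  have "odd_sigma3 = odd_sigma1 * dil (1 + 24 * odd_div1)"
    using odd_sigma1_mult_dil_odd_div1 by (simp add: dil_hom algebra_simps)
  also have "dil (1 + 24 * odd_div1) = tX\<^sup>2 + tY\<^sup>2"
    unfolding jacobi_theta(1)[symmetric] dil_add dil_u_v ..
  finally show ?thesis by (simp add: jacobi_theta)
qed

text \<open>Both sides are solutions A of A(q^2) (A(q) - A(q^2)) = 4 \<open>odd_sigma1\<close>.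
  Subtracting the two equations leaves one that is linear in the difference and its
  dilation.\<close>

theorem two_squares: "theta\<^sup>2 = 1 + 4 * eis1_chi4"
proof -
  define d where "d = theta\<^sup>2 - (1 + 4 * eis1_chi4)"
  have dil_d: "dil d = tX - (1 + 4 * dil eis1_chi4)"
    by (simp add: d_def theta_square dil_hom flip: dil_tX_tY)
  have "d = 0"
  proof (rule dil_recursion_unique)
    show "tX * (d - 1 * dil d) + (4 * (eis1_chi4 - dil eis1_chi4)) * dil d = 0"
    proof -
      have "tX * (d - dil d) + (4 * (eis1_chi4 - dil eis1_chi4)) * dil d =
          tX * tY - (4 * (eis1_chi4 - dil eis1_chi4) + 16 * (dil eis1_chi4 * (eis1_chi4 - dil eis1_chi4)))"
        unfolding dil_d by (simp add: d_def theta_square algebra_simps)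
      also have "16 * (dil eis1_chi4 * (eis1_chi4 - dil eis1_chi4)) = 4 * (odd_sigma1 - (eis1_chi4 - dil eis1_chi4))"
        unfolding eis1_chi4_identity[symmetric] by simp
      finally show ?thesis by (simp add: jacobi_theta)
    qed
  qed (simp_all add: d_def power2_eq_square)
  then show ?thesis by (simp add: d_def)
qed

theorem square_plus_two_squares: "theta * dil theta = 1 + 2 * eis1_chi8"
proof -
  define d where "d = theta * dil theta - (1 + 2 * eis1_chi8)"
  let ?P = "dil (theta * dil theta)"
  have split: "theta * dil theta = ?P + theta_odd * dil theta"
    by (subst (1) theta_split) (simp add: dil_hom algebra_simps)
  have P: "?P * (theta_odd * dil theta) = 2 * odd_sigma1"
  proof -
    have "2 * (?P * (theta_odd * dil theta)) = tX * tY"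
      by (simp add: tX_def tY_def dil_hom power2_eq_square algebra_simps)
    also have "\<dots> = 2 * (2 * odd_sigma1)" by (simp add: jacobi_theta)
    finally show ?thesis by (simp only: mult_cancel_left) simp
  qed
  have "d = 0"
  proof (rule dil_recursion_unique)
    show "?P * (d - 1 * dil d) + (2 * (eis1_chi8 - dil eis1_chi8)) * dil d = 0"
    proof -
      have dil_d: "dil d = ?P - (1 + 2 * dil eis1_chi8)"
        by (simp add: d_def dil_diff dil_add dil_1 dil_numeral dil_mult[of 2])
      have "?P * (d - dil d) + (2 * (eis1_chi8 - dil eis1_chi8)) * dil d =
          ?P * (theta * dil theta - ?P) - (2 * (eis1_chi8 - dil eis1_chi8) + 4 * (dil eis1_chi8 * (eis1_chi8 - dil eis1_chi8)))"
        unfolding dil_d by (simp add: d_def algebra_simps)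
      also have "theta * dil theta - ?P = theta_odd * dil theta"
        by (subst (1) split) simp
      also have "4 * (dil eis1_chi8 * (eis1_chi8 - dil eis1_chi8)) = 2 * (odd_sigma1 - (eis1_chi8 - dil eis1_chi8))"
        unfolding eis1_chi8_identity[symmetric] by simp
      finally show ?thesis unfolding P by simp
    qed
  qed (simp_all add: d_def)
  then show ?thesis by (simp add: d_def)
qed

lemma dil_tX_add_tY: "dil tX + dil tY = tX"
  by (rule dil_tX_tY[symmetric])

lemma tX_eis1_chi4: "tX = 1 + 4 * dil eis1_chi4"
  using arg_cong[OF two_squares, of dil] by (simp add: theta_square dil_hom dil_tX_add_tY)

lemma tY_eis1_chi4: "tY = 4 * (eis1_chi4 - dil eis1_chi4)"
  using two_squares unfolding theta_square by (subst (asm) tX_eis1_chi4) (simp add: algebra_simps)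

text \<open>Once the weight 1 series is known, \<open>eis3_chi4_identity\<close> is linear in
  \<open>eis3_chi4\<close> with coefficients \<open>tX\<close> and \<open>4 * tY\<close>. The
  right-hand side satisfies the same equation by \<open>odd_sigma3_theta\<close>.\<close>

theorem eis3_chi4_theta: "4 * eis3_chi4 = (tX + tY) * tX * tY"
proof -
  define F where "F = (tX + tY) * tX * tY"
  define d where "d = 4 * eis3_chi4 - F"
  have dF: "4 * dil F = tX * tY\<^sup>2"
    unfolding F_def by (simp add: dil_mult dil_add dil_tX_add_tY tY_square)
  have odd_sigma3: "odd_sigma3 = tX * (eis3_chi4 - 4 * dil eis3_chi4) + 4 * tY * dil eis3_chi4"
  proof -
    have "tX * (eis3_chi4 - 4 * dil eis3_chi4) + 4 * tY * dil eis3_chi4 =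
        4 * (4 * dil eis3_chi4 * (eis1_chi4 - dil eis1_chi4) + dil eis1_chi4 * (eis3_chi4 - 4 * dil eis3_chi4)) + (eis3_chi4 - 4 * dil eis3_chi4)"
      unfolding tY_eis1_chi4 by (subst tX_eis1_chi4) (simp add: algebra_simps)
    then show ?thesis unfolding eis3_chi4_identity by simp
  qed
  have "d = 0"
  proof (rule dil_recursion_unique)
    have "dil d = 4 * dil eis3_chi4 - dil F" by (simp add: d_def dil_hom)
    then show "tX * (d - 4 * dil d) + 4 * tY * dil d = 0"
      using dF odd_sigma3 odd_sigma3_theta F_def d_def by Groebner_Basis.algebra
  qed (simp_all add: d_def F_def)
  then show ?thesis by (simp add: d_def F_def)
qed

text \<open>With the Eisenstein series E_4 = 1 + 240 q + ..., the left side is E_4(q) - 8 E_4(q^2) +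
  7; the 7 removes the constant term.\<close>

theorem odd_div3_theta: "240 * odd_div3 = 7 - 7 * (tX + tY) ^ 4 + 88 * tX * tY * (tX + tY)\<^sup>2 - 112 * tX\<^sup>2 * tY\<^sup>2"
proof -
  define F where "F = 7 - 7 * (tX + tY) ^ 4 + 88 * tX * tY * (tX + tY)\<^sup>2 - 112 * tX\<^sup>2 * tY\<^sup>2"
  define d where "d = 240 * odd_div3 - F"
  have odd_div3: "odd_div3 = dil odd_div3 + odd_sigma3"
    unfolding odd_div3_def odd_sigma3_def
    by (subst ser_split_odd_e) (auto simp: ser_oo_def intro!: ser_cong)
  have dF: "dil F = 7 - 7 * tX ^ 4 + 22 * tX\<^sup>2 * tY\<^sup>2 - 7 * tY ^ 4"
  proof -
    have "dil F = 7 - 7 * (dil tX + dil tY) ^ 4 + 88 * dil tX * dil tY * (dil tX + dil tY)\<^sup>2 - 112 * (dil tX)\<^sup>2 * (dil tY)\<^sup>2"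
      unfolding F_def by (simp add: dil_hom)
    then show ?thesis using dil_tX_add_tY tY_square by Groebner_Basis.algebra
  qed
  have "d = 0"
  proof (rule dil_recursion_unique)
    have "dil d = 240 * dil odd_div3 - dil F" by (simp add: d_def dil_hom)
    then show "1 * (d - 1 * dil d) + 0 * dil d = 0"
      using dF odd_div3 odd_sigma3_theta F_def d_def by Groebner_Basis.algebra
  qed (simp_all add: d_def F_def eval_nat_numeral)
  then show ?thesis by (simp add: d_def F_def)
qed

lemma odd_codiv5_split: "odd_codiv5 = 32 * dil odd_codiv5 + ser_oo (\<lambda>d e. real d ^ 5)"
  unfolding odd_codiv5_def
  \<comment> \<open>The nested \<open>num.Bit0\<close> is the binary numeral 32 = 2^5.\<close>
  by (subst ser_split_odd_d[where k = "num.Bit0 (num.Bit0 (num.Bit0 (num.Bit0 (num.Bit0 num.One))))"])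
    (auto simp: ser_oo_def power_mult_distrib intro!: ser_cong)

theorem odd_codiv5_theta: "4 * odd_codiv5 = tX * tY * (tX + tY)\<^sup>2 * ((tX + tY)\<^sup>2 + 4 * tX * tY)"
proof -
  define F where "F = tX * tY * (tX + tY)\<^sup>2 * ((tX + tY)\<^sup>2 + 4 * tX * tY)"
  define d where "d = 4 * odd_codiv5 - F"
  define o5 where "o5 = ser_oo (\<lambda>d e. real d ^ 5)"
  have odd_codiv5: "odd_codiv5 = 32 * dil odd_codiv5 + o5"
    unfolding o5_def by (rule odd_codiv5_split)
  have dF: "4 * dil F = tY\<^sup>2 * tX\<^sup>2 * (tX\<^sup>2 + tY\<^sup>2)"
  proof -
    have "dil F = dil tX * dil tY * (dil tX + dil tY)\<^sup>2 * ((dil tX + dil tY)\<^sup>2 + 4 * dil tX * dil tY)"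
      unfolding F_def by (simp add: dil_hom)
    then show ?thesis using dil_tX_add_tY tY_square by Groebner_Basis.algebra
  qed
  have odd_div1: "24 * dil odd_div1 = tX\<^sup>2 + tY\<^sup>2 - 1"
    using arg_cong[OF jacobi_theta(1), of dil] by (simp add: dil_add dil_u_v dil_1 dil_mult[of 24] dil_numeral)
  have odd_div3: "240 * dil odd_div3 = 7 - 7 * tX ^ 4 + 22 * tX\<^sup>2 * tY\<^sup>2 - 7 * tY ^ 4"
  proof -
    have "240 * dil odd_div3 = dil (240 * odd_div3)" by (simp add: dil_hom)
    also have "\<dots> = 7 - 7 * (dil tX + dil tY) ^ 4 + 88 * dil tX * dil tY * (dil tX + dil tY)\<^sup>2 - 112 * (dil tX)\<^sup>2 * (dil tY)\<^sup>2"
      unfolding odd_div3_theta by (simp add: dil_hom)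
    finally show ?thesis using dil_tX_add_tY tY_square by Groebner_Basis.algebra
  qed
  have "3 * (4 * o5) = 3 * (tX * tY * (tX ^ 4 + 14 * tX\<^sup>2 * tY\<^sup>2 + tY ^ 4))"
    using odd_sigma1_mult_dil_odd_div3[folded o5_def] odd_div1 odd_div3 odd_sigma3_theta jacobi_theta(2) by Groebner_Basis.algebra
  then have o5: "4 * o5 = tX * tY * (tX ^ 4 + 14 * tX\<^sup>2 * tY\<^sup>2 + tY ^ 4)"
    by (simp only: mult_cancel_left) simp
  have "d = 0"
  proof (rule dil_recursion_unique)
    have "dil d = 4 * dil odd_codiv5 - dil F" by (simp add: d_def dil_hom)
    then show "1 * (d - 32 * dil d) + 0 * dil d = 0"
      using dF odd_codiv5 o5 F_def d_def by Groebner_Basis.algebra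
  qed (simp_all add: d_def F_def)
  then show ?thesis by (simp add: d_def F_def)
qed

lemma dil_theta_eis1_chi8: "dil theta * dil (dil theta) = 1 + 2 * dil eis1_chi8"
  using arg_cong[OF square_plus_two_squares, of dil] by (simp add: dil_hom)

lemma theta_odd_eis1_chi8: "theta_odd * dil theta = 2 * (eis1_chi8 - dil eis1_chi8)"
proof -
  have "theta * dil theta = dil theta * dil (dil theta) + theta_odd * dil theta"
    by (subst (1) theta_split) (simp add: algebra_simps)
  then show ?thesis
    unfolding square_plus_two_squares dil_theta_eis1_chi8 by (simp add: algebra_simps)
qed

theorem eis2_psi8_theta: "4 * eis2_psi8 = theta * dil theta * tY"
proof -
  define F where "F = theta * dil theta * tY"
  define d where "d = 4 * eis2_psi8 - F"
  have dF: "dil F = dil theta * dil (dil theta) * theta_odd\<^sup>2"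
    unfolding F_def by (simp add: dil_mult dil_tY)
  have "2 * (eis2_psi8 - 2 * dil eis2_psi8) = dil tX * (theta_odd * dil theta)"
  proof -
    have "dil tX * (theta_odd * dil theta) = 2 * ((1 + 4 * dil (dil eis1_chi4)) * (eis1_chi8 - dil eis1_chi8))"
      unfolding theta_odd_eis1_chi8 by (subst tX_eis1_chi4) (simp add: dil_hom algebra_simps)
    also have "\<dots> = 2 * (4 * (dil (dil eis1_chi4) * (eis1_chi8 - dil eis1_chi8)) + (eis1_chi8 - dil eis1_chi8))"
      by (simp add: algebra_simps)
    finally show ?thesis unfolding eis2_psi8_identity by simp
  qed
  then have N: "2 * (eis2_psi8 - 2 * dil eis2_psi8) = (dil (dil theta))\<^sup>2 * (theta_odd * dil theta)"
    by (simp add: dil_tX)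
  have "d = 0"
  proof (rule dil_recursion_unique)
    have "dil d = 4 * dil eis2_psi8 - dil F" by (simp add: d_def dil_hom)
    then show "1 * (d - 2 * dil d) + 0 * dil d = 0"
      using dF N F_def d_def tY_def theta_split by Groebner_Basis.algebra
  qed (simp_all add: d_def F_def)
  then show ?thesis by (simp add: d_def F_def)
qed

text \<open>\<open>eis2_psi8_theta\<close> makes the third product of
  \<open>eis3_chi8_identity\<close> a known term, which leaves an equation linear in
  \<open>eis3_chi8\<close>. Its leading factor theta(q^2) theta(q^4) has constant term 1.\<close>

theorem eis3_chi8_theta: "8 * eis3_chi8 = theta * dil theta * tY * (2 * tX + tY)"
proof -
  define F where "F = theta * dil theta * tY * (2 * tX + tY)"
  define d where "d = 8 * eis3_chi8 - F"
  have dF: "dil F = dil theta * dil (dil theta) * theta_odd\<^sup>2 * (2 * (dil (dil theta))\<^sup>2 + theta_odd\<^sup>2)"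
    unfolding F_def by (simp add: dil_mult dil_add dil_tY dil_tX dil_numeral)
  have dN: "4 * dil eis2_psi8 = dil theta * dil (dil theta) * theta_odd\<^sup>2"
    using arg_cong[OF eis2_psi8_theta, of dil] by (simp add: dil_mult[of 4] dil_mult[of _ tY] dil_mult[of theta] dil_tY dil_numeral)
  define G where "G = dil (theta * dil theta)"
  have G: "G = dil theta * dil (dil theta)" by (simp add: G_def dil_hom)
  have "d = 0"
  proof (rule dil_recursion_unique)
    have dd: "dil d = 8 * dil eis3_chi8 - dil F" by (simp add: d_def dil_hom)
    have "2 * (4 * dil eis3_chi8 * (eis1_chi8 - dil eis1_chi8) + dil eis1_chi8 * (eis3_chi8 - 4 * dil eis3_chi8) + 4 * dil eis2_psi8 * (eis2_psi8 - 2 * dil eis2_psi8)) =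
      odd_sigma3 - (eis3_chi8 - 4 * dil eis3_chi8)" by (rule eis3_chi8_identity)
    then show "G * (d - 4 * dil d) + 4 * (theta_odd * dil theta) * dil d = 0"
      using dd dF dN eis2_psi8_theta odd_sigma3_theta theta_odd_eis1_chi8 dil_theta_eis1_chi8 F_def d_def tY_def tX_alt tX_def theta_split G by Groebner_Basis.algebra
  qed (simp_all add: d_def F_def G_def)
  then show ?thesis by (simp add: d_def F_def)
qed

section \<open>The second Eisenstein series of weight 3\<close>

text \<open>On a series whose exponents lie in one residue class, the twist by a character of that
  modulus is multiplication by a constant.\<close>

definition supports :: "nat \<Rightarrow> nat \<Rightarrow> real fps \<Rightarrow> bool" where
  "supports m r f \<longleftrightarrow> (\<forall>n. f $ n \<noteq> 0 \<longrightarrow> n mod m = r mod m)"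

definition twist :: "(nat \<Rightarrow> real) \<Rightarrow> real fps \<Rightarrow> real fps" where
  "twist c f = Abs_fps (\<lambda>n. c n * f $ n)"

lemma twist_nth: "twist c f $ n = c n * f $ n"
  by (simp add: twist_def)

lemma twist_add: "twist c (f + g) = twist c f + twist c g"
  by (rule fps_ext) (simp add: twist_nth algebra_simps)

lemma twist_numeral: "twist c (numeral k * f) = numeral k * twist c f"
  by (rule fps_ext) (simp add: twist_nth)

lemma supports_mult: "supports m r f \<Longrightarrow> supports m s g \<Longrightarrow> supports m (r + s) (f * g)"
  unfolding supports_def
proof (intro allI impI)
  fix n assume f: "\<forall>n. f $ n \<noteq> 0 \<longrightarrow> n mod m = r mod m" and g: "\<forall>n. g $ n \<noteq> 0 \<longrightarrow> n mod m = s mod m"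
    and n: "(f * g) $ n \<noteq> 0"
  then obtain i where i: "i \<le> n" "f $ i \<noteq> 0" "g $ (n - i) \<noteq> 0"
    unfolding fps_mult_nth by (metis (no_types, lifting) atLeastAtMost_iff mult_eq_0_iff sum.neutral)
  then have "(i + (n - i)) mod m = (r + s) mod m"
    using f g by (metis mod_add_eq)
  then show "n mod m = (r + s) mod m" using i by simp
qed

lemma supports_power: "supports m r f \<Longrightarrow> supports m (k * r) (f ^ k)"
proof (induction k)
  case 0
  show ?case by (simp add: supports_def)
next
  case (Suc k)
  then show ?case using supports_mult[of m r f "k * r" "f ^ k"] by simp
qed

lemma supports_dil: "supports m r f \<Longrightarrow> supports (2 * m) (2 * r) (dil f)"
  unfolding supports_def
proof (intro allI impI)
  fix n assume f: "\<forall>n. f $ n \<noteq> 0 \<longrightarrow> n mod m = r mod m" and n: "dil f $ n \<noteq> 0"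
  then obtain k where k: "n = 2 * k" by (auto simp: dil_nth split: if_splits elim: evenE)
  then have "k mod m = r mod m" using f n by simp
  then show "n mod (2 * m) = 2 * r mod (2 * m)" unfolding k by (simp flip: mult_mod_right)
qed

lemma supports_1: "supports 1 0 f"
  by (simp add: supports_def)

lemma supports_mod: "supports m r f \<Longrightarrow> k dvd m \<Longrightarrow> supports k r f"
  unfolding supports_def by (metis mod_mod_cancel)

lemma twist_chi4: "supports 4 r f \<Longrightarrow> twist chi4 f = fps_const (chi4 r) * f"
proof (rule fps_ext)
  fix n assume f: "supports 4 r f"
  show "twist chi4 f $ n = (fps_const (chi4 r) * f) $ n"
  proof (cases "f $ n = 0")
    case False
    then have "n mod 4 = r mod 4" using f by (simp add: supports_def)
    then show ?thesis by (simp only: twist_nth chi4_def fps_mult_left_const_nth)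
  qed (simp add: twist_nth)
qed

lemma twist_chi8: "supports 8 r f \<Longrightarrow> twist chi8 f = fps_const (chi8 r) * f"
proof (rule fps_ext)
  fix n assume f: "supports 8 r f"
  show "twist chi8 f $ n = (fps_const (chi8 r) * f) $ n"
  proof (cases "f $ n = 0")
    case False
    then have "n mod 8 = r mod 8" using f by (simp add: supports_def)
    then show ?thesis by (simp only: twist_nth chi8_def fps_mult_left_const_nth)
  qed (simp add: twist_nth)
qed

lemma supports_theta_odd: "supports 8 1 theta_odd"
  by (simp add: supports_def theta_odd_mod_8)

lemma supports_dil_dil_theta: "supports 4 0 (dil (dil theta))"
  using supports_dil[OF supports_dil[OF supports_1]] by simp

text \<open>At odd \<open>n\<close> the two Eisenstein series of weight 3 and character \<open>chi\<close> differ by the factor \<open>chi n\<close>. On the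
  theta side, this twist is read off from the residues of the exponents in the dissection of \<open>theta\<close>.\<close>

lemma twist_ser_oo:
  assumes mult: "\<And>m n. c (m * n) = c m * c n" and sq: "\<And>e. odd e \<Longrightarrow> c e * c e = 1"
  shows "twist c (ser_oo (\<lambda>d e. (real d)\<^sup>2 * c e)) = ser_oo (\<lambda>d e. (real d)\<^sup>2 * c d)"
proof (rule odd_series_eqI)
  fix n :: nat assume n: "odd n"
  have "c n * ((real d)\<^sup>2 * c e) = (real d)\<^sup>2 * c d" if "(d, e) \<in> pairs n" for d e
  proof -
    have e: "odd e" "n = d * e" using that n by (auto simp: pairs_def)
    then have "c n * ((real d)\<^sup>2 * c e) = (real d)\<^sup>2 * c d * (c e * c e)" by (simp add: mult)
    then show ?thesis using sq[OF e(1)] by simp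
  qed
  then show "twist c (ser_oo (\<lambda>d e. (real d)\<^sup>2 * c e)) $ n = ser_oo (\<lambda>d e. (real d)\<^sup>2 * c d) $ n"
    unfolding twist_nth ser_oo_nth[OF n] sum_distrib_left by (auto intro!: sum.cong)
qed (use odd_series_ser_oo in \<open>auto simp: odd_series_def twist_nth\<close>)

text \<open>The modular forms are these series minus 1/4 and 3/2 respectively; the two constants are
  -L(-2, chi) / 2.\<close>

definition dual3_chi4 :: "real fps" where "dual3_chi4 = ser (\<lambda>d e. (real d)\<^sup>2 * chi4 d)"
definition dual3_chi8 :: "real fps" where "dual3_chi8 = ser (\<lambda>d e. (real d)\<^sup>2 * chi8 d)"

lemma eis_dual_nth_0 [simp]: "dual3_chi4 $ 0 = 0" "dual3_chi8 $ 0 = 0"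
  by (simp_all add: dual3_chi4_def dual3_chi8_def)

lemma dual3_chi4_split: "dual3_chi4 = dil dual3_chi4 + ser_oo (\<lambda>d e. (real d)\<^sup>2 * chi4 d)"
  unfolding dual3_chi4_def by (rule ser_split_odd_e) auto

lemma dual3_chi8_split: "dual3_chi8 = dil dual3_chi8 + ser_oo (\<lambda>d e. (real d)\<^sup>2 * chi8 d)"
  unfolding dual3_chi8_def by (rule ser_split_odd_e) auto

lemma eis3_chi4_odd_theta: "4 * ser_oo (\<lambda>d e. (real d)\<^sup>2 * chi4 e) = tX\<^sup>2 * tY"
proof -
  have "4 * dil eis3_chi4 = dil tX * dil tY * (dil tX + dil tY)"
    using arg_cong[OF eis3_chi4_theta, of dil] by (simp add: dil_hom algebra_simps)
  then show ?thesis using eis3_chi4_split eis3_chi4_theta dil_tX_add_tY tY_square by Groebner_Basis.algebra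
qed

theorem dual3_chi4_theta: "4 * dual3_chi4 = 1 - (tX + tY) * (tX - tY)\<^sup>2"
proof -
  define F where "F = (tX + tY) * (tX - tY)\<^sup>2"
  define d where "d = 4 * dual3_chi4 - 1 + F"
  let ?c = "dil (dil theta)" and ?b = theta_odd
  have b: "supports 4 1 ?b" by (rule supports_mod[OF supports_theta_odd]) simp
  note c = supports_dil_dil_theta
  \<comment> \<open>The exponents of c are divisible by 4 and those of b are 1 modulo 4, so the
    power of b alone decides the value of \<open>chi4\<close>.\<close>
  have t: "twist chi4 (?c ^ 5 * ?b) = ?c ^ 5 * ?b" "twist chi4 (?c ^ 3 * ?b ^ 3) = - (?c ^ 3 * ?b ^ 3)"
    "twist chi4 (?c * ?b ^ 5) = ?c * ?b ^ 5"
    using twist_chi4[OF supports_mult[OF supports_power[OF c, of 5] b]]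
      twist_chi4[OF supports_mult[OF supports_power[OF c, of 3] supports_power[OF b, of 3]]]
      twist_chi4[OF supports_mult[OF c supports_power[OF b, of 5]]]
    by (simp_all add: chi4_def flip: fps_const_neg)
  have "tX\<^sup>2 * tY = 2 * (?c ^ 5 * ?b) + (4 * (?c ^ 3 * ?b ^ 3) + 2 * (?c * ?b ^ 5))"
    using tX_alt tY_def by Groebner_Basis.algebra
  then have "twist chi4 (4 * ser_oo (\<lambda>d e. (real d)\<^sup>2 * chi4 e)) =
      2 * (?c ^ 5 * ?b) + (4 * - (?c ^ 3 * ?b ^ 3) + 2 * (?c * ?b ^ 5))"
    unfolding eis3_chi4_odd_theta by (simp only: twist_add twist_numeral t)
  also have "\<dots> = tY * (tX\<^sup>2 - tY\<^sup>2)"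
    using tX_alt tY_def by Groebner_Basis.algebra
  finally have o: "4 * ser_oo (\<lambda>d e. (real d)\<^sup>2 * chi4 d) = tY * (tX\<^sup>2 - tY\<^sup>2)"
    by (simp add: twist_numeral twist_ser_oo[of chi4] chi4_mult chi4_square)
  have dF: "dil F = (dil tX + dil tY) * (dil tX - dil tY)\<^sup>2" by (simp add: F_def dil_hom)
  have "d = 0"
  proof (rule dil_recursion_unique)
    have "dil d = 4 * dil dual3_chi4 - 1 + dil F" by (simp add: d_def dil_hom)
    then show "1 * (d - 1 * dil d) + 0 * dil d = 0"
      using dF dil_tX_add_tY tY_square dual3_chi4_split o d_def F_def by Groebner_Basis.algebra
  qed (simp_all add: d_def F_def power2_eq_square)
  then show ?thesis by (simp add: d_def F_def algebra_simps)
qed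

lemma eis3_chi8_odd_theta:
  "8 * ser_oo (\<lambda>d e. (real d)\<^sup>2 * chi8 e) =
    4 * dil theta * (dil (dil theta))\<^sup>2 * theta_odd * ((dil (dil theta))\<^sup>2 + 2 * theta_odd\<^sup>2)"
proof -
  have "8 * dil eis3_chi8 = dil theta * dil (dil theta) * dil tY * (2 * dil tX + dil tY)"
    using arg_cong[OF eis3_chi8_theta, of dil] by (simp only: dil_hom)
  then have "8 * dil eis3_chi8 = dil theta * dil (dil theta) * theta_odd\<^sup>2 * (2 * (dil (dil theta))\<^sup>2 + theta_odd\<^sup>2)"
    by (simp only: dil_tX dil_tY)
  then show ?thesis using eis3_chi8_split eis3_chi8_theta tX_alt tY_def theta_split by Groebner_Basis.algebra
qed

lemma dil_theta_split: "dil theta = dil (dil (dil theta)) + dil theta_odd"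
  using arg_cong[OF theta_split, of dil] by (simp add: dil_add)

lemma dil_dil_theta_square: "(dil (dil theta))\<^sup>2 = (dil (dil (dil theta)))\<^sup>2 + (dil theta_odd)\<^sup>2"
  using arg_cong[OF tX_alt, of dil] by (simp add: dil_tX dil_add dil_power)

lemma theta_odd_square: "theta_odd\<^sup>2 = 2 * dil (dil (dil theta)) * dil theta_odd"
  unfolding dil_tY[symmetric] tY_def by (simp add: dil_mult dil_numeral)

text \<open>The exponents of c = theta(q^4) are ambiguous modulo 8, so the dissection goes one level
  further: with e = theta(q^8) and f = \<open>dil theta_odd\<close>, the series
  \<open>dil theta\<close>, c^2 and b^2 are polynomials in e and f, and b e^i f^j has exponents 1 +
  2 j modulo 8.\<close>

theorem dual3_chi8_theta: "2 * dual3_chi8 = 3 - theta * dil theta * (tX - tY) * (3 * tX + tY)"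
proof -
  define F where "F = theta * dil theta * (tX - tY) * (3 * tX + tY)"
  define d where "d = 2 * dual3_chi8 - 3 + F"
  define b where "b = theta_odd"
  define e where "e = dil (dil (dil theta))"
  define f where "f = dil theta_odd"
  have sb: "supports 8 1 b" unfolding b_def by (rule supports_theta_odd)
  have se: "supports 8 0 e" unfolding e_def using supports_dil[OF supports_dil_dil_theta] by simp
  have sf: "supports 8 2 f" unfolding f_def
    by (rule supports_mod[OF supports_dil[OF supports_theta_odd, simplified]]) simp
  have s: "supports 8 (1 + (i * 0 + j * 2)) (b * (e ^ i * f ^ j))" for i j
    by (intro supports_mult supports_power sb se sf)
  have t: "twist chi8 (b * (e ^ i * f ^ j)) = fps_const (chi8 (1 + (i * 0 + j * 2))) * (b * (e ^ i * f ^ j))" for i j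
    by (rule twist_chi8[OF s])
  have chi: "chi8 3 = 1" "chi8 5 = - 1" "chi8 7 = - 1" "chi8 9 = 1" "chi8 11 = 1"
    by (simp_all add: chi8_def)
  define P where "P = (\<lambda>i j. b * (e ^ i * f ^ j))"
  have tP: "twist chi8 (P 5 0) = P 5 0" "twist chi8 (P 4 1) = P 4 1" "twist chi8 (P 3 2) = - P 3 2"
    "twist chi8 (P 2 3) = - P 2 3" "twist chi8 (P 1 4) = P 1 4" "twist chi8 (P 0 5) = P 0 5"
    unfolding P_def t by (simp_all add: chi flip: fps_const_neg numeral_3_eq_3)
  define c where "c = dil (dil theta)"
  have sq: "dil theta = e + f" "c\<^sup>2 = e\<^sup>2 + f\<^sup>2" "b\<^sup>2 = 2 * e * f"
    unfolding e_def f_def b_def c_def by (fact dil_theta_split dil_dil_theta_square theta_odd_square)+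
  have "4 * dil theta * c\<^sup>2 * b * (c\<^sup>2 + 2 * b\<^sup>2) =
      4 * (P 5 0 + (5 * P 4 1 + (6 * P 3 2 + (6 * P 2 3 + (5 * P 1 4 + P 0 5)))))"
    unfolding P_def using sq by Groebner_Basis.algebra
  then have "8 * ser_oo (\<lambda>d e. (real d)\<^sup>2 * chi8 e) =
      4 * (P 5 0 + (5 * P 4 1 + (6 * P 3 2 + (6 * P 2 3 + (5 * P 1 4 + P 0 5)))))"
    unfolding c_def b_def eis3_chi8_odd_theta .
  from arg_cong[OF this, of "twist chi8"] have "twist chi8 (8 * ser_oo (\<lambda>d e. (real d)\<^sup>2 * chi8 e)) =
      4 * (P 5 0 + (5 * P 4 1 + (6 * - P 3 2 + (6 * - P 2 3 + (5 * P 1 4 + P 0 5)))))"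
    by (simp only: twist_add twist_numeral tP)
  moreover have tw: "twist chi8 (ser_oo (\<lambda>d e. (real d)\<^sup>2 * chi8 e)) = ser_oo (\<lambda>d e. (real d)\<^sup>2 * chi8 d)"
    by (rule twist_ser_oo) (simp_all add: chi8_mult chi8_square)
  ultimately have "8 * ser_oo (\<lambda>d e. (real d)\<^sup>2 * chi8 d) =
      4 * (P 5 0 + (5 * P 4 1 + (6 * - P 3 2 + (6 * - P 2 3 + (5 * P 1 4 + P 0 5)))))"
    by (simp only: twist_numeral tw)
  then have "4 * (2 * ser_oo (\<lambda>d e. (real d)\<^sup>2 * chi8 d)) =
      4 * (b * (e ^ 5 + 5 * e ^ 4 * f - 6 * e ^ 3 * f\<^sup>2 - 6 * e\<^sup>2 * f ^ 3 + 5 * e * f ^ 4 + f ^ 5))"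
    unfolding P_def by (simp add: algebra_simps)
  then have o: "2 * ser_oo (\<lambda>d e. (real d)\<^sup>2 * chi8 d) =
      b * (e ^ 5 + 5 * e ^ 4 * f - 6 * e ^ 3 * f\<^sup>2 - 6 * e\<^sup>2 * f ^ 3 + 5 * e * f ^ 4 + f ^ 5)"
    by (simp only: mult_cancel_left) simp
  have dF: "dil F = dil theta * c * (c\<^sup>2 - b\<^sup>2) * (3 * c\<^sup>2 + b\<^sup>2)"
    unfolding F_def b_def c_def by (simp add: dil_hom dil_tX dil_tY)
  have "d = 0"
  proof (rule dil_recursion_unique)
    have dd: "dil d = 2 * dil dual3_chi8 - 3 + dil F" by (simp add: d_def dil_hom)
    have "F - dil F + b * (e ^ 5 + 5 * e ^ 4 * f - 6 * e ^ 3 * f\<^sup>2 - 6 * e\<^sup>2 * f ^ 3 + 5 * e * f ^ 4 + f ^ 5) = 0"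
    proof -
      have "theta = c + b" "tX = c\<^sup>2 + b\<^sup>2" "tY = 2 * c * b"
        unfolding b_def c_def by (fact theta_split tX_alt tY_def)+
      then show ?thesis using sq dF F_def by Groebner_Basis.algebra
    qed
    then show "1 * (d - 1 * dil d) + 0 * dil d = 0"
      using dd o dual3_chi8_split d_def by Groebner_Basis.algebra
  qed (simp_all add: d_def F_def)
  then show ?thesis by (simp add: d_def F_def algebra_simps)
qed

section \<open>Squares of the weight 3 series\<close>

text \<open>\<open>dual6\<close> is the Eisenstein series of weight 6 and level 2 with nonzero constant term; \<open>odd_codiv5\<close> is the other one.\<close>

definition dual6 :: "real fps" where
  "dual6 = ((tX + tY)\<^sup>2 - 4 * tX * tY)\<^sup>2 * ((tX + tY)\<^sup>2 + 4 * tX * tY)"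

lemma dil_plus_odd_nth: "odd_series g \<Longrightarrow> (dil f + g) $ (2 * n) = f $ n"
  by (simp add: odd_series_nth)

definition even_series :: "real fps \<Rightarrow> bool" where
  "even_series f \<longleftrightarrow> (\<forall>n. odd n \<longrightarrow> f $ n = 0)"

lemma even_series_dil: "even_series (dil f)"
  by (simp add: even_series_def dil_nth_odd)

lemma even_series_add: "even_series f \<Longrightarrow> even_series g \<Longrightarrow> even_series (f + g)"
  by (simp add: even_series_def)

lemma even_series_diff: "even_series f \<Longrightarrow> even_series g \<Longrightarrow> even_series (f - g)"
  by (simp add: even_series_def)

lemma even_series_mult:
  assumes "even_series f" "even_series g"
  shows "even_series (f * g)"
  unfolding even_series_def fps_mult_nth
proof (intro allI impI sum.neutral ballI)
  fix n i :: nat assume "odd n" "i \<in> {0..n}"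
  then show "f $ i * g $ (n - i) = 0"
    using assms by (cases "even i") (auto simp: even_series_def)
qed

lemma even_series_numeral: "even_series (numeral k)"
  using even_series_dil[of "numeral k"] by (simp add: dil_numeral)

lemma even_series_tX_power: "even_series (tX ^ k)"
  unfolding tX_def dil_power[symmetric] by (rule even_series_dil)

lemma even_series_tX: "even_series tX"
  using even_series_tX_power[of 1] by simp

lemma even_series_tY_square: "even_series (tY\<^sup>2)"
  unfolding dil_u_v(2)[symmetric] by (rule even_series_dil)

lemma even_series_tY_fourth: "even_series (tY ^ 4)"
  using even_series_mult[OF even_series_tY_square even_series_tY_square] by (simp flip: power_add)

lemmas even_series_intros = even_series_add even_series_diff even_series_mult even_series_numeral
  even_series_tX even_series_tX_power even_series_tY_square even_series_tY_fourth

lemma odd_series_tY_mult: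
  assumes "even_series f"
  shows "odd_series (tY * f)"
  unfolding odd_series_def fps_mult_nth
proof (intro allI impI sum.neutral ballI)
  fix n i :: nat assume "even n" "i \<in> {0..n}"
  then show "tY $ i * f $ (n - i) = 0"
    using assms odd_series_tY by (cases "even i") (auto simp: even_series_def odd_series_def)
qed

text \<open>\<open>tX\<close> and the square of \<open>tY\<close> have even exponents only and
  \<open>tY\<close> odd ones only, so reading coefficients at 2 n discards a remainder that is odd
  in \<open>tY\<close>.\<close>

lemma dil_plus_tY_nth:
  assumes "g = dil f + tY * h" "even_series h"
  shows "g $ (2 * n) = f $ n"
  unfolding assms(1) by (rule dil_plus_odd_nth[OF odd_series_tY_mult[OF assms(2)]])

lemma dil_odd_codiv5: "16 * dil odd_codiv5 = tX\<^sup>2 * tY\<^sup>2 * (tX\<^sup>2 + tY\<^sup>2)"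
proof -
  have "4 * dil odd_codiv5 = dil tX * dil tY * (dil tX + dil tY)\<^sup>2 * ((dil tX + dil tY)\<^sup>2 + 4 * dil tX * dil tY)"
    using arg_cong[OF odd_codiv5_theta, of dil] by (simp only: dil_hom)
  then show ?thesis using dil_tX_add_tY tY_square by Groebner_Basis.algebra
qed

lemma dil_dual6: "dil dual6 = (tX\<^sup>2 - tY\<^sup>2)\<^sup>2 * (tX\<^sup>2 + tY\<^sup>2)"
  unfolding dual6_def dil_mult[of "_\<^sup>2"] dil_power[of "_ - _"] dil_add[of "_\<^sup>2"] dil_diff[of "_\<^sup>2"] dil_u_v ..

lemma eis3_chi4_square_nth: "(eis3_chi4\<^sup>2) $ (2 * n) = odd_codiv5 $ n"
proof -
  have eq: "16 * eis3_chi4\<^sup>2 = dil (16 * odd_codiv5) + tY * (2 * tX ^ 3 * tY\<^sup>2)"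
    using eis3_chi4_theta dil_odd_codiv5 unfolding dil_mult[of 16] dil_numeral by Groebner_Basis.algebra
  have "(16 * eis3_chi4\<^sup>2) $ (2 * n) = (16 * odd_codiv5) $ n"
    by (rule dil_plus_tY_nth[OF eq]) (intro even_series_intros)
  then show ?thesis by simp
qed

lemma dual6_nth_double: "dual6 $ (2 * n) = dual6 $ n - 256 * odd_codiv5 $ n"
proof -
  have eq: "dual6 = dil (dual6 - 256 * odd_codiv5) + tY * (2 * tX * (tX ^ 4 + 14 * tX\<^sup>2 * tY\<^sup>2 + tY ^ 4))"
    unfolding dil_diff dil_mult[of 256] dil_numeral
    using dil_odd_codiv5 dil_dual6 dual6_def by Groebner_Basis.algebra
  have "dual6 $ (2 * n) = (dual6 - 256 * odd_codiv5) $ n"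
    by (rule dil_plus_tY_nth[OF eq]) (intro even_series_intros)
  then show ?thesis by simp
qed

lemma dual6_nth_odd: "odd n \<Longrightarrow> dual6 $ n = 8 * ser_oo (\<lambda>d e. real d ^ 5) $ n"
proof -
  assume n: "odd n"
  have "dual6 = dil (dual6 - 256 * odd_codiv5) + 8 * ser_oo (\<lambda>d e. real d ^ 5)"
    unfolding dil_diff dil_mult[of 256] dil_numeral
    using dil_odd_codiv5 dil_dual6 dual6_def odd_codiv5_theta odd_codiv5_split by Groebner_Basis.algebra
  from arg_cong[OF this, of "\<lambda>f. f $ n"] show ?thesis using n by (simp add: dil_nth_odd)
qed

lemma odd_codiv5_nth_double: "odd_codiv5 $ (2 * n) = 32 * odd_codiv5 $ n"
  using arg_cong[OF odd_codiv5_split, of "\<lambda>f. f $ (2 * n)"] odd_series_nth[OF odd_series_ser_oo] by simp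

lemma odd_codiv5_nth_odd: "odd n \<Longrightarrow> odd_codiv5 $ n = ser_oo (\<lambda>d e. real d ^ 5) $ n"
  using arg_cong[OF odd_codiv5_split, of "\<lambda>f. f $ n"] by (simp add: dil_nth_odd)

lemma odd_codiv5_nth: "odd m \<Longrightarrow> odd_codiv5 $ (2 ^ j * m) = 32 ^ j * ser_oo (\<lambda>d e. real d ^ 5) $ m"
proof (induction j)
  case (Suc j)
  then show ?case using odd_codiv5_nth_double[of "2 ^ j * m"] by (simp add: mult.assoc)
qed (simp add: odd_codiv5_nth_odd)

text \<open>Iterating \<open>dual6_nth_double\<close> subtracts 256 times the sum of 32^i for i < j
  from the initial factor 8 = 248 / 31; the 63 arises from 248 + 256 = 8 * 63.\<close>

lemma dual6_nth: "odd m \<Longrightarrow> dual6 $ (2 ^ j * m) = 8 * ((63 - 32 ^ Suc j) / 31) * ser_oo (\<lambda>d e. real d ^ 5) $ m"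
proof (induction j)
  case (Suc j)
  then show ?case
    using dual6_nth_double[of "2 ^ j * m"] odd_codiv5_nth[of m j] by (simp add: mult.assoc field_simps)
qed (simp add: dual6_nth_odd)

lemma dual3_chi4_square_nth: "((dual3_chi4 - fps_const (1 / 4))\<^sup>2) $ (2 * n) = dual6 $ n / 16"
proof -
  have "4 * fps_const (1 / 4 :: real) = 1" by (simp add: numeral_fps_const)
  then have B: "4 * (dual3_chi4 - fps_const (1 / 4)) = - (tX + tY) * (tX - tY)\<^sup>2"
    using dual3_chi4_theta by Groebner_Basis.algebra
  have eq: "16 * (dual3_chi4 - fps_const (1 / 4))\<^sup>2 = dil dual6 + tY * (tX * (4 * tX\<^sup>2 * tY\<^sup>2 - 2 * tX ^ 4 - 2 * tY ^ 4))"
    using B dil_dual6 by Groebner_Basis.algebra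
  have "(16 * (dual3_chi4 - fps_const (1 / 4))\<^sup>2) $ (2 * n) = dual6 $ n"
    by (rule dil_plus_tY_nth[OF eq]) (intro even_series_intros)
  then show ?thesis by simp
qed

text \<open>Halving the exponent once leaves a polynomial in u and v that is not a multiple of
  \<open>odd_codiv5\<close>; only the second halving produces one. The factor is 2304 / 64 =
  36.\<close>

lemma eis3_chi8_square_nth: "(eis3_chi8\<^sup>2) $ (4 * n) = 36 * odd_codiv5 $ n"
proof -
  define u where "u = (tX + tY)\<^sup>2"
  define v where "v = 4 * tX * tY"
  have du: "dil u = tX\<^sup>2" and dv: "dil v = tY\<^sup>2"
    unfolding u_def v_def by (fact dil_u_v)+
  have A: "theta\<^sup>2 = tX + tY" "(dil theta)\<^sup>2 = tX" by (simp_all add: theta_square tX_def)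
  have eq: "64 * eis3_chi8\<^sup>2 = dil (4 * u\<^sup>2 * v + 5 * u * v\<^sup>2) + tY * (tX * (8 * tX\<^sup>2 * tY\<^sup>2 + tY ^ 4))"
    unfolding dil_hom du dv using eis3_chi8_theta A by Groebner_Basis.algebra
  have 1: "(64 * eis3_chi8\<^sup>2) $ (2 * (2 * n)) = (4 * u\<^sup>2 * v + 5 * u * v\<^sup>2) $ (2 * n)"
    by (rule dil_plus_tY_nth[OF eq]) (intro even_series_intros)
  have eq: "4 * u\<^sup>2 * v + 5 * u * v\<^sup>2 = dil (2304 * odd_codiv5) + tY * (16 * tX * (tX ^ 4 + 16 * tX\<^sup>2 * tY\<^sup>2 + tY ^ 4))"
    unfolding dil_mult[of 2304] dil_numeral using dil_odd_codiv5 u_def v_def by Groebner_Basis.algebra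
  have 2: "(4 * u\<^sup>2 * v + 5 * u * v\<^sup>2) $ (2 * n) = (2304 * odd_codiv5) $ n"
    by (rule dil_plus_tY_nth[OF eq]) (intro even_series_intros)
  show ?thesis using 1 unfolding 2 by simp
qed

lemma dual3_chi8_square_nth: "((dual3_chi8 - fps_const (3 / 2))\<^sup>2) $ (4 * n) = 9 / 4 * dual6 $ n"
proof -
  define u where "u = (tX + tY)\<^sup>2"
  define v where "v = 4 * tX * tY"
  have du: "dil u = tX\<^sup>2" and dv: "dil v = tY\<^sup>2"
    unfolding u_def v_def by (fact dil_u_v)+
  have A: "theta\<^sup>2 = tX + tY" "(dil theta)\<^sup>2 = tX" by (simp_all add: theta_square tX_def)
  have "2 * fps_const (3 / 2 :: real) = 3" by (simp add: numeral_fps_const)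
  then have "2 * (dual3_chi8 - fps_const (3 / 2)) = 2 * dual3_chi8 - 3" by (simp add: right_diff_distrib)
  then have B: "2 * (dual3_chi8 - fps_const (3 / 2)) = - (theta * dil theta * (tX - tY) * (3 * tX + tY))"
    unfolding dual3_chi8_theta by simp
  have eq: "4 * (dual3_chi8 - fps_const (3 / 2))\<^sup>2 =
      dil (9 * u ^ 3 - 14 * u\<^sup>2 * v + 5 * u * v\<^sup>2) + tY * (tX * (2 * tX\<^sup>2 * tY\<^sup>2 + tY ^ 4 - 3 * tX ^ 4))"
    unfolding dil_hom du dv using B A by Groebner_Basis.algebra
  have 1: "(4 * (dual3_chi8 - fps_const (3 / 2))\<^sup>2) $ (2 * (2 * n)) = (9 * u ^ 3 - 14 * u\<^sup>2 * v + 5 * u * v\<^sup>2) $ (2 * n)"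
    by (rule dil_plus_tY_nth[OF eq]) (intro even_series_intros)
  have eq: "9 * u ^ 3 - 14 * u\<^sup>2 * v + 5 * u * v\<^sup>2 =
      dil (9 * dual6) + tY * (tX * (4 * tX\<^sup>2 * tY\<^sup>2 - 2 * tX ^ 4 - 2 * tY ^ 4))"
    unfolding dil_mult[of 9] dil_numeral using dil_dual6 u_def v_def by Groebner_Basis.algebra
  have 2: "(9 * u ^ 3 - 14 * u\<^sup>2 * v + 5 * u * v\<^sup>2) $ (2 * n) = (9 * dual6) $ n"
    by (rule dil_plus_tY_nth[OF eq]) (intro even_series_intros)
  show ?thesis using 1 unfolding 2 by simp
qed

section \<open>The Hecke relation and Selberg's convolution\<close>

text \<open>The Hecke relation comes from the bijection \<open>(d, e) \<mapsto> (t, d e / t)\<close> with \<open>t = gcd (m / d, e)\<close>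
  between pairs of divisors of \<open>m\<close> and \<open>n\<close> and pairs consisting of a common divisor \<open>t\<close> of \<open>m\<close> and \<open>n\<close>
  and a divisor of \<open>m n / t\<^sup>2\<close>.\<close>

lemma sum_divisor_pairs:
  fixes h :: "nat \<Rightarrow> real"
  assumes m: "m > 0" and n: "n > 0"
  shows "(\<Sum>d\<in>{d. d dvd m}. \<Sum>e\<in>{e. e dvd n}. h (d * e)) =
    (\<Sum>t\<in>{t. t dvd m \<and> t dvd n}. \<Sum>D\<in>{D. D dvd m * n div t\<^sup>2}. h (t * D))"
proof -
  have fin: "finite {d. d dvd m}" "finite {e. e dvd n}" "finite {t. t dvd m \<and> t dvd n}"
    using m n by (auto intro: finite_subset[OF _ finite_divisors_nat[OF m]])
  have pos: "m * n div t\<^sup>2 > 0" if "t dvd m" "t dvd n" for t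
  proof -
    have "t * t dvd m * n" using that by (rule mult_dvd_mono)
    then show ?thesis using m n that by (auto simp: power2_eq_square div_greater_zero_iff intro: dvd_imp_le)
  qed
  have "(\<Sum>d\<in>{d. d dvd m}. \<Sum>e\<in>{e. e dvd n}. h (d * e)) = (\<Sum>(d, e)\<in>{d. d dvd m} \<times> {e. e dvd n}. h (d * e))"
    by (rule sum.cartesian_product)
  also have "\<dots> = (\<Sum>(t, D)\<in>(SIGMA t:{t. t dvd m \<and> t dvd n}. {D. D dvd m * n div t\<^sup>2}). h (t * D))"
  proof (rule sum.reindex_bij_witness[where
        j = "\<lambda>(d, e). (gcd (m div d) e, d * (e div gcd (m div d) e))" and
        i = "\<lambda>(t, D). (gcd D (m div t), t * (D div gcd D (m div t)))"], goal_cases)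
    case (1 p)
    then obtain d e where p: "p = (d, e)" and d: "d dvd m" and e: "e dvd n" by auto
    define t where "t = gcd (m div d) e"
    have t: "t dvd m div d" "t dvd e" by (simp_all add: t_def)
    have "d > 0" "e > 0" using d e m n by (auto intro: Nat.gr0I)
    then have t0: "t > 0" by (simp add: t_def)
    obtain m' where m': "m div d = t * m'" using t(1) by (elim dvdE)
    obtain e' where e': "e = t * e'" using t(2) by (elim dvdE)
    have md: "m = d * (t * m')" using d m' by (metis dvd_mult_div_cancel)
    have "t = gcd (t * m') (t * e')" unfolding t_def[symmetric] m'[symmetric] e'[symmetric] by (simp add: t_def)
    then have cop: "gcd m' e' = 1" using t0 by (simp add: gcd_mult_distrib_nat[symmetric])
    have "gcd (d * e') (m div t) = d"
    proof -
      have "m div t = d * m'" using t0 md by simp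
      then show ?thesis using cop by (simp add: gcd_mult_distrib_nat[symmetric] gcd.commute)
    qed
    moreover have "e div t = e'" using e' t0 by simp
    ultimately show ?case
      using t0 \<open>d > 0\<close> unfolding p by (simp add: t_def[symmetric] e'[symmetric])
  next
    case (2 p)
    then obtain d e where p: "p = (d, e)" and d: "d dvd m" and e: "e dvd n" by auto
    define t where "t = gcd (m div d) e"
    have t: "t dvd m div d" "t dvd e" by (simp_all add: t_def)
    have "e > 0" using e n by (auto intro: Nat.gr0I)
    then have t0: "t > 0" by (simp add: t_def)
    obtain m' where m': "m div d = t * m'" using t(1) by (elim dvdE)
    obtain e' where e': "e = t * e'" using t(2) by (elim dvdE)
    obtain n' where n': "n = e * n'" using e by (elim dvdE)
    have md: "m = d * (t * m')" using d m' by (metis dvd_mult_div_cancel)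
    have "m * n = t\<^sup>2 * (d * e' * (m' * n'))" unfolding md n' e' by (simp add: power2_eq_square)
    then have "m * n div t\<^sup>2 = d * e' * (m' * n')" using t0 by simp
    then have "d * e' dvd m * n div t\<^sup>2" by simp
    moreover have "t dvd m" "t dvd n" unfolding md n' e' by simp_all
    moreover have "e div t = e'" using e' t0 by simp
    ultimately show ?case
      unfolding p by (simp add: t_def[symmetric])
  next
    case (3 p)
    then obtain t D where p: "p = (t, D)" and t: "t dvd m" "t dvd n" and D: "D dvd m * n div t\<^sup>2" by auto
    have t0: "t > 0" using t m by (auto intro: Nat.gr0I)
    obtain m' where m': "m = t * m'" using t(1) by (elim dvdE)
    obtain n' where n': "n = t * n'" using t(2) by (elim dvdE)
    define d where "d = gcd D m'"
    have d0: "d > 0" using m m' by (auto simp: d_def intro: Nat.gr0I)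
    obtain D' where D': "D = d * D'" unfolding d_def by (metis gcd_dvd1 dvdE)
    obtain m'' where m'': "m' = d * m''" unfolding d_def by (metis gcd_dvd2 dvdE)
    have "d = gcd (d * D') (d * m'')" unfolding D'[symmetric] m''[symmetric] by (rule d_def)
    then have cop: "gcd D' m'' = 1" using d0 by (simp add: gcd_mult_distrib_nat[symmetric])
    have "gcd (m div d) (t * D') = t"
    proof -
      have "m div d = t * m''" using d0 m' m'' by simp
      then show ?thesis using cop by (simp add: gcd_mult_distrib_nat[symmetric] gcd.commute)
    qed
    moreover have "m div t = m'" using t0 m' by simp
    moreover have "D div d = D'" using D' d0 by simp
    ultimately show ?case
      using t0 d0 unfolding p by (simp add: d_def[symmetric] D'[symmetric])
  next
    case (4 p)
    then obtain t D where p: "p = (t, D)" and t: "t dvd m" "t dvd n" and D: "D dvd m * n div t\<^sup>2" by auto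
    have t0: "t > 0" using t m by (auto intro: Nat.gr0I)
    obtain m' where m': "m = t * m'" using t(1) by (elim dvdE)
    obtain n' where n': "n = t * n'" using t(2) by (elim dvdE)
    define d where "d = gcd D m'"
    have d0: "d > 0" using m m' by (auto simp: d_def intro: Nat.gr0I)
    obtain D' where D': "D = d * D'" unfolding d_def by (metis gcd_dvd1 dvdE)
    obtain m'' where m'': "m' = d * m''" unfolding d_def by (metis gcd_dvd2 dvdE)
    have "d = gcd (d * D') (d * m'')" unfolding D'[symmetric] m''[symmetric] by (rule d_def)
    then have cop: "gcd D' m'' = 1" using d0 by (simp add: gcd_mult_distrib_nat[symmetric])
    have "m * n = t\<^sup>2 * (m' * n')" unfolding m' n' by (simp add: power2_eq_square)
    then have "m * n div t\<^sup>2 = m' * n'" using t0 by simp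
    then have "d * D' dvd d * (m'' * n')" using D D' m'' by simp
    then have "D' dvd m'' * n'" using d0 by simp
    then have "D' dvd n'" using cop by (metis coprime_dvd_mult_right_iff coprime_iff_gcd_eq_1)
    then have "t * D' dvd n" using n' by simp
    moreover have "d dvd m" using m' m'' by simp
    moreover have "m div t = m'" using t0 m' by simp
    moreover have "D div d = D'" using D' d0 by simp
    ultimately show ?case
      unfolding p by (simp add: d_def[symmetric])
  next
    case (5 p)
    then obtain d e where p: "p = (d, e)" by (cases p)
    have *: "gcd (m div d) e * (d * (e div gcd (m div d) e)) = d * e"
      by (simp add: mult.left_commute)
    show ?case unfolding p prod.case * ..
  qed
  also have "\<dots> = (\<Sum>t\<in>{t. t dvd m \<and> t dvd n}. \<Sum>D\<in>{D. D dvd m * n div t\<^sup>2}. h (t * D))"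
    using fin pos by (subst sum.Sigma) (auto intro!: finite_divisors_nat)
  finally show ?thesis .
qed

lemma sum_pairs_divisors:
  assumes "n > 0"
  shows "(\<Sum>(d, e)\<in>pairs n. w d e) = (\<Sum>d\<in>{d. d dvd n}. w d (n div d))"
  by (rule sum.reindex_bij_witness[where i = "\<lambda>d. (d, n div d)" and j = fst])
    (use assms in \<open>auto simp: pairs_def elim!: dvdE\<close>)

text \<open>For completely multiplicative f and g the product of the summands at d and e is f (d e)
  g (m n / (d e)), a function of d e alone, so \<open>sum_divisor_pairs\<close> applies.\<close>

theorem hecke_relation:
  fixes f g :: "nat \<Rightarrow> real"
  assumes f: "\<And>m n. f (m * n) = f m * f n" and g: "\<And>m n. g (m * n) = g m * g n"
    and m: "m > 0" and n: "n > 0"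
  shows "ser (\<lambda>d e. f d * g e) $ m * ser (\<lambda>d e. f d * g e) $ n =
    (\<Sum>t\<in>{t. t dvd m \<and> t dvd n}. f t * g t * ser (\<lambda>d e. f d * g e) $ (m * n div t\<^sup>2))"
proof -
  let ?h = "\<lambda>P. f P * g (m * n div P)"
  have nth: "ser (\<lambda>d e. f d * g e) $ k = (\<Sum>d\<in>{d. d dvd k}. f d * g (k div d))" if "k > 0" for k
    unfolding ser_nth by (rule sum_pairs_divisors[OF that])
  have "ser (\<lambda>d e. f d * g e) $ m * ser (\<lambda>d e. f d * g e) $ n =
      (\<Sum>d\<in>{d. d dvd m}. \<Sum>e\<in>{e. e dvd n}. ?h (d * e))"
    unfolding nth[OF m] nth[OF n] sum_product
  proof (intro sum.cong refl)
    fix d e assume "d \<in> {d. d dvd m}" "e \<in> {e. e dvd n}"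
    then have "m * n div (d * e) = (m div d) * (n div e)" by (simp add: div_mult_div_if_dvd)
    then show "f d * g (m div d) * (f e * g (n div e)) = ?h (d * e)" by (simp add: f g)
  qed
  also have "\<dots> = (\<Sum>t\<in>{t. t dvd m \<and> t dvd n}. \<Sum>D\<in>{D. D dvd m * n div t\<^sup>2}. ?h (t * D))"
    by (rule sum_divisor_pairs[OF m n])
  also have "\<dots> = (\<Sum>t\<in>{t. t dvd m \<and> t dvd n}. f t * g t * ser (\<lambda>d e. f d * g e) $ (m * n div t\<^sup>2))"
  proof (rule sum.cong[OF refl])
    fix t assume t: "t \<in> {t. t dvd m \<and> t dvd n}"
    then have tt: "t\<^sup>2 dvd m * n" unfolding power2_eq_square by (auto intro: mult_dvd_mono)
    then obtain k where k: "m * n = t\<^sup>2 * k" by (elim dvdE)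
    have "t > 0" using t m by (auto intro: Nat.gr0I)
    then have k': "m * n div t\<^sup>2 = k" "k > 0" using k m n by (auto intro: Nat.gr0I)
    have "?h (t * D) = f t * g t * (f D * g (k div D))" if "D dvd k" for D
    proof -
      obtain l where l: "k = D * l" using \<open>D dvd k\<close> by (elim dvdE)
      then have "D > 0" using k' by (auto intro: Nat.gr0I)
      then have "m * n div (t * D) = t * l" "k div D = l"
        using \<open>t > 0\<close> k l by (simp_all add: power2_eq_square)
      then show ?thesis by (simp add: f g)
    qed
    then show "(\<Sum>D\<in>{D. D dvd m * n div t\<^sup>2}. ?h (t * D)) = f t * g t * ser (\<lambda>d e. f d * g e) $ (m * n div t\<^sup>2)"
      unfolding k'(1) nth[OF k'(2)] sum_distrib_left by (intro sum.cong) auto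
  qed
  finally show ?thesis .
qed

lemma theta_mult_nth_square: "(theta * B) $ (M\<^sup>2) = (\<Sum>i=0..2 * M. B $ (i * (2 * M - i)))"
  unfolding theta_mult_nth
proof (rule sum.reindex_bij_witness[where i = "\<lambda>i. int M - int i" and j = "\<lambda>j. nat (int M - j)"], goal_cases)
  case (1 j)
  then have "\<bar>j\<bar> \<le> int M" using abs_le_square_iff[of j "int M"] by simp
  then show ?case by simp
next
  case (2 j)
  then have "\<bar>j\<bar> \<le> int M" using abs_le_square_iff[of j "int M"] by simp
  then show ?case by auto
next
  case (4 i)
  then have "\<bar>int M - int i\<bar> \<le> int M" by auto
  then show ?case using abs_le_square_iff[of "int M - int i" "int M"] by simp
next
  case (5 j)
  then have j: "\<bar>j\<bar> \<le> int M" using abs_le_square_iff[of j "int M"] by simp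
  define i where "i = nat (int M - j)"
  have i: "int i = int M - j" "i \<le> 2 * M" using j by (auto simp: i_def)
  have le: "nat (j\<^sup>2) \<le> M\<^sup>2" using 5 by (simp add: nat_le_iff)
  have "int (i * (2 * M - i)) = int (M\<^sup>2 - nat (j\<^sup>2))"
    using i(2) le by (simp add: of_nat_diff i(1) power2_eq_square algebra_simps)
  then have "i * (2 * M - i) = M\<^sup>2 - nat (j\<^sup>2)" by (simp only: of_nat_eq_iff)
  then show ?case by (simp add: i_def)
qed auto

text \<open>With \<open>n\<^sub>1 = N - j\<close> and \<open>n\<^sub>2 = N + j\<close>, the coefficient of \<open>theta * B\<close> at \<open>N\<^sup>2\<close> is the sum of the
  coefficients of \<open>B\<close> at \<open>n\<^sub>1 n\<^sub>2\<close> over \<open>n\<^sub>1 + n\<^sub>2 = 2 N\<close>.\<close>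

theorem selberg_convolution:
  fixes f g :: "nat \<Rightarrow> real"
  assumes f: "\<And>m n. f (m * n) = f m * f n" and g: "\<And>m n. g (m * n) = g m * g n"
    and even: "\<And>t. even t \<Longrightarrow> f t * g t = 0"
    and \<beta>: "\<beta> \<noteq> 0 \<Longrightarrow> g = (\<lambda>n. 1)"
    and N: "N > 0"
  defines "B \<equiv> ser (\<lambda>d e. f d * g e) - fps_const \<beta>"
  shows "(B\<^sup>2) $ (2 * N) = (\<Sum>t\<in>{t. t dvd N}. f t * g t * (theta * B) $ ((N div t)\<^sup>2))"
proof -
  define T where "T = 2 * N"
  have T: "T > 0" using N by (simp add: T_def)
  have B_pos: "B $ n = ser (\<lambda>d e. f d * g e) $ n" if "n > 0" for n
    using that by (simp add: B_def)
  have B_0: "B $ 0 = - \<beta>" by (simp add: B_def)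
  \<comment> \<open>At the end points i = 0 and i = T one index is 0, where the Hecke relation says
    nothing. If the constant term is nonzero, then g = 1 and B_T is the sum of f t over t dividing
    T, which is just the shape required.\<close>
  have zero: "B $ 0 * B $ T = (\<Sum>t\<in>{t. t dvd T}. f t * g t * B $ 0)"
  proof (cases "\<beta> = 0")
    case False
    then have "g = (\<lambda>n. 1)" by (rule \<beta>)
    then have "B $ T = (\<Sum>t\<in>{t. t dvd T}. f t * g t)"
      unfolding B_pos[OF T] ser_nth sum_pairs_divisors[OF T] by simp
    then show ?thesis by (simp add: sum_distrib_left mult.commute)
  qed (simp add: B_0)
  have prod: "B $ i * B $ (T - i) =
      (\<Sum>t\<in>{t. t dvd T}. if t dvd i then f t * g t * B $ (i * (T - i) div t\<^sup>2) else 0)" if i: "i \<le> T" for i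
  proof -
    consider "i = 0" | "i = T" | "0 < i" "i < T" using i by linarith
    then show ?thesis
    proof cases
      case 1
      then show ?thesis using zero by simp
    next
      case 2
      have "B $ i * B $ (T - i) = (\<Sum>t\<in>{t. t dvd T}. f t * g t * B $ 0)"
        using zero 2 by (simp add: mult.commute)
      also have "\<dots> = (\<Sum>t\<in>{t. t dvd T}. if t dvd i then f t * g t * B $ (i * (T - i) div t\<^sup>2) else 0)"
        using 2 by (intro sum.cong) auto
      finally show ?thesis .
    next
      case 3
      then have pos: "T - i > 0" by simp
      have "B $ i * B $ (T - i) = (\<Sum>t\<in>{t. t dvd i \<and> t dvd T - i}. f t * g t * ser (\<lambda>d e. f d * g e) $ (i * (T - i) div t\<^sup>2))"
        unfolding B_pos[OF 3(1)] B_pos[OF pos] by (rule hecke_relation[OF f g 3(1) pos])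
      also have "\<dots> = (\<Sum>t\<in>{t. t dvd T}. if t dvd i then f t * g t * B $ (i * (T - i) div t\<^sup>2) else 0)"
      proof (rule sum.mono_neutral_cong_left)
        show "finite {t. t dvd T}" using T by (rule finite_divisors_nat)
        show "{t. t dvd i \<and> t dvd T - i} \<subseteq> {t. t dvd T}"
          using i by (auto dest: dvd_diffD)
        show "\<forall>t\<in>{t. t dvd T} - {t. t dvd i \<and> t dvd T - i}.
            (if t dvd i then f t * g t * B $ (i * (T - i) div t\<^sup>2) else 0) = 0"
          by auto
        fix t assume t: "t \<in> {t. t dvd i \<and> t dvd T - i}"
        then have "t * t dvd i * (T - i)" by (auto intro: mult_dvd_mono)
        then have "t\<^sup>2 \<le> i * (T - i)" using 3 pos by (auto simp: power2_eq_square intro!: dvd_imp_le)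
        moreover have "t > 0" using t 3 by (auto intro: Nat.gr0I)
        ultimately have "i * (T - i) div t\<^sup>2 > 0" by (simp add: div_greater_zero_iff)
        then show "f t * g t * ser (\<lambda>d e. f d * g e) $ (i * (T - i) div t\<^sup>2) =
            (if t dvd i then f t * g t * B $ (i * (T - i) div t\<^sup>2) else 0)"
          using t by (simp add: B_pos)
      qed
      finally show ?thesis .
    qed
  qed
  have "(B\<^sup>2) $ T = (\<Sum>i=0..T. \<Sum>t\<in>{t. t dvd T}. if t dvd i then f t * g t * B $ (i * (T - i) div t\<^sup>2) else 0)"
    unfolding power2_eq_square[of B] fps_mult_nth by (rule sum.cong) (use prod in auto)
  also have "\<dots> = (\<Sum>t\<in>{t. t dvd T}. \<Sum>i=0..T. if t dvd i then f t * g t * B $ (i * (T - i) div t\<^sup>2) else 0)"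
    by (rule sum.swap)
  also have "\<dots> = (\<Sum>t\<in>{t. t dvd N}. f t * g t * (theta * B) $ ((N div t)\<^sup>2))"
  proof (rule sum.mono_neutral_cong_right)
    show "finite {t. t dvd T}" using T by (rule finite_divisors_nat)
    show "{t. t dvd N} \<subseteq> {t. t dvd T}" by (auto simp: T_def)
    \<comment> \<open>A divisor of 2 N that does not divide N is even, and there f t g t =
      0.\<close>
    show "\<forall>t\<in>{t. t dvd T} - {t. t dvd N}. (\<Sum>i=0..T. if t dvd i then f t * g t * B $ (i * (T - i) div t\<^sup>2) else 0) = 0"
    proof
      fix t assume t: "t \<in> {t. t dvd T} - {t. t dvd N}"
      have "even t"
      proof (rule ccontr)
        assume "odd t"
        then have "coprime t 2" by simp
        then show False using t by (auto simp: T_def coprime_dvd_mult_right_iff)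
      qed
      then show "(\<Sum>i=0..T. if t dvd i then f t * g t * B $ (i * (T - i) div t\<^sup>2) else 0) = 0"
        by (intro sum.neutral) (simp add: even)
    qed
    fix t assume "t \<in> {t. t dvd N}"
    then obtain M where M: "N = t * M" by (auto elim: dvdE)
    then have t: "t > 0" using N by (auto intro: Nat.gr0I)
    have TM: "T = t * (2 * M)" by (simp add: T_def M)
    have "(\<Sum>i=0..T. if t dvd i then f t * g t * B $ (i * (T - i) div t\<^sup>2) else 0) =
        (\<Sum>i\<in>{i\<in>{0..T}. t dvd i}. f t * g t * B $ (i * (T - i) div t\<^sup>2))"
      by (rule sum.mono_neutral_cong_right) (auto split: if_splits)
    also have "\<dots> = (\<Sum>i=0..2 * M. f t * g t * B $ (i * (2 * M - i)))"
    proof (rule sum.reindex_bij_witness[where i = "\<lambda>i. t * i" and j = "\<lambda>i. i div t"], goal_cases)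
      case (2 i)
      then obtain k where "i = t * k" by (auto elim: dvdE)
      then show ?case using 2 t unfolding TM by simp
    next
      case (5 i)
      then obtain k where k: "i = t * k" by (auto elim: dvdE)
      have eq: "i * (T - i) = t\<^sup>2 * (k * (2 * M - k))"
        unfolding k TM by (simp add: power2_eq_square diff_mult_distrib2 algebra_simps)
      have "i * (T - i) div t\<^sup>2 = k * (2 * M - k)" "i div t = k"
        unfolding eq using t k by simp_all
      then show ?case by (simp only:)
    qed (use t in \<open>auto simp: TM\<close>)
    also have "\<dots> = f t * g t * (theta * B) $ (M\<^sup>2)"
      unfolding theta_mult_nth_square sum_distrib_left ..
    finally show "(\<Sum>i=0..T. if t dvd i then f t * g t * B $ (i * (T - i) div t\<^sup>2) else 0) =
        f t * g t * (theta * B) $ ((N div t)\<^sup>2)"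
      using t by (simp add: M)
  qed
  finally show ?thesis by (simp add: T_def)
qed

lemma prime_power_divisor_sum:
  fixes F :: "nat \<Rightarrow> real"
  assumes p: "prime p" and m: "\<not> p dvd m" "m > 0"
  shows "(\<Sum>t\<in>{t. t dvd p ^ l * m}. F t) = (\<Sum>i\<le>l. \<Sum>t\<in>{t. t dvd m}. F (p ^ i * t))"
proof -
  have p0: "p > 0" using p by (simp add: prime_gt_0_nat)
  have "(\<Sum>i\<le>l. \<Sum>t\<in>{t. t dvd m}. F (p ^ i * t)) = (\<Sum>(i, t)\<in>{..l} \<times> {t. t dvd m}. F (p ^ i * t))"
    by (rule sum.cartesian_product)
  also have "\<dots> = (\<Sum>t\<in>{t. t dvd p ^ l * m}. F t)"
  proof (rule sum.reindex_bij_witness[where j = "\<lambda>(i, t). p ^ i * t" and i = "\<lambda>t. (multiplicity p t, t div p ^ multiplicity p t)"], goal_cases)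
    case (1 q)
    then obtain i t where q: "q = (i, t)" "t dvd m" by auto
    have "\<not> p dvd t" using q m(1) dvd_trans by blast
    then have "multiplicity p (p ^ i * t) = i"
      using p by (intro multiplicity_eqI) (auto simp: mult.commute)
    then show ?case using p0 q by simp
  next
    case (2 q)
    then show ?case by (auto intro: mult_dvd_mono le_imp_power_dvd)
  next
    case (3 t)
    then show ?case by (simp add: multiplicity_dvd)
  next
    case (4 t)
    then have t: "t dvd p ^ l * m" by simp
    then have t0: "t \<noteq> 0" using m p0 by (intro notI) simp
    obtain t' where t': "t = p ^ multiplicity p t * t'" using multiplicity_dvd[of p t] by (elim dvdE)
    have np: "\<not> p dvd t'"
    proof
      assume "p dvd t'"
      then have "p ^ Suc (multiplicity p t) dvd t"
        by (subst t') (simp add: mult.commute mult_dvd_mono)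
      then show False using t0 p multiplicity_lessI[of t p "Suc (multiplicity p t)"]
        by (metis Suc_n_not_le_n not_prime_unit power_dvd_iff_le_multiplicity)
    qed
    have "multiplicity p t \<le> l"
    proof -
      have "p ^ multiplicity p t dvd p ^ l * m" using t by (rule dvd_trans[OF multiplicity_dvd])
      moreover have "coprime (p ^ multiplicity p t) m"
        using prime_imp_coprime[OF p m(1)] by simp
      ultimately have "p ^ multiplicity p t dvd p ^ l" by (simp add: coprime_dvd_mult_left_iff)
      then show ?thesis using p by (metis power_dvd_imp_le prime_gt_1_nat)
    qed
    moreover have "t' dvd m"
    proof -
      have "t' dvd p ^ l * m" using t t' by (metis dvd_mult_right)
      moreover have "coprime t' (p ^ l)" using prime_imp_coprime[OF p np] by (simp add: coprime_commute)
      ultimately show ?thesis by (simp add: coprime_dvd_mult_right_iff)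
    qed
    moreover have "t div p ^ multiplicity p t = t'" using t' p0 by (metis nonzero_mult_div_cancel_left power_not_zero neq0_conv)
    ultimately show ?case by simp
  qed auto
  finally show ?thesis by simp
qed

section \<open>Inversion of the convolution\<close>

lemma s_prod_1 [simp]: "s_prod d 1 = 1" "s_prod d (Suc 0) = 1"
  by (simp_all add: s_prod_def)

definition s_local :: "int \<Rightarrow> nat \<Rightarrow> nat \<Rightarrow> real" where
  "s_local d p l = (real p ^ (5 * l + 5) - 1) / (real p ^ 5 - 1)
       - real p ^ 2 * of_int (Legendre d (int p)) * ((real p ^ (5 * l) - 1) / (real p ^ 5 - 1))"

lemma s_prod_prime_power_mult:
  assumes p: "prime p" and m: "\<not> p dvd m" "m > 0"
  shows "s_prod d (p ^ l * m) = s_local d p l * s_prod d m"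
proof (cases "l = 0")
  case True
  have "real p > 1" using prime_gt_1_nat[OF p] by simp
  then have "real p ^ 5 > 1" by (rule one_less_power) simp
  then show ?thesis using True by (simp add: s_local_def)
next
  case False
  have pf: "prime_factors (p ^ l * m) = insert p (prime_factors m)"
    using p m False prime_gt_0_nat[OF p] by (simp add: prime_factors_product prime_factors_power prime_prime_factors)
  have notin: "p \<notin> prime_factors m" using m by auto
  have mp: "multiplicity p (p ^ l * m) = l"
    using p m by (intro multiplicity_eqI) (auto simp: mult.commute)
  have mq: "multiplicity q (p ^ l * m) = multiplicity q m" if "q \<in> prime_factors m" for q
  proof -
    have q: "prime q" "q \<noteq> p" using that notin by auto
    then have "multiplicity q (p ^ l) = 0"
      using p by (simp add: multiplicity_distinct_prime_power)
    then show ?thesis using q p m by (simp add: prime_elem_multiplicity_mult_distrib)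
  qed
  show ?thesis
    unfolding s_prod_def pf using notin mp mq by (simp add: s_local_def)
qed

text \<open>The local factor is G l - h G (l - 1), the subtracted term being 0 at l = 0. Its
  generating function is that of G times 1 - h x, and convolving with the powers of h divides by 1 -
  h x.\<close>

lemma s_local_convolution:
  assumes p: "prime p"
  shows "(\<Sum>i\<le>l. (real p ^ 2 * of_int (Legendre d (int p))) ^ i * s_local d p (l - i)) =
    (\<Sum>i\<le>l. real (p ^ i) ^ 5)"
proof -
  have "real p > 1" using prime_gt_1_nat[OF p] by simp
  then have "real p ^ 5 > 1" by (rule one_less_power) simp
  then have p5: "real p ^ 5 \<noteq> 1" by (rule less_imp_neq[THEN not_sym])
  define h where "h = real p ^ 2 * of_int (Legendre d (int p))"
  define G where "G = (\<lambda>l. \<Sum>i\<le>l. real (p ^ i) ^ 5)"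
  have geo: "G l = (real p ^ (5 * l + 5) - 1) / (real p ^ 5 - 1)" for l
  proof -
    have "G l = (\<Sum>i\<le>l. (real p ^ 5) ^ i)"
      unfolding G_def by (rule sum.cong) (simp_all flip: power_mult add: mult.commute)
    also have "\<dots> = ((real p ^ 5) ^ Suc l - 1) / (real p ^ 5 - 1)"
      unfolding lessThan_Suc_atMost[symmetric] by (rule geometric_sum[OF p5])
    also have "(real p ^ 5) ^ Suc l = real p ^ (5 * l + 5)"
      by (simp add: power_mult power_add)
    finally show ?thesis .
  qed
  have s0: "s_local d p 0 = 1" using p5 by (simp add: s_local_def)
  have sS: "s_local d p (Suc l) = G (Suc l) - h * G l" for l
    unfolding s_local_def geo h_def by (simp add: algebra_simps)
  have "(\<Sum>i\<le>l. h ^ i * s_local d p (l - i)) = G l"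
  proof (induction l)
    case (Suc l)
    have "(\<Sum>i\<le>Suc l. h ^ i * s_local d p (Suc l - i)) = s_local d p (Suc l) + h * (\<Sum>i\<le>l. h ^ i * s_local d p (l - i))"
      unfolding sum.atMost_Suc_shift by (simp add: sum_distrib_left mult.assoc)
    then show ?case unfolding Suc sS by simp
  qed (simp add: s0 G_def)
  then show ?thesis by (simp add: h_def G_def)
qed

lemma s_prod_convolution:
  fixes h :: "nat \<Rightarrow> real"
  assumes h: "\<And>m n. h (m * n) = h m * h n" "h 1 = 1"
    and hp: "\<And>p. prime p \<Longrightarrow> odd p \<Longrightarrow> h p = real p ^ 2 * of_int (Legendre d (int p))"
    and m: "odd m"
  shows "(\<Sum>t\<in>{t. t dvd m}. h t * s_prod d (m div t)) = (\<Sum>t\<in>{t. t dvd m}. real t ^ 5)"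
  using m
proof (induction m rule: less_induct)
  case (less m)
  show ?case
  proof (cases "m = 1")
    case True
    then show ?thesis using h by simp
  next
    case False
    then obtain p where p: "prime p" "p dvd m" using prime_factor_nat by blast
    have m0: "m > 0" using less.prems by (auto intro: Nat.gr0I)
    have p0: "p > 0" using p by (simp add: prime_gt_0_nat)
    obtain n where n: "m = p ^ multiplicity p m * n" "\<not> p dvd n"
      using multiplicity_decompose'[of m p] m0 p not_prime_unit by (metis less_numeral_extra(3))
    define l where "l = multiplicity p m"
    have mn: "m = p ^ l * n" using n by (simp add: l_def)
    have "l > 0" using p m0 by (simp add: l_def prime_multiplicity_gt_zero_iff)
    then have odd: "odd p" "odd n" using less.prems mn by auto
    have n0: "n > 0" using mn m0 by (auto intro: Nat.gr0I)
    have "1 < p ^ l" using prime_gt_1_nat[OF p(1)] \<open>l > 0\<close> by (rule one_less_power)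
    then have "n < m" using n0 mn by simp
    have hpow: "h (p ^ i) = (real p ^ 2 * of_int (Legendre d (int p))) ^ i" for i
      by (induction i) (simp_all add: h h(2)[unfolded One_nat_def] hp[OF p(1) odd(1)])
    have "(\<Sum>t\<in>{t. t dvd m}. h t * s_prod d (m div t)) =
        (\<Sum>i\<le>l. \<Sum>t\<in>{t. t dvd n}. h (p ^ i * t) * s_prod d (p ^ l * n div (p ^ i * t)))"
      unfolding mn by (rule prime_power_divisor_sum[OF p(1) n(2) n0])
    also have "\<dots> = (\<Sum>i\<le>l. \<Sum>t\<in>{t. t dvd n}. (h (p ^ i) * s_local d p (l - i)) * (h t * s_prod d (n div t)))"
    proof (intro sum.cong refl)
      fix i t assume i: "i \<in> {..l}" and t: "t \<in> {t. t dvd n}"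
      then have pl: "p ^ l = p ^ i * p ^ (l - i)" by (simp flip: power_add)
      obtain r where r: "n = t * r" using t by (auto elim: dvdE)
      have "t > 0" using r n0 by (auto intro: Nat.gr0I)
      then have nz: "p ^ i * t \<noteq> 0" using p0 by simp
      have "p ^ l * n = (p ^ i * t) * (p ^ (l - i) * r)" unfolding pl r by (simp add: ac_simps)
      then have "p ^ l * n div (p ^ i * t) = p ^ (l - i) * r" using nz by (metis nonzero_mult_div_cancel_left)
      then have "p ^ l * n div (p ^ i * t) = p ^ (l - i) * (n div t)"
        using r \<open>t > 0\<close> by simp
      moreover have "\<not> p dvd n div t" "n div t > 0"
        using t n(2) n0 by (auto elim!: dvdE intro: Nat.gr0I)
      ultimately show "h (p ^ i * t) * s_prod d (p ^ l * n div (p ^ i * t)) =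
          (h (p ^ i) * s_local d p (l - i)) * (h t * s_prod d (n div t))"
        using s_prod_prime_power_mult[OF p(1), of "n div t" d "l - i"] by (simp add: h)
    qed
    also have "\<dots> = (\<Sum>i\<le>l. h (p ^ i) * s_local d p (l - i)) * (\<Sum>t\<in>{t. t dvd n}. h t * s_prod d (n div t))"
      by (rule sum_product[symmetric])
    also have "\<dots> = (\<Sum>i\<le>l. real (p ^ i) ^ 5) * (\<Sum>t\<in>{t. t dvd n}. real t ^ 5)"
      unfolding hpow s_local_convolution[OF p(1)] less.IH[OF \<open>n < m\<close> odd(2)] ..
    also have "\<dots> = (\<Sum>i\<le>l. \<Sum>t\<in>{t. t dvd n}. real (p ^ i * t) ^ 5)"
      unfolding sum_product by (simp add: power_mult_distrib)
    also have "\<dots> = (\<Sum>t\<in>{t. t dvd m}. real t ^ 5)"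
      unfolding mn by (rule prime_power_divisor_sum[OF p(1) n(2) n0, symmetric])
    finally show ?thesis .
  qed
qed

text \<open>A and K times \<open>s_prod d\<close> have the same convolution with h. By induction
  their difference vanishes at proper divisors of m, so only t = 1 is left, with coefficient h 1 =
  1.\<close>

theorem s_prod_inversion:
  fixes h A :: "nat \<Rightarrow> real"
  assumes h: "\<And>m n. h (m * n) = h m * h n" "h 1 = 1"
    and hp: "\<And>p. prime p \<Longrightarrow> odd p \<Longrightarrow> h p = real p ^ 2 * of_int (Legendre d (int p))"
    and A: "\<And>m. odd m \<Longrightarrow> (\<Sum>t\<in>{t. t dvd m}. h t * A (m div t)) = K * (\<Sum>t\<in>{t. t dvd m}. real t ^ 5)"
    and m: "odd m"
  shows "A m = K * s_prod d m"
  using m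
proof (induction m rule: less_induct)
  case (less m)
  have m0: "m > 0" using less.prems by (auto intro: Nat.gr0I)
  have fin: "finite {t. t dvd m}" using m0 by (rule finite_divisors_nat)
  have "(\<Sum>t\<in>{t. t dvd m}. h t * A (m div t)) = K * (\<Sum>t\<in>{t. t dvd m}. h t * s_prod d (m div t))"
  proof -
    have "(\<Sum>t\<in>{t. t dvd m}. h t * s_prod d (m div t)) = (\<Sum>t\<in>{t. t dvd m}. real t ^ 5)"
      by (rule s_prod_convolution) (fact h hp less.prems)+
    then show ?thesis using A[OF less.prems] by simp
  qed
  then have "(\<Sum>t\<in>{t. t dvd m}. h t * (A (m div t) - K * s_prod d (m div t))) = 0"
    by (simp add: right_diff_distrib sum_subtractf sum_distrib_left mult.left_commute)
  also have "(\<Sum>t\<in>{t. t dvd m}. h t * (A (m div t) - K * s_prod d (m div t))) = h 1 * (A (m div 1) - K * s_prod d (m div 1)) +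
      (\<Sum>t\<in>{t. t dvd m} - {1}. h t * (A (m div t) - K * s_prod d (m div t)))"
    using fin by (rule sum.remove) simp
  also have "(\<Sum>t\<in>{t. t dvd m} - {1}. h t * (A (m div t) - K * s_prod d (m div t))) = 0"
  proof (rule sum.neutral, rule ballI)
    fix t assume "t \<in> {t. t dvd m} - {1}"
    then have t: "t dvd m" "t \<noteq> 1" by auto
    then obtain n where n: "m = t * n" by (elim dvdE)
    then have "n > 0" "t > 0" using m0 by (auto intro: Nat.gr0I)
    then have "n < m" "odd n" using n t less.prems by auto
    then have "A n = K * s_prod d n" by (rule less.IH)
    then show "h t * (A (m div t) - K * s_prod d (m div t)) = 0" using n \<open>t > 0\<close> by simp
  qed
  finally show ?case using h by simp
qed

section \<open>Legendre symbols of -4 and -2 as characters modulo 4 and 8\<close>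

lemma Legendre_eqI:
  assumes p: "prime p" "odd p" and c: "[Legendre a (int p) = c] (mod int p)" "\<bar>c\<bar> \<le> 1"
  shows "Legendre a (int p) = c"
proof -
  have "p > 2" using p prime_ge_2_nat[of p] by (cases "p = 2") auto
  have "\<bar>Legendre a (int p)\<bar> \<le> 1" by (simp add: Legendre_def)
  then have "\<bar>Legendre a (int p) - c\<bar> < int p" using c(2) \<open>p > 2\<close> by linarith
  moreover have "int p dvd Legendre a (int p) - c" using c(1) by (simp add: cong_iff_dvd_diff)
  ultimately have "Legendre a (int p) - c = 0"
    using dvd_imp_le_int[of "Legendre a (int p) - c" "int p"] by linarith
  then show ?thesis by simp
qed

text \<open>Euler's criterion: with p = 2 k + 1, (-4)^k is (-1)^k 2^(p-1), and the last power is 1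
  modulo p by Fermat.\<close>

lemma Legendre_minus_4:
  assumes p: "prime p" "odd p"
  shows "of_int (Legendre (- 4) (int p)) = chi4 p"
proof -
  define k where "k = (p - 1) div 2"
  have pk: "p = 2 * k + 1" using p by (auto simp: k_def elim: oddE)
  have p2: "p > 2" using p prime_ge_2_nat[of p] by (cases "p = 2") auto
  have "[Legendre (- 4) (int p) = (- 4) ^ k] (mod int p)"
    unfolding k_def using p p2 by (intro euler_criterion) auto
  also have "(- 4 :: int) ^ k = (- 1) ^ k * int (2 ^ (p - 1))"
    by (simp add: pk power_mult flip: power_mult_distrib)
  also have "[(- 1) ^ k * int (2 ^ (p - 1)) = (- 1) ^ k * int 1] (mod int p)"
  proof (intro cong_mult cong_refl)
    have "\<not> p dvd 2" using p2 by (auto dest: dvd_imp_le)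
    then have "[2 ^ (p - 1) = 1] (mod p)" by (rule fermat_theorem[OF p(1)])
    then show "[int (2 ^ (p - 1)) = int 1] (mod int p)" by (simp only: cong_int_iff)
  qed
  finally have "Legendre (- 4) (int p) = (- 1) ^ k"
    by (intro Legendre_eqI p) (simp_all add: power_abs)
  moreover have "chi4 p = (- 1) ^ k"
  proof (cases "even k")
    case True
    then have "p mod 4 = 1" unfolding pk by presburger
    then show ?thesis using True by (simp add: chi4_def)
  next
    case False
    then have "p mod 4 = 3" unfolding pk by presburger
    then show ?thesis using False by (simp add: chi4_def)
  qed
  ultimately show ?thesis by simp
qed

lemma Legendre_minus_2:
  assumes p: "prime p" "odd p"
  shows "of_int (Legendre (- 2) (int p)) = chi8 p"
proof -
  define k where "k = (p - 1) div 2"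
  have pk: "p = 2 * k + 1" using p by (auto simp: k_def elim: oddE)
  have p2: "p > 2" using p prime_ge_2_nat[of p] by (cases "p = 2") auto
  interpret GAUSS p 2
  proof
    show "[2 \<noteq> 0] (mod int p)" using p2 by (auto simp: cong_def)
  qed (use p p2 in auto)
  have half: "(int p - 1) div 2 = int k" by (simp add: pk)
  \<comment> \<open>In Gauss's lemma for 2 the doubles 2 x with x <= k stay below p = 2 k + 1, so
    nothing is reduced and \<open>E\<close> consists of those with 2 x > k.\<close>
  have "C = (\<lambda>x. 2 * x) ` {0<..int k}"
    unfolding C_def B_def A_def half image_image by (rule image_cong) (auto simp: pk)
  then have "E = (\<lambda>x. 2 * x) ` {int k div 2<..int k}"
    unfolding E_def half by auto
  then have "card E = nat (int k - int k div 2)"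
    by (simp add: card_image inj_on_def)
  then have cardE: "card E = k - k div 2" by (simp add: nat_diff_distrib zdiv_int[symmetric] nat_div_distrib)
  have "[Legendre (- 2) (int p) = (- 2) ^ k] (mod int p)"
    unfolding k_def using p p2 by (intro euler_criterion) auto
  also have "(- 2 :: int) ^ k = (- 1) ^ k * 2 ^ k"
    by (simp flip: power_mult_distrib)
  also have "[(- 1) ^ k * 2 ^ k = (- 1) ^ k * Legendre 2 (int p)] (mod int p)"
  proof (intro cong_mult cong_refl)
    have "[Legendre 2 (int p) = 2 ^ k] (mod int p)"
      unfolding k_def using p p2 by (intro euler_criterion) auto
    then show "[2 ^ k = Legendre 2 (int p)] (mod int p)" by (rule cong_sym)
  qed
  finally have "[Legendre (- 2) (int p) = (- 1) ^ (k + (k - k div 2))] (mod int p)"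
    unfolding gauss_lemma cardE power_add .
  then have "Legendre (- 2) (int p) = (- 1) ^ (k + (k - k div 2))"
    by (intro Legendre_eqI p) (simp_all add: power_abs)
  moreover have "(- 1 :: int) ^ (k + (k - k div 2)) = (- 1) ^ (k div 2)"
  proof -
    have "even (k + (k - k div 2)) \<longleftrightarrow> even (k div 2)" by presburger
    then show ?thesis by (simp add: minus_one_power_iff)
  qed
  moreover have "chi8 p = (- 1) ^ (k div 2)"
  proof -
    consider "k mod 4 = 0" | "k mod 4 = 1" | "k mod 4 = 2" | "k mod 4 = 3" by linarith
    then show ?thesis
    proof cases
      case 1
      then have "p mod 8 = 1" "even (k div 2)" unfolding pk by presburger+
      then show ?thesis by (simp add: chi8_def)
    next
      case 2
      then have "p mod 8 = 3" "even (k div 2)" unfolding pk by presburger+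
      then show ?thesis by (simp add: chi8_def)
    next
      case 3
      then have "p mod 8 = 5" "odd (k div 2)" unfolding pk by presburger+
      then show ?thesis by (simp add: chi8_def)
    next
      case 4
      then have "p mod 8 = 7" "odd (k div 2)" unfolding pk by presburger+
      then show ?thesis by (simp add: chi8_def)
    qed
  qed
  ultimately show ?thesis by simp
qed

lemma restrict_to_odd_divisors:
  fixes h :: "nat \<Rightarrow> real"
  assumes h: "\<And>t. even t \<Longrightarrow> h t = 0" and m: "odd m"
  shows "(\<Sum>t\<in>{t. t dvd 2 ^ j * m}. h t * F ((2 ^ j * m) div t)) = (\<Sum>t\<in>{t. t dvd m}. h t * F (2 ^ j * (m div t)))"
proof (rule sum.mono_neutral_cong_right)
  have "m > 0" using m by (auto intro: Nat.gr0I)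
  then show "finite {t. t dvd 2 ^ j * m}" by (intro finite_divisors_nat) simp
  show "\<forall>t\<in>{t. t dvd 2 ^ j * m} - {t. t dvd m}. h t * F ((2 ^ j * m) div t) = 0"
  proof
    fix t assume t: "t \<in> {t. t dvd 2 ^ j * m} - {t. t dvd m}"
    have "even t"
    proof (rule ccontr)
      assume "odd t"
      then have "coprime t (2 ^ j)" by simp
      then show False using t by (simp add: coprime_dvd_mult_right_iff)
    qed
    then show "h t * F ((2 ^ j * m) div t) = 0" by (simp add: h)
  qed
  show "{t. t dvd m} \<subseteq> {t. t dvd 2 ^ j * m}" by auto
  show "h t * F ((2 ^ j * m) div t) = h t * F (2 ^ j * (m div t))" if "t \<in> {t. t dvd m}" for t
    using that by (simp add: div_mult_swap)
qed

text \<open>The power 2^j stays fixed while the odd part varies: f t g t vanishes at even t, so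
  Selberg's formula runs over divisors of m only, and the inversion applies for each j
  separately.\<close>

theorem theta_mult_eisenstein_nth_square:
  fixes f g :: "nat \<Rightarrow> real"
  assumes f: "\<And>m n. f (m * n) = f m * f n" and g: "\<And>m n. g (m * n) = g m * g n"
    and fg1: "f 1 * g 1 = 1"
    and even: "\<And>t. even t \<Longrightarrow> f t * g t = 0"
    and \<beta>: "\<beta> \<noteq> 0 \<Longrightarrow> g = (\<lambda>n. 1)"
    and p: "\<And>p. prime p \<Longrightarrow> odd p \<Longrightarrow> f p * g p = real p ^ 2 * of_int (Legendre d (int p))"
    and B: "B = ser (\<lambda>d e. f d * g e) - fps_const \<beta>"
    and K: "\<And>m. odd m \<Longrightarrow> (B\<^sup>2) $ (2 * (2 ^ j * m)) = K * ser_oo (\<lambda>d e. real d ^ 5) $ m"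
    and m: "odd m"
  shows "(theta * B) $ ((2 ^ j * m)\<^sup>2) = K * s_prod d m"
proof (rule s_prod_inversion[where h = "\<lambda>t. f t * g t" and A = "\<lambda>m. (theta * B) $ ((2 ^ j * m)\<^sup>2)", OF _ fg1 p _ m])
  show "f (m * n) * g (m * n) = f m * g m * (f n * g n)" for m n by (simp add: f g)
  fix m :: nat assume m: "odd m"
  then have m0: "m > 0" by (auto intro: Nat.gr0I)
  then have N: "2 ^ j * m > 0" by simp
  have "(B\<^sup>2) $ (2 * (2 ^ j * m)) =
      (\<Sum>t\<in>{t. t dvd 2 ^ j * m}. f t * g t * (theta * B) $ (((2 ^ j * m) div t)\<^sup>2))"
    unfolding B by (rule selberg_convolution) (fact f g even \<beta> N)+
  also have "\<dots> = (\<Sum>t\<in>{t. t dvd m}. f t * g t * (theta * B) $ ((2 ^ j * (m div t))\<^sup>2))"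
    by (rule restrict_to_odd_divisors[where F = "\<lambda>n. (theta * B) $ (n\<^sup>2)", OF even m])
  finally have "(\<Sum>t\<in>{t. t dvd m}. f t * g t * (theta * B) $ ((2 ^ j * (m div t))\<^sup>2)) = (B\<^sup>2) $ (2 * (2 ^ j * m))" ..
  also have "\<dots> = K * (\<Sum>t\<in>{t. t dvd m}. real t ^ 5)"
    unfolding K[OF m] ser_oo_nth[OF m] sum_pairs_divisors[OF m0] by simp
  finally show "(\<Sum>t\<in>{t. t dvd m}. f t * g t * (theta * B) $ ((2 ^ j * (m div t))\<^sup>2)) = K * (\<Sum>t\<in>{t. t dvd m}. real t ^ 5)" .
qed

lemma theta_eis3_chi4_nth:
  assumes "odd m"
  shows "(theta * eis3_chi4) $ ((2 ^ j * m)\<^sup>2) = 32 ^ j * s6 m"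
  unfolding s6_def
  by (rule theta_mult_eisenstein_nth_square[where f = "\<lambda>d. (real d)\<^sup>2" and g = chi4 and \<beta> = 0])
    (use assms in \<open>simp_all add: eis3_chi4_def[symmetric] power_mult_distrib chi4_mult Legendre_minus_4 eis3_chi4_square_nth odd_codiv5_nth\<close>)

lemma theta_dual3_chi4_nth:
  assumes "odd m"
  shows "(theta * (dual3_chi4 - fps_const (1 / 4))) $ ((2 ^ j * m)\<^sup>2) = (63 - 32 ^ Suc j) / 62 * s6 m"
  unfolding s6_def
  by (rule theta_mult_eisenstein_nth_square[where f = "\<lambda>d. (real d)\<^sup>2 * chi4 d" and g = "\<lambda>n. 1" and \<beta> = "1 / 4"])
    (use assms in \<open>simp_all add: dual3_chi4_def[symmetric] power_mult_distrib chi4_mult Legendre_minus_4 dual3_chi4_square_nth dual6_nth\<close>)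

lemma theta_eis3_chi8_nth:
  assumes "odd m"
  shows "(theta * eis3_chi8) $ ((2 ^ Suc j * m)\<^sup>2) = 36 * 32 ^ j * s5 m"
proof -
  have eq: "2 * (2 ^ Suc j * n) = 4 * (2 ^ j * n)" for n :: nat by simp
  show ?thesis
    unfolding s5_def
    by (rule theta_mult_eisenstein_nth_square[where f = "\<lambda>d. (real d)\<^sup>2" and g = chi8 and \<beta> = 0])
      (use assms in \<open>simp_all only: eq eis3_chi8_square_nth, simp_all add: eis3_chi8_def[symmetric] power_mult_distrib chi8_mult Legendre_minus_2 odd_codiv5_nth\<close>)
qed

lemma theta_dual3_chi8_nth:
  assumes "odd m"
  shows "(theta * (dual3_chi8 - fps_const (3 / 2))) $ ((2 ^ Suc j * m)\<^sup>2) = 18 * ((63 - 32 ^ Suc j) / 31) * s5 m"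
proof -
  have eq: "2 * (2 ^ Suc j * n) = 4 * (2 ^ j * n)" for n :: nat by simp
  show ?thesis
    unfolding s5_def
    by (rule theta_mult_eisenstein_nth_square[where f = "\<lambda>d. (real d)\<^sup>2 * chi8 d" and g = "\<lambda>n. 1" and \<beta> = "3 / 2"])
      (use assms in \<open>simp_all only: eq dual3_chi8_square_nth, simp_all add: dual3_chi8_def[symmetric] power_mult_distrib chi8_mult Legendre_minus_2 dual6_nth\<close>)
qed

section \<open>Representation numbers of septenary forms\<close>

definition solutions :: "nat list \<Rightarrow> nat \<Rightarrow> int list set" where
  "solutions as n = {x. length x = length as \<and> (\<Sum>i<length as. int (as ! i) * (x ! i)\<^sup>2) = int n}"

definition theta_scaled :: "nat \<Rightarrow> real fps" where
  "theta_scaled a = Abs_fps (\<lambda>n. real (card {j :: int. int a * j\<^sup>2 = int n}))"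

lemma finite_scaled_square_eq:
  assumes "a > 0"
  shows "finite {j :: int. int a * j\<^sup>2 = int n}"
proof (rule finite_subset)
  show "{j :: int. int a * j\<^sup>2 = int n} \<subseteq> {j. j\<^sup>2 \<le> int n}"
  proof clarify
    fix j :: int assume j: "int a * j\<^sup>2 = int n"
    have "1 * j\<^sup>2 \<le> int a * j\<^sup>2" using assms by (intro mult_right_mono) auto
    then show "j\<^sup>2 \<le> int n" using j by simp
  qed
qed (rule finite_int_square_le)

lemma solutions_theta:
  assumes "\<forall>a\<in>set as. 0 < a"
  shows "finite (solutions as n) \<and> real (card (solutions as n)) = prod_list (map theta_scaled as) $ n"
  using assms
proof (induction as arbitrary: n)
  case Nil
  have "solutions [] n = (if n = 0 then {[]} else {})" by (auto simp: solutions_def)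
  then show ?case by simp
next
  case (Cons a as)
  let ?J = "\<lambda>i. {j :: int. int a * j\<^sup>2 = int i}"
  let ?S = "SIGMA i:{0..n}. ?J i \<times> solutions as (n - i)"
  have IH: "finite (solutions as k)" "real (card (solutions as k)) = prod_list (map theta_scaled as) $ k" for k
    using Cons by auto
  have J: "finite (?J i)" for i using Cons.prems by (intro finite_scaled_square_eq) simp
  have finS: "finite ?S" using IH J by (intro finite_SigmaI finite_cartesian_product) auto
  have bij: "bij_betw (\<lambda>(i, j, y). j # y) ?S (solutions (a # as) n)"
  proof (rule bij_betw_byWitness[where f' = "\<lambda>x. (nat (int a * (hd x)\<^sup>2), hd x, tl x)"])
    show "\<forall>p\<in>?S. (\<lambda>x. (nat (int a * (hd x)\<^sup>2), hd x, tl x)) ((\<lambda>(i, j, y). j # y) p) = p"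
      by auto
    show "\<forall>x\<in>solutions (a # as) n. (\<lambda>(i, j, y). j # y) (nat (int a * (hd x)\<^sup>2), hd x, tl x) = x"
    proof
      fix x assume "x \<in> solutions (a # as) n"
      then have "length x = Suc (length as)" by (simp add: solutions_def)
      then show "(\<lambda>(i, j, y). j # y) (nat (int a * (hd x)\<^sup>2), hd x, tl x) = x" by (cases x) simp_all
    qed
    show "(\<lambda>(i, j, y). j # y) ` ?S \<subseteq> solutions (a # as) n"
      by (auto simp: solutions_def sum.lessThan_Suc_shift of_nat_diff simp del: sum.lessThan_Suc)
    show "(\<lambda>x. (nat (int a * (hd x)\<^sup>2), hd x, tl x)) ` solutions (a # as) n \<subseteq> ?S"
    proof (rule image_subsetI)
      fix x assume x: "x \<in> solutions (a # as) n"
      then have "length x = Suc (length as)" by (simp add: solutions_def)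
      then obtain j y where jy: "x = j # y" "length y = length as" by (cases x) auto
      have sum: "int a * j\<^sup>2 + (\<Sum>i<length as. int (as ! i) * (y ! i)\<^sup>2) = int n"
        using x unfolding jy(1) by (simp add: solutions_def sum.lessThan_Suc_shift del: sum.lessThan_Suc)
      have "(\<Sum>i<length as. int (as ! i) * (y ! i)\<^sup>2) \<ge> 0" by (intro sum_nonneg) simp
      then have le: "int a * j\<^sup>2 \<le> int n" using sum by linarith
      have ge: "0 \<le> int a * j\<^sup>2" by simp
      have "int (n - nat (int a * j\<^sup>2)) = int n - int a * j\<^sup>2"
        using le ge by (simp add: of_nat_diff nat_le_iff)
      then have "y \<in> solutions as (n - nat (int a * j\<^sup>2))"
        unfolding solutions_def using jy(2) sum by simp
      then show "(nat (int a * (hd x)\<^sup>2), hd x, tl x) \<in> ?S"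
        using le ge unfolding jy(1) by (simp add: nat_le_iff)
    qed
  qed
  have "real (card ?S) = (\<Sum>i=0..n. real (card (?J i)) * real (card (solutions as (n - i))))"
    using IH J by (subst card_SigmaI) (auto simp: card_cartesian_product)
  also have "\<dots> = (theta_scaled a * prod_list (map theta_scaled as)) $ n"
    unfolding fps_mult_nth IH(2) by (simp add: theta_scaled_def)
  finally have "real (card (solutions (a # as) n)) = (theta_scaled a * prod_list (map theta_scaled as)) $ n"
    using bij_betw_same_card[OF bij] by simp
  then show ?case using bij_betw_finite[OF bij] finS by simp
qed

lemma theta_scaled_1: "theta_scaled 1 = theta" "theta_scaled (Suc 0) = theta"
  by (simp_all add: theta_scaled_def theta_def)

lemma theta_scaled_double: "theta_scaled (2 * a) = dil (theta_scaled a)"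
proof (rule fps_ext)
  fix n
  show "theta_scaled (2 * a) $ n = dil (theta_scaled a) $ n"
  proof (cases "even n")
    case True
    then obtain k where k: "n = 2 * k" by (elim evenE)
    have "{j :: int. int (2 * a) * j\<^sup>2 = int n} = {j. int a * j\<^sup>2 = int k}" unfolding k by auto
    then show ?thesis using k by (simp add: theta_scaled_def dil_nth)
  next
    case False
    have "{j :: int. int (2 * a) * j\<^sup>2 = int n} = {}"
    proof (rule ccontr)
      assume "\<not> ?thesis"
      then obtain j :: int where "int (2 * a) * j\<^sup>2 = int n" by blast
      then have "int n = 2 * (int a * j\<^sup>2)" by simp
      then have "even (int n)" by (metis dvd_triv_left)
      then show False using False by simp
    qed
    then have "theta_scaled (2 * a) $ n = 0" by (simp only: theta_scaled_def fps_nth_Abs_fps card.empty of_nat_0)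
    then show ?thesis using False by (simp add: dil_nth)
  qed
qed

lemma r7_theta:
  assumes "i + j + l = 7"
  shows "real (r7 (mults i j l) n) = (theta ^ i * dil theta ^ j * dil (dil theta) ^ l) $ n"
proof -
  have len: "length (mults i j l) = 7" using assms by (simp add: mults_def)
  have "theta_scaled 2 = dil theta" using theta_scaled_double[of 1] by (simp add: theta_scaled_1)
  moreover have "theta_scaled 4 = dil (theta_scaled 2)" using theta_scaled_double[of 2] by simp
  ultimately have "prod_list (map theta_scaled (mults i j l)) = theta ^ i * dil theta ^ j * dil (dil theta) ^ l"
    by (simp add: mults_def theta_scaled_1 prod_list_replicate mult.assoc)
  moreover have "\<forall>a\<in>set (mults i j l). 0 < a" by (auto simp: mults_def)
  moreover have "r7 (mults i j l) n = card (solutions (mults i j l) n)"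
    unfolding r7_def solutions_def len ..
  ultimately show ?thesis using solutions_theta by simp
qed

text \<open>With b = \<open>theta_odd\<close> and c = theta(q^4), the two terms are the coefficients
  at 4 t of c^7 and of b^4 c^3, the latter with multiplicity kappa.\<close>

definition septenary :: "nat \<Rightarrow> nat \<Rightarrow> real" where
  "septenary \<kappa> t = (theta ^ 7) $ t + real \<kappa> * (theta ^ 3 * (4 * tX * tY)) $ t"

text \<open>The exponents of \<open>dil (dil theta)\<close> are divisible by 4 and those of \<open>theta_odd\<close> are 1 modulo 4.\<close>

lemma monomial_nth:
  assumes "q \<le> 7"
  shows "(theta_odd ^ q * dil (dil theta) ^ (7 - q)) $ (4 * t) =
    (if q = 0 then (theta ^ 7) $ t else if q = 4 then (theta ^ 3 * (4 * tX * tY)) $ t else 0)"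
proof -
  have dil2: "dil (dil f) $ (4 * t) = f $ t" for f
    using dil_nth_double[of "dil f" "2 * t"] by simp
  show ?thesis
  proof (cases "q = 0 \<or> q = 4")
    case True
    have "theta_odd ^ 4 = (dil tY)\<^sup>2" by (simp add: dil_tY)
    also have "\<dots> = dil (dil (4 * tX * tY))" by (simp add: dil_u_v flip: dil_power)
    finally have b4: "theta_odd ^ 4 = dil (dil (4 * tX * tY))" .
    have "dil (dil (theta ^ 3 * v)) = dil (dil v) * dil (dil theta) ^ 3" for v
      by (simp add: dil_mult dil_power mult.commute)
    then have "theta_odd ^ 4 * dil (dil theta) ^ 3 = dil (dil (theta ^ 3 * (4 * tX * tY)))"
      unfolding b4 by (rule sym)
    moreover have "dil (dil theta) ^ 7 = dil (dil (theta ^ 7))" by (simp add: dil_power)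
    ultimately show ?thesis using True by (auto simp: dil2)
  next
    case False
    have "supports 4 (q * 1 + (7 - q) * 0) (theta_odd ^ q * dil (dil theta) ^ (7 - q))"
      by (intro supports_mult supports_power supports_dil_dil_theta supports_mod[OF supports_theta_odd]) simp
    moreover have "q mod 4 \<noteq> 0" using False assms by presburger
    ultimately have "(theta_odd ^ q * dil (dil theta) ^ (7 - q)) $ (4 * t) = 0"
      by (auto simp: supports_def)
    then show ?thesis using False by simp
  qed
qed

lemma binomial_expansion:
  fixes x y :: "real fps"
  assumes "i \<le> N"
  shows "(x + y) ^ i = (\<Sum>p\<le>N. of_nat (i choose p) * x ^ p * y ^ (i - p))"
  unfolding binomial_ring by (rule sum.mono_neutral_left) (use assms in auto)

text \<open>The number of coefficients 2 is even, so theta(q^2) enters through its square b^2 + c^2.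
  The coefficient of b^4 in (b + c)^i (b^2 + c^2)^j c^l takes b^4 from the first factor, b^2 from
  each of the first two, or b^4 from the second.\<close>

theorem r7_multiple_of_4:
  assumes "i + 2 * j + l = 7"
  shows "real (r7 (mults i (2 * j) l) (4 * t)) = septenary ((i choose 4) + (i choose 2) * j + (j choose 2)) t"
proof -
  let ?c = "dil (dil theta)" and ?b = theta_odd
  let ?m = "\<lambda>q. if q = 0 then (theta ^ 7) $ t else if q = 4 then (theta ^ 3 * (4 * tX * tY)) $ t else 0"
  have "theta ^ i * dil theta ^ (2 * j) * ?c ^ l = (?b + ?c) ^ i * (?b\<^sup>2 + ?c\<^sup>2) ^ j * ?c ^ l"
    unfolding power_mult dil_theta_square by (subst (1) theta_split) (simp add: add.commute)
  also have "\<dots> = (\<Sum>p\<le>7. \<Sum>s\<le>3. of_nat ((i choose p) * (j choose s)) * (?b ^ (p + 2 * s) * ?c ^ (i - p + 2 * (j - s) + l)))"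
  proof -
    have "i \<le> 7" "j \<le> 3" using assms by auto
    then show ?thesis
      unfolding binomial_expansion[OF \<open>i \<le> 7\<close>] binomial_expansion[OF \<open>j \<le> 3\<close>] sum_product sum_distrib_right
      by (intro sum.cong refl) (simp add: sum_distrib_left power_add power_mult[symmetric] ac_simps)
  qed
  finally have "real (r7 (mults i (2 * j) l) (4 * t)) = (\<Sum>p\<le>7. \<Sum>s\<le>3. real ((i choose p) * (j choose s)) *
      (?b ^ (p + 2 * s) * ?c ^ (i - p + 2 * (j - s) + l)) $ (4 * t))"
    using assms by (simp add: r7_theta fps_sum_nth fps_of_nat[symmetric])
  also have "\<dots> = (\<Sum>p\<le>7. \<Sum>s\<le>3. real ((i choose p) * (j choose s)) * ?m (p + 2 * s))"
  proof (intro sum.cong refl)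
    fix p s :: nat
    show "real ((i choose p) * (j choose s)) * (?b ^ (p + 2 * s) * ?c ^ (i - p + 2 * (j - s) + l)) $ (4 * t) =
        real ((i choose p) * (j choose s)) * ?m (p + 2 * s)"
    proof (cases "p \<le> i \<and> s \<le> j")
      case True
      then have "i - p + 2 * (j - s) + l = 7 - (p + 2 * s)" "p + 2 * s \<le> 7" using assms by auto
      then show ?thesis using monomial_nth[of "p + 2 * s" t] by simp
    qed auto
  qed
  also have "\<dots> = septenary ((i choose 4) + (i choose 2) * j + (j choose 2)) t"
    by (simp add: eval_nat_numeral septenary_def algebra_simps)
  finally show ?thesis .
qed

text \<open>\<open>u\<close> is the classical formula for sums of six squares by both weight 3
  Eisenstein series. By \<open>v\<close> the second part involves \<open>eis3_chi4\<close> alone, so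
  kappa affects only the coefficient of 32^j.\<close>

lemma septenary_nth_square:
  assumes "odd m"
  shows "septenary \<kappa> ((2 ^ j * m)\<^sup>2) = (16 * (1 + real \<kappa>) * 32 ^ j - 2 * (63 - 32 ^ Suc j) / 31) * s6 m"
proof -
  have v: "theta\<^sup>2 * (4 * tX * tY) = 16 * eis3_chi4"
    using eis3_chi4_theta theta_square by Groebner_Basis.algebra
  have "4 * fps_const (1 / 4 :: real) = 1" by (simp add: numeral_fps_const)
  then have u: "theta ^ 6 = 16 * eis3_chi4 - 4 * (dual3_chi4 - fps_const (1 / 4))"
    using dual3_chi4_theta eis3_chi4_theta theta_square by Groebner_Basis.algebra
  have t7: "theta ^ 7 = 16 * (theta * eis3_chi4) - 4 * (theta * (dual3_chi4 - fps_const (1 / 4)))"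
    using u by Groebner_Basis.algebra
  have t3: "theta ^ 3 * (4 * tX * tY) = 16 * (theta * eis3_chi4)"
    using v by Groebner_Basis.algebra
  show ?thesis
    unfolding septenary_def t7 t3 fps_sub_nth numeral_mult_nth theta_eis3_chi4_nth[OF assms] theta_dual3_chi4_nth[OF assms]
    by (simp add: field_simps)
qed

lemma r7_s6:
  assumes "odd m" "i + 2 * j + l = 7"
  shows "real (r7 (mults i (2 * j) l) (2 ^ (2 * Suc k) * m\<^sup>2)) =
    (16 * (1 + real ((i choose 4) + (i choose 2) * j + (j choose 2))) * 32 ^ k - 2 * (63 - 32 ^ Suc k) / 31) * s6 m"
proof -
  have "2 ^ (2 * Suc k) * m\<^sup>2 = 4 * (2 ^ k * m)\<^sup>2"
    by (simp add: power_mult_distrib power_mult[symmetric] mult.commute)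
  then show ?thesis
    unfolding septenary_nth_square[OF assms(1), symmetric] by (simp only: r7_multiple_of_4[OF assms(2)])
qed

text \<open>Odd powers of \<open>dil theta\<close> bring in the series for \<open>chi8\<close>.
  Their squares are known at multiples of 4 only, hence the positive exponent
  \<open>Suc k\<close>.\<close>

lemma r7_s5:
  assumes "odd m"
  shows "3 * real (r7 (mults 6 1 0) (2 ^ (2 * Suc k) * m\<^sup>2)) = (1152 * 32 ^ k - 36 * (63 - 32 ^ Suc k) / 31) * s5 m"
    and "3 * real (r7 (mults 4 3 0) (2 ^ (2 * Suc k) * m\<^sup>2)) = (576 * 32 ^ k - 36 * (63 - 32 ^ Suc k) / 31) * s5 m"
    and "3 * real (r7 (mults 2 5 0) (2 ^ (2 * Suc k) * m\<^sup>2)) = (288 * 32 ^ k - 36 * (63 - 32 ^ Suc k) / 31) * s5 m"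
proof -
  define N where "N = (2 ^ Suc k * m)\<^sup>2"
  define B where "B = dual3_chi8 - fps_const (3 / 2)"
  have N: "2 ^ (2 * Suc k) * m\<^sup>2 = N"
    by (simp add: N_def power_mult_distrib power_mult[symmetric] mult.commute)
  have "2 * fps_const (3 / 2 :: real) = 3" by (simp add: numeral_fps_const)
  then have "2 * B = 2 * dual3_chi8 - 3" by (simp add: B_def right_diff_distrib)
  then have B: "2 * B = - (theta * dil theta * (tX - tY) * (3 * tX + tY))"
    unfolding dual3_chi8_theta by simp
  have C: "(dil theta)\<^sup>2 = tX" by (simp add: tX_def)
  note basic = B eis3_chi8_theta theta_square C
  have nth: "(theta * eis3_chi8) $ N = 36 * 32 ^ k * s5 m" "(theta * B) $ N = 18 * ((63 - 32 ^ Suc k) / 31) * s5 m"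
    unfolding N_def B_def by (fact theta_eis3_chi8_nth[OF assms] theta_dual3_chi8_nth[OF assms])+
  have r: "real (r7 (mults 6 1 0) N) = (theta ^ 6 * dil theta) $ N"
    "real (r7 (mults 4 3 0) N) = (theta ^ 4 * dil theta ^ 3) $ N"
    "real (r7 (mults 2 5 0) N) = (theta\<^sup>2 * dil theta ^ 5) $ N"
    by (simp_all add: r7_theta)
  have "3 * (theta ^ 6 * dil theta) = 32 * (theta * eis3_chi8) - 2 * (theta * B)"
    using basic by Groebner_Basis.algebra
  from arg_cong[OF this, of "\<lambda>f. f $ N", unfolded fps_sub_nth numeral_mult_nth nth]
  show "3 * real (r7 (mults 6 1 0) (2 ^ (2 * Suc k) * m\<^sup>2)) = (1152 * 32 ^ k - 36 * (63 - 32 ^ Suc k) / 31) * s5 m"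
    unfolding N r by (simp add: algebra_simps)
  have "3 * (theta\<^sup>2 * dil theta ^ 5) = 8 * (theta * eis3_chi8) - 2 * (theta * B)"
    using basic by Groebner_Basis.algebra
  from arg_cong[OF this, of "\<lambda>f. f $ N", unfolded fps_sub_nth numeral_mult_nth nth]
  show "3 * real (r7 (mults 2 5 0) (2 ^ (2 * Suc k) * m\<^sup>2)) = (288 * 32 ^ k - 36 * (63 - 32 ^ Suc k) / 31) * s5 m"
    unfolding N r by (simp add: algebra_simps)
  \<comment> \<open>Besides the two Eisenstein contributions this form has an odd series, which
    vanishes at the even number N.\<close>
  have "3 * (theta ^ 4 * dil theta ^ 3) = 16 * (theta * eis3_chi8) - 2 * (theta * B) + tY * (dil theta * (tX\<^sup>2 - tY\<^sup>2))"
    using basic by Groebner_Basis.algebra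
  moreover have "odd_series (tY * (dil theta * (tX\<^sup>2 - tY\<^sup>2)))"
    by (intro odd_series_tY_mult even_series_intros even_series_dil)
  moreover have "even N" by (simp add: N_def)
  ultimately have "(3 * (theta ^ 4 * dil theta ^ 3)) $ N = (16 * (theta * eis3_chi8) - 2 * (theta * B)) $ N"
    by (simp add: odd_series_nth)
  from this[unfolded fps_sub_nth numeral_mult_nth nth] show "3 * real (r7 (mults 4 3 0) (2 ^ (2 * Suc k) * m\<^sup>2)) = (576 * 32 ^ k - 36 * (63 - 32 ^ Suc k) / 31) * s5 m"
    unfolding N r by (simp add: algebra_simps)
qed

theorem corollary4p4:
  fixes k m :: nat
  assumes "k \<ge> 1" and "m \<ge> 1" and "odd m"
  shows "real (r7 (mults 6 1 0) (2 ^ (2 * k) * m\<^sup>2)) =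
      12 * ((2 ^ (5 * k + 5) - 63) / (2 ^ 5 - 1)) * s5 m \<and>
    r7 (mults 5 2 0) (2 ^ (2 * k) * m\<^sup>2) = r7 (mults 6 0 1) (2 ^ (2 * k) * m\<^sup>2) \<and>
    real (r7 (mults 6 0 1) (2 ^ (2 * k) * m\<^sup>2)) =
      (250 * 2 ^ (5 * k) - 126) / (2 ^ 5 - 1) * s6 m \<and>
    real (r7 (mults 4 3 0) (2 ^ (2 * k) * m\<^sup>2)) =
      (198 * 2 ^ (5 * k) - 756) / (2 ^ 5 - 1) * s5 m \<and>
    r7 (mults 3 4 0) (2 ^ (2 * k) * m\<^sup>2) = r7 (mults 4 2 1) (2 ^ (2 * k) * m\<^sup>2) \<and>
    real (r7 (mults 4 2 1) (2 ^ (2 * k) * m\<^sup>2)) =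
      126 * ((2 ^ (5 * k) - 1) / (2 ^ 5 - 1)) * s6 m \<and>
    real (r7 (mults 2 5 0) (2 ^ (2 * k) * m\<^sup>2)) =
      (105 * 2 ^ (5 * k) - 756) / (2 ^ 5 - 1) * s5 m \<and>
    real (r7 (mults 5 0 2) (2 ^ (2 * k) * m\<^sup>2)) =
      (95 * 2 ^ (5 * k) - 126) / (2 ^ 5 - 1) * s6 m \<and>
    r7 (mults 3 0 4) (2 ^ (2 * k) * m\<^sup>2) = r7 (mults 2 0 5) (2 ^ (2 * k) * m\<^sup>2) \<and>
    r7 (mults 2 0 5) (2 ^ (2 * k) * m\<^sup>2) = r7 (mults 1 0 6) (2 ^ (2 * k) * m\<^sup>2) \<and>
    r7 (mults 1 0 6) (2 ^ (2 * k) * m\<^sup>2) = r7 (mults 1 2 4) (2 ^ (2 * k) * m\<^sup>2) \<and>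
    real (r7 (mults 1 2 4) (2 ^ (2 * k) * m\<^sup>2)) =
      (35 * 2 ^ (5 * k - 1) - 126) / (2 ^ 5 - 1) * s6 m \<and>
    r7 (mults 3 2 2) (2 ^ (2 * k) * m\<^sup>2) = r7 (mults 2 4 1) (2 ^ (2 * k) * m\<^sup>2) \<and>
    r7 (mults 2 4 1) (2 ^ (2 * k) * m\<^sup>2) = r7 (mults 1 6 0) (2 ^ (2 * k) * m\<^sup>2) \<and>
    real (r7 (mults 1 6 0) (2 ^ (2 * k) * m\<^sup>2)) =
      (2 ^ (5 * k + 6) - 126) / (2 ^ 5 - 1) * s6 m \<and>
    r7 (mults 2 2 3) (2 ^ (2 * k) * m\<^sup>2) = r7 (mults 1 4 2) (2 ^ (2 * k) * m\<^sup>2) \<and>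
    r7 (mults 1 4 2) (2 ^ (2 * k) * m\<^sup>2) = r7 (mults 4 0 3) (2 ^ (2 * k) * m\<^sup>2) \<and>
    real (r7 (mults 4 0 3) (2 ^ (2 * k) * m\<^sup>2)) =
      (33 * 2 ^ (5 * k) - 126) / (2 ^ 5 - 1) * s6 m"
proof -
  let ?N = "2 ^ (2 * k) * m\<^sup>2"
  obtain j where k: "k = Suc j" using assms(1) by (cases k) auto
  have pow: "2 ^ (5 * n) = (32 :: real) ^ n" for n by (simp add: power_mult)
  have pow': "2 ^ (5 * k - 1) = 16 * (32 :: real) ^ j"
  proof -
    have "5 * k - 1 = 4 + 5 * j" by (simp add: k)
    then show ?thesis by (simp add: power_add pow)
  qed
  have kp: "32 ^ k = 32 * (32 :: real) ^ j" by (simp add: k)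
  note s6 = r7_s6[OF assms(3), where k = j, folded k]
  note s5 = r7_s5[OF assms(3), where k = j, folded k]
  have r5: "real (r7 (mults 6 1 0) ?N) = 12 * ((2 ^ (5 * k + 5) - 63) / (2 ^ 5 - 1)) * s5 m"
    "real (r7 (mults 4 3 0) ?N) = (198 * 2 ^ (5 * k) - 756) / (2 ^ 5 - 1) * s5 m"
    "real (r7 (mults 2 5 0) ?N) = (105 * 2 ^ (5 * k) - 756) / (2 ^ 5 - 1) * s5 m"
    using s5 unfolding power_add pow kp by (simp_all add: field_simps)
  \<comment> \<open>Here j = k - 1. Over the denominator 31 the coefficient of 32^j is 496 (1 +
    kappa) + 64 = 560 + 496 kappa.\<close>
  have r6: "real (r7 (mults i (2 * q) l) ?N) = ((560 + 496 * real \<kappa>) * 32 ^ j - 126) / 31 * s6 m"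
    if "i + 2 * q + l = 7" "(i choose 4) + (i choose 2) * q + (q choose 2) = \<kappa>" for i q l \<kappa>
    using s6[OF that(1)] unfolding that(2) kp by (simp add: field_simps)
  \<comment> \<open>The six values of kappa, one for each group of forms with equal representation
    numbers.\<close>
  have c: "((560 + 496 * real 15) * 32 ^ j - 126) / 31 = (250 * 2 ^ (5 * k) - 126) / (2 ^ 5 - 1 :: real)"
    "((560 + 496 * real 7) * 32 ^ j - 126) / 31 = 126 * ((2 ^ (5 * k) - 1) / (2 ^ 5 - 1 :: real))"
    "((560 + 496 * real 5) * 32 ^ j - 126) / 31 = (95 * 2 ^ (5 * k) - 126) / (2 ^ 5 - 1 :: real)"
    "((560 + 496 * real 0) * 32 ^ j - 126) / 31 = (35 * 2 ^ (5 * k - 1) - 126) / (2 ^ 5 - 1 :: real)"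
    "((560 + 496 * real 3) * 32 ^ j - 126) / 31 = (2 ^ (5 * k + 6) - 126) / (2 ^ 5 - 1 :: real)"
    "((560 + 496 * real 1) * 32 ^ j - 126) / 31 = (33 * 2 ^ (5 * k) - 126) / (2 ^ 5 - 1 :: real)"
    unfolding power_add pow pow' kp by (simp_all add: field_simps)
  have binom: "6 choose 4 = (15 :: nat)" "5 choose 4 = (5 :: nat)" "4 choose 4 = (1 :: nat)" "3 choose 4 = (0 :: nat)"
    "2 choose 4 = (0 :: nat)" "1 choose 4 = (0 :: nat)" "6 choose 2 = (15 :: nat)" "5 choose 2 = (10 :: nat)"
    "4 choose 2 = (6 :: nat)" "3 choose 2 = (3 :: nat)" "2 choose 2 = (1 :: nat)" "1 choose 2 = (0 :: nat)"
    by (simp_all add: eval_nat_numeral)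
  have r520: "real (r7 (mults 5 2 0) ?N) = (250 * 2 ^ (5 * k) - 126) / (2 ^ 5 - 1) * s6 m"
    using r6[of 5 1 0 15] unfolding c by (simp add: binom)
  have r601: "real (r7 (mults 6 0 1) ?N) = (250 * 2 ^ (5 * k) - 126) / (2 ^ 5 - 1) * s6 m"
    using r6[of 6 0 1 15] unfolding c by (simp add: binom)
  have r340: "real (r7 (mults 3 4 0) ?N) = 126 * ((2 ^ (5 * k) - 1) / (2 ^ 5 - 1)) * s6 m"
    using r6[of 3 2 0 7] unfolding c by (simp add: binom)
  have r421: "real (r7 (mults 4 2 1) ?N) = 126 * ((2 ^ (5 * k) - 1) / (2 ^ 5 - 1)) * s6 m"
    using r6[of 4 1 1 7] unfolding c by (simp add: binom)
  have r502: "real (r7 (mults 5 0 2) ?N) = (95 * 2 ^ (5 * k) - 126) / (2 ^ 5 - 1) * s6 m"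
    using r6[of 5 0 2 5] unfolding c by (simp add: binom)
  have r304: "real (r7 (mults 3 0 4) ?N) = (35 * 2 ^ (5 * k - 1) - 126) / (2 ^ 5 - 1) * s6 m"
    using r6[of 3 0 4 0] unfolding c by (simp add: binom)
  have r205: "real (r7 (mults 2 0 5) ?N) = (35 * 2 ^ (5 * k - 1) - 126) / (2 ^ 5 - 1) * s6 m"
    using r6[of 2 0 5 0] unfolding c by (simp add: binom)
  have r106: "real (r7 (mults 1 0 6) ?N) = (35 * 2 ^ (5 * k - 1) - 126) / (2 ^ 5 - 1) * s6 m"
    using r6[of 1 0 6 0] unfolding c by (simp add: binom)
  have r124: "real (r7 (mults 1 2 4) ?N) = (35 * 2 ^ (5 * k - 1) - 126) / (2 ^ 5 - 1) * s6 m"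
    using r6[of 1 1 4 0] unfolding c by (simp add: binom)
  have r322: "real (r7 (mults 3 2 2) ?N) = (2 ^ (5 * k + 6) - 126) / (2 ^ 5 - 1) * s6 m"
    using r6[of 3 1 2 3] unfolding c by (simp add: binom)
  have r241: "real (r7 (mults 2 4 1) ?N) = (2 ^ (5 * k + 6) - 126) / (2 ^ 5 - 1) * s6 m"
    using r6[of 2 2 1 3] unfolding c by (simp add: binom)
  have r160: "real (r7 (mults 1 6 0) ?N) = (2 ^ (5 * k + 6) - 126) / (2 ^ 5 - 1) * s6 m"
    using r6[of 1 3 0 3] unfolding c by (simp add: binom)
  have r223: "real (r7 (mults 2 2 3) ?N) = (33 * 2 ^ (5 * k) - 126) / (2 ^ 5 - 1) * s6 m"
    using r6[of 2 1 3 1] unfolding c by (simp add: binom)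
  have r142: "real (r7 (mults 1 4 2) ?N) = (33 * 2 ^ (5 * k) - 126) / (2 ^ 5 - 1) * s6 m"
    using r6[of 1 2 2 1] unfolding c by (simp add: binom)
  have r403: "real (r7 (mults 4 0 3) ?N) = (33 * 2 ^ (5 * k) - 126) / (2 ^ 5 - 1) * s6 m"
    using r6[of 4 0 3 1] unfolding c by (simp add: binom)
  show ?thesis
    unfolding r5 of_nat_eq_iff[where 'a = real, symmetric] r520 r601 r340 r421 r502 r304 r205 r106 r124 r322 r241 r160
      r223 r142 r403 by (intro conjI refl)
qed

end
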